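(* Let $U$ be the set of partition quadruples $$U=\{(\pi_1,\pi_2,\pi_3,\pi_4): \ell(\pi_4)\le 2s(\pi_1)<\infty \text{ and } s(\pi_1)\le s(\pi_i)\text{ for } i=2,3,4\},$$ and let $V$ be the set of those $(\pi_1,\pi_2,\pi_3,\pi_4)\in U$ for which the smallest part of $\pi_1$ appears at least twice in $\pi_1$. Then for all integers $m$ and all integers $n\ge 1$, $ru(m,n)$ is the number of partition quadruples of $n$ from $U$ with $u$-rank equal to $m$, and $rv(m,n)$ is the number of partition quadruples of $n$ from $V$ with $v$-rank equal to $m$. Furthermore, for every integer $n\ge 0$: (i) the residue of the $u$-rank mod $3$ divides the partition quadruples of $3n$ from $U$ into $3$ equal classes; (ii) the residue of the $v$-rank mod $3$ divides the partition quadruples of $3n+1$ from $V$ into $3$ equal classes; (iii) the residue of the $u$-rank mod $5$ divides the partition quadruples of $5n$ from $U$, and those of $5n+3$ from $U$, into $5$ equal classes; (iv) the residue of the $v$-rank mod $5$ divides the partition quadruples of $5n+1$ from $V$, and those of $5n+4$ from $V$, into $5$ equal classes; and (v) the residue of the $u$-rank mod $7$ divides the partition quadruples of $7n$ from $U$, and those of $7n+5$ from $U$, into $7$ equal classes. Here "the residue of the rank mod $\ell$ divides a finite set of quadruples into $\ell$ equal classes" means that for each residue class $k$ modulo $\ell$ the number of quadruples in the set whose rank is congruent to $k$ modulo $\ell$ is the same.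
   Context: A partition is a (possibly empty) finite non-increasing sequence of positive integers (its parts). For a partition $\pi$, $s(\pi)$ is its smallest part, $\ell(\pi)$ its largest part, and $\#(\pi)$ its number of parts; the empty partition has $s=\infty$, $\ell=0$, $\#=0$. A quadruple $(\pi_1,\pi_2,\pi_3,\pi_4)$ of partitions is a partition quadruple of $n$ if all parts of $\pi_1,\pi_2,\pi_3,\pi_4$ together sum to $n$. (The condition $s(\pi_1)<\infty$ means $\pi_1$ is non-empty.) Let $\omega(\pi_1,\pi_2,\pi_3,\pi_4)$ be the number of parts of $\pi_1$ (counted with multiplicity) that are either equal to $s(\pi_1)$ or larger than $s(\pi_1)+\#(\pi_4)$; if $\#(\pi_4)=0$ then $\omega=\#(\pi_1)$. Define $$u\text{-rank}(\pi_1,\pi_2,\pi_3,\pi_4)=\omega(\pi_1,\pi_2,\pi_3,\pi_4)-1+2\#(\pi_2)-2\#(\pi_3)-\#(\pi_4),$$ $$v\text{-rank}(\pi_1,\pi_2,\pi_3,\pi_4)=\omega(\pi_1,\pi_2,\pi_3,\pi_4)-2+2\#(\pi_2)-2\#(\pi_3)-\#(\pi_4).$$ Notation: $(z;q)_n=\prod_{j=0}^{n-1}(1-zq^j)$, $(z;q)_\infty=\prod_{j=0}^\infty(1-zq^j)$, $(z_1,\dots,z_k;q)_n=(z_1;q)_n\cdots(z_k;q)_n$ (also for $n=\infty$). Define $$RU(z,q)=\frac{(q;q)_\infty}{(z,z^{-1},z^2,z^{-2};q)_\infty}\sum_{n=1}^\infty\frac{(z,z^{-1},z^2,z^{-2};q)_n\,q^n}{(q;q)_{2n}}=\sum_{n=1}^\infty\frac{q^n(q^{2n+1};q)_\infty}{(zq^n,z^{-1}q^n,z^2q^n,z^{-2}q^n;q)_\infty},$$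 $$RV(z,q)=\frac{(q;q)_\infty}{(z,z^{-1},z^2,z^{-2};q)_\infty}\sum_{n=1}^\infty\frac{(z,z^{-1},z^2,z^{-2};q)_n\,q^{2n}}{(q;q)_{2n}}=\sum_{n=1}^\infty\frac{q^{2n}(q^{2n+1};q)_\infty}{(zq^n,z^{-1}q^n,z^2q^n,z^{-2}q^n;q)_\infty}.$$ The integers $ru(m,n)$ and $rv(m,n)$ are defined by expanding the right-hand forms as power series in $q$ whose coefficients are Laurent polynomials in $z$: $$RU(z,q)=\sum_{n=1}^\infty\sum_{m=-\infty}^\infty ru(m,n)z^mq^n,\qquad RV(z,q)=\sum_{n=1}^\infty\sum_{m=-\infty}^\infty rv(m,n)z^mq^n.$$ *)

theory Defs
  imports
    "HOL-Analysis.Analysis"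
    "HOL-Library.Poly_Mapping"
    "HOL-Library.Extended_Nat"
    "HOL-Number_Theory.Cong"
begin

section \<open>Partitions and partition quadruples\<close>

definition is_partition :: "nat list \<Rightarrow> bool" where
  "is_partition p \<longleftrightarrow> sorted_wrt (\<ge>) p \<and> (\<forall>x\<in>set p. 0 < x)"

definition smallest_part :: "nat list \<Rightarrow> enat" where
  "smallest_part p = (if p = [] then \<infinity> else enat (Min (set p)))"

definition largest_part :: "nat list \<Rightarrow> nat" where
  "largest_part p = (if p = [] then 0 else Max (set p))"

type_synonym quadruple = "nat list \<times> nat list \<times> nat list \<times> nat list"

definition is_partition_quadruple_of :: "nat \<Rightarrow> quadruple \<Rightarrow> bool" where
  "is_partition_quadruple_of n = (\<lambda>(p1, p2, p3, p4).
     is_partition p1 \<and> is_partition p2 \<and> is_partition p3 \<and> is_partition p4 \<and>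
     sum_list p1 + sum_list p2 + sum_list p3 + sum_list p4 = n)"

definition U_set :: "quadruple set" where
  "U_set = {(p1, p2, p3, p4).
     is_partition p1 \<and> is_partition p2 \<and> is_partition p3 \<and> is_partition p4 \<and>
     enat (largest_part p4) \<le> 2 * smallest_part p1 \<and> 2 * smallest_part p1 < \<infinity> \<and>
     smallest_part p1 \<le> smallest_part p2 \<and>
     smallest_part p1 \<le> smallest_part p3 \<and>
     smallest_part p1 \<le> smallest_part p4}"

definition V_set :: "quadruple set" where
  "V_set = {(p1, p2, p3, p4) \<in> U_set.
     2 \<le> length (filter (\<lambda>x. enat x = smallest_part p1) p1)}"

definition quadruples_in :: "quadruple set \<Rightarrow> nat \<Rightarrow> quadruple set" where
  "quadruples_in S n = {Q \<in> S. is_partition_quadruple_of n Q}"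

lemma finite_quadruples_in: "finite (quadruples_in S n)"
proof -
  let ?L = "{xs. set xs \<subseteq> {..n} \<and> length xs \<le> n}"
  have len: "length xs \<le> sum_list xs" if "is_partition xs" for xs
    using that unfolding is_partition_def by (induction xs) (auto simp: Suc_le_eq)
  have L: "xs \<in> ?L" if "is_partition xs" "sum_list xs \<le> n" for xs
  proof -
    have "x \<le> n" if "x \<in> set xs" for x
      using member_le_sum_list[OF that] \<open>sum_list xs \<le> n\<close> by linarith
    then show ?thesis using len[OF that(1)] that(2) by auto
  qed
  have "quadruples_in S n \<subseteq> ?L \<times> ?L \<times> ?L \<times> ?L"
  proof
    fix Q assume Q: "Q \<in> quadruples_in S n"
    obtain p1 p2 p3 p4 where [simp]: "Q = (p1, p2, p3, p4)" by (cases Q)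
    have "is_partition p1" "is_partition p2" "is_partition p3" "is_partition p4"
      and "sum_list p1 + sum_list p2 + sum_list p3 + sum_list p4 = n"
      using Q by (simp_all add: quadruples_in_def is_partition_quadruple_of_def)
    then have "p1 \<in> ?L" "p2 \<in> ?L" "p3 \<in> ?L" "p4 \<in> ?L"
      by (intro L; linarith)+
    then show "Q \<in> ?L \<times> ?L \<times> ?L \<times> ?L" by simp
  qed
  moreover have "finite ?L"
    by (rule finite_lists_length_le) simp
  ultimately show ?thesis
    by (elim finite_subset) (intro finite_cartesian_product)
qed


section \<open>Ranks\<close>

definition omega :: "quadruple \<Rightarrow> nat" where
  "omega = (\<lambda>(p1, p2, p3, p4).
     if length p4 = 0 then length p1
     else length (filter (\<lambda>x. enat x = smallest_part p1 \<or>
                              smallest_part p1 + enat (length p4) < enat x) p1))"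

definition u_rank :: "quadruple \<Rightarrow> int" where
  "u_rank = (\<lambda>(p1, p2, p3, p4). int (omega (p1, p2, p3, p4)) - 1
     + 2 * int (length p2) - 2 * int (length p3) - int (length p4))"

definition v_rank :: "quadruple \<Rightarrow> int" where
  "v_rank = (\<lambda>(p1, p2, p3, p4). int (omega (p1, p2, p3, p4)) - 2
     + 2 * int (length p2) - 2 * int (length p3) - int (length p4))"

definition divides_into_equal_classes ::
    "(quadruple \<Rightarrow> int) \<Rightarrow> nat \<Rightarrow> quadruple set \<Rightarrow> bool" where
  "divides_into_equal_classes rk l S \<longleftrightarrow>
     (\<forall>k k' :: int. card {Q \<in> S. [rk Q = k] (mod int l)} = card {Q \<in> S. [rk Q = k'] (mod int l)})"


section \<open>The generating functions\<close>

text \<open>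
  Laurent polynomials in \<open>z\<close> over the integers are the finitely supported maps
  from exponents to coefficients (with convolution as product). The variable \<open>q\<close> is
  the indeterminate \<^term>\<open>fps_X\<close> of power series over them; infinite sums and
  products are limits in the \<open>q\<close>-adic topology of \<^typ>\<open>'a fps\<close>.
\<close>

type_synonym laurent_poly = "int \<Rightarrow>\<^sub>0 int"

abbreviation q :: "laurent_poly fps" where
  "q \<equiv> fps_X"

definition z_pow :: "int \<Rightarrow> laurent_poly fps" where
  "z_pow k = fps_const (Poly_Mapping.single k 1)"

definition qpoch_inf :: "laurent_poly fps \<Rightarrow> laurent_poly fps" where
  "qpoch_inf a = prodinf (\<lambda>j. 1 - a * q ^ j)"

text \<open>
  Laurent polynomials carry no \<^const>\<open>inverse\<close>, so the reciprocal is taken with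
  \<^const>\<open>fps_right_inverse\<close>; it is only meaningful for constant term 1.
\<close>

definition recip :: "laurent_poly fps \<Rightarrow> laurent_poly fps" where
  "recip f = fps_right_inverse f 1"

definition summand :: "nat \<Rightarrow> laurent_poly fps" where
  "summand n = qpoch_inf (q ^ (2 * n + 1)) *
     recip (qpoch_inf (z_pow 1 * q ^ n) * qpoch_inf (z_pow (-1) * q ^ n) *
            qpoch_inf (z_pow 2 * q ^ n) * qpoch_inf (z_pow (-2) * q ^ n))"

text \<open>The sums start at \<open>n = 1\<close>, hence the shift by \<^const>\<open>Suc\<close>.\<close>

definition RU :: "laurent_poly fps" where
  "RU = suminf (\<lambda>n. q ^ Suc n * summand (Suc n))"

definition RV :: "laurent_poly fps" where
  "RV = suminf (\<lambda>n. q ^ (2 * Suc n) * summand (Suc n))"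

definition ru :: "int \<Rightarrow> nat \<Rightarrow> int" where
  "ru m n = Poly_Mapping.lookup (fps_nth RU n) m"

definition rv :: "int \<Rightarrow> nat \<Rightarrow> int" where
  "rv m n = Poly_Mapping.lookup (fps_nth RV n) m"

text \<open>The limits and reciprocals above exist.\<close>

lemma tendsto_fps_coeffwise:
  fixes F :: "nat \<Rightarrow> 'a::comm_ring_1 fps"
  assumes "\<And>m n. m \<le> n \<Longrightarrow> fps_nth (F n) m = fps_nth G m"
  shows "F \<longlonglongrightarrow> G"
proof (rule tendsto_fpsI)
  fix m
  show "\<forall>\<^sub>F n in sequentially. fps_nth (F n) m = fps_nth G m"
    using eventually_ge_at_top[of m] by eventually_elim (rule assms)
qed

lemma qpoch_inf_has_prod:
  assumes "fps_nth a 0 = 0"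
  shows "(\<lambda>j. 1 - a * q ^ j) has_prod qpoch_inf a"
    and "fps_nth (qpoch_inf a) 0 = 1"
proof -
  let ?P = "\<lambda>n. \<Prod>j\<le>n. 1 - a * q ^ j"
  have coeff_Suc: "fps_nth (?P (Suc n)) m = fps_nth (?P n) m" if "m \<le> n" for n m
  proof -
    have "?P (Suc n) = ?P n - q ^ Suc n * (?P n * a)"
      by (simp add: algebra_simps)
    then show ?thesis
      using that by (simp only: fps_sub_nth fps_X_power_mult_nth) simp
  qed
  have stable: "fps_nth (?P n) m = fps_nth (?P m) m" if "m \<le> n" for n m
    using that
  proof (induction n rule: dec_induct)
    case (step n)
    then show ?case using coeff_Suc[of m n] by (simp only:)
  qed (rule refl)
  define G where "G = Abs_fps (\<lambda>m. fps_nth (?P m) m)"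
  have lim: "?P \<longlonglongrightarrow> G"
    by (rule tendsto_fps_coeffwise) (simp only: G_def fps_nth_Abs_fps, rule stable)
  have G0: "fps_nth G 0 = 1"
    using assms by (simp add: G_def)
  then have hp: "(\<lambda>j. 1 - a * q ^ j) has_prod G"
    unfolding has_prod_def raw_has_prod_def using lim by auto
  have "qpoch_inf a = G"
    unfolding qpoch_inf_def using has_prod_unique[OF hp] by simp
  then show "(\<lambda>j. 1 - a * q ^ j) has_prod qpoch_inf a" "fps_nth (qpoch_inf a) 0 = 1"
    using hp G0 by simp_all
qed

lemma mult_recip:
  assumes "fps_nth f 0 = 1"
  shows "f * recip f = 1"
  unfolding recip_def using assms by (intro fps_right_inverse) simp

lemma sums_of_dvd_power:
  fixes F :: "nat \<Rightarrow> laurent_poly fps"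
  assumes "\<And>n. n < k n"
  shows "(\<lambda>n. q ^ k n * F n) sums suminf (\<lambda>n. q ^ k n * F n)"
proof -
  let ?T = "\<lambda>n. q ^ k n * F n"
  define G where "G = Abs_fps (\<lambda>m. fps_nth (\<Sum>n<m. ?T n) m)"
  have stable: "fps_nth (\<Sum>i<n. ?T i) m = fps_nth (\<Sum>i<m. ?T i) m" if "m \<le> n" for n m
    using that
  proof (induction n rule: dec_induct)
    case (step n)
    then show ?case using assms[of n] by (simp add: fps_X_power_mult_nth)
  qed simp
  have "?T sums G"
    unfolding sums_def by (rule tendsto_fps_coeffwise) (simp only: G_def fps_nth_Abs_fps, rule stable)
  then show ?thesis by (simp add: sums_iff)
qed

lemma RU_sums: "(\<lambda>n. q ^ Suc n * summand (Suc n)) sums RU"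
  unfolding RU_def by (rule sums_of_dvd_power) simp

lemma RV_sums: "(\<lambda>n. q ^ (2 * Suc n) * summand (Suc n)) sums RV"
  unfolding RV_def by (rule sums_of_dvd_power) simp

end

theory Submission
  imports Defs
begin

text \<open>
  Let \<open>n\<close> be the smallest part of \<open>\<pi>\<^sub>1\<close> and remove one copy of it. What remains is a quadruple of
  partitions into parts \<open>\<ge> n\<close>, with the parts of \<open>\<pi>\<^sub>4\<close> at most \<open>2n\<close>; if \<open>\<pi>\<^sub>4\<close> has \<open>k\<close> parts, a part of
  \<open>\<pi>\<^sub>1\<close> counts for the rank unless it lies in \<open>{n+1..n+k}\<close>. For fixed \<open>k\<close> the four partitions are
  independent and have product generating functions, and the sum over \<open>k\<close> is the q-binomial theorem.
  The result is the \<open>n\<close>-th summand of \<open>RU\<close> and \<open>RV\<close> without its power of \<open>q\<close> (\<open>gf_fill\<close>), which is the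
  combinatorial interpretation of \<open>ru\<close> and \<open>rv\<close>. The argument needs only that the weight of a rank is
  multiplicative, so it applies to Laurent monomials and equally to the powers of a complex number
  \<open>x\<close>.

  For the congruences, finite Fourier analysis reduces equal class sizes modulo \<open>l\<close> to the vanishing
  of the sums of \<open>x powi rank\<close> for all \<open>x\<close> with \<open>x ^ l = 1\<close> and \<open>x \<noteq> 1\<close>. Their generating function is
  an explicit quotient. With \<open>y = x\<^sup>2\<close>, the finite Jacobi triple product expands
  \<open>(x, 1/x; q)\<^sub>n / (q; q)\<^sub>2\<^sub>n\<close> in terms of \<open>1 / ((q; q)\<^sub>n\<^sub>-\<^sub>r (q; q)\<^sub>n\<^sub>+\<^sub>r)\<close>; the sum over \<open>n\<close> of the latter against
  \<open>q ^ n (y, 1/y; q)\<^sub>n\<close> telescopes (\<open>bsum_telescope\<close>). In the limit the rank generating function times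
  a theta function in \<open>x\<close> becomes a bilateral Lambert series (\<open>gf_times_theta\<close>).

  If \<open>x ^ l = 1\<close>, both series split over the residue classes modulo \<open>l\<close>: the theta function into
  theta functions, the Lambert series into Appell sums, all with base \<open>Q ^ l\<close> for \<open>Q = q ^ l\<close> and with
  arguments that are powers of \<open>Q\<close>. The exchange identity for Appell sums (\<open>appell_exchange\<close>), proved
  by comparing coefficients in an auxiliary variable, supplies enough linear relations to divide the
  Lambert series by the theta function: the quotient is a sum of terms \<open>q ^ k g\<^sub>k(q ^ l)\<close> in which only
  certain residues \<open>k\<close> occur (\<open>lambert_3\<close>, \<open>lambert_U5\<close>, \<open>lambert_V5\<close>, \<open>lambert_U7\<close>). Averaging over the
  \<open>l\<close>-th roots of unity in \<open>q\<close> shows that the coefficients in the missing residue classes vanish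
  (\<open>coeffs_vanish_of_dissection\<close>), and these classes are the arithmetic progressions of the theorem.
\<close>

section \<open>Truncated equality of power series and finite Pochhammer products\<close>

text \<open>
  Agreement of all coefficients below \<open>N\<close>. The passages to the limit in the q-identities below go
  through this relation: it is a congruence, and it makes sense over every commutative ring.
\<close>

definition fps_eq :: "nat \<Rightarrow> 'a::comm_ring_1 fps \<Rightarrow> 'a fps \<Rightarrow> bool" where
  "fps_eq N f g \<longleftrightarrow> (\<forall>m<N. fps_nth f m = fps_nth g m)"

lemma fps_eq_refl [simp]: "fps_eq N f f" by (simp add: fps_eq_def)
lemma fps_eq_sym: "fps_eq N f g \<Longrightarrow> fps_eq N g f" by (simp add: fps_eq_def)
lemma fps_eq_trans [trans]: "fps_eq N f g \<Longrightarrow> fps_eq N g h \<Longrightarrow> fps_eq N f h" by (simp add: fps_eq_def)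
lemma fps_eq_mono: "fps_eq N f g \<Longrightarrow> M \<le> N \<Longrightarrow> fps_eq M f g" by (simp add: fps_eq_def)
lemma fps_eq_add: "fps_eq N f g \<Longrightarrow> fps_eq N f' g' \<Longrightarrow> fps_eq N (f + f') (g + g')" by (simp add: fps_eq_def)
lemma fps_eq_mult: "fps_eq N f g \<Longrightarrow> fps_eq N f' g' \<Longrightarrow> fps_eq N (f * f') (g * g')"
  by (auto simp: fps_eq_def fps_mult_nth intro!: sum.cong)
lemma fps_eqI: "(\<And>N. fps_eq N f g) \<Longrightarrow> f = g"
  unfolding fps_eq_def by (rule fps_ext) blast
lemma fps_eq_sum: "(\<And>i. i \<in> A \<Longrightarrow> fps_eq N (f i) (g i)) \<Longrightarrow> fps_eq N (sum f A) (sum g A)"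
  by (simp add: fps_eq_def fps_sum_nth)
lemma fps_eq_X_power_mult: "N \<le> k \<Longrightarrow> fps_eq N (fps_X ^ k * f) 0"
  by (simp add: fps_eq_def fps_X_power_mult_nth)

text \<open>
  The finite product \<open>(a; q)\<^sub>n\<close>, with \<^const>\<open>fps_X\<close> in the role of \<open>q\<close>.
\<close>

definition fpoch :: "'a::comm_ring_1 fps \<Rightarrow> nat \<Rightarrow> 'a fps" where
  "fpoch a n = (\<Prod>j<n. 1 - a * fps_X ^ j)"

text \<open>
  The infinite product \<open>(a; q)\<^sub>\<infinity>\<close>. From the factor with \<open>j = Suc m\<close> on, no factor changes the
  coefficient of order \<open>m\<close>, so that it can be read off a finite product, whatever the constant term of
  \<open>a\<close> is.
\<close>

definition fpinf :: "'a::comm_ring_1 fps \<Rightarrow> 'a fps" where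
  "fpinf a = Abs_fps (\<lambda>m. fps_nth (fpoch a (Suc m)) m)"

lemma fpoch_0 [simp]: "fpoch a 0 = 1" by (simp add: fpoch_def)

lemma fpoch_Suc: "fpoch a (Suc n) = fpoch a n * (1 - a * fps_X ^ n)"
  by (simp add: fpoch_def mult.commute)

lemma fpoch_add: "fpoch a (m + n) = fpoch a m * fpoch (a * fps_X ^ m) n"
  by (induction n) (simp_all add: fpoch_Suc power_add mult_ac)

lemma fpoch_Suc_left: "fpoch a (Suc n) = (1 - a) * fpoch (a * fps_X) n"
  using fpoch_add[of a 1 n] by (simp add: fpoch_Suc)

lemma fps_eq_fpoch: "m \<le> n \<Longrightarrow> fps_eq m (fpoch a n) (fpoch a m)"
proof (induction n rule: dec_induct)
  case (step n)
  have "fpoch a (Suc n) = fpoch a n + fps_X ^ n * (- (fpoch a n * a))"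
    by (simp add: fpoch_Suc algebra_simps)
  also have "fps_eq m \<dots> (fpoch a m + 0)"
    using step by (intro fps_eq_add fps_eq_X_power_mult) auto
  finally show ?case by simp
qed simp

lemma fps_eq_fpinf: "fps_eq n (fpinf a) (fpoch a n)"
  unfolding fps_eq_def
proof safe
  fix m assume "m < n"
  thus "fps_nth (fpinf a) m = fps_nth (fpoch a n) m"
    using fps_eq_fpoch[of "Suc m" n a] by (simp add: fpinf_def fps_eq_def)
qed

lemma fpinf_split: "fpinf a = fpoch a n * fpinf (a * fps_X ^ n)"
proof (rule fps_eqI)
  fix N
  have "fps_eq N (fpinf a) (fpoch a (n + N))"
    by (rule fps_eq_mono[OF fps_eq_fpinf]) simp
  also have "fpoch a (n + N) = fpoch a n * fpoch (a * fps_X ^ n) N" by (rule fpoch_add)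
  also have "fps_eq N \<dots> (fpoch a n * fpinf (a * fps_X ^ n))"
    by (intro fps_eq_mult fps_eq_refl fps_eq_sym[OF fps_eq_fpinf])
  finally show "fps_eq N (fpinf a) (fpoch a n * fpinf (a * fps_X ^ n))" .
qed

lemma fpoch_nth_0: "fps_nth a 0 = 0 \<Longrightarrow> fps_nth (fpoch a n) 0 = 1"
  by (induction n) (simp_all add: fpoch_Suc)

lemma fpinf_nth_0: "fps_nth (fpinf a) 0 = 1 - fps_nth a 0"
  by (simp add: fpinf_def fpoch_Suc)

lemma fpoch_X_nth_0: "fps_nth (fpoch fps_X k :: 'a::comm_ring_1 fps) 0 = 1"
  by (rule fpoch_nth_0) simp

lemma fps_unit_cancel:
  fixes f g h :: "'a::comm_ring_1 fps"
  assumes "f * g = f * h" "fps_nth f 0 = 1"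
  shows "g = h"
proof -
  define i where "i = fps_right_inverse f 1"
  have "f * i = 1" unfolding i_def using assms by (intro fps_right_inverse) simp
  hence "i * f = 1" by (simp add: mult.commute)
  thus ?thesis using arg_cong[OF assms(1), of "\<lambda>x. i * x"] by (simp flip: mult.assoc)
qed

section \<open>Partitions with bounded-below parts\<close>

definition parts_ge :: "nat \<Rightarrow> nat list set" where
  "parts_ge n = {p. is_partition p \<and> (\<forall>x\<in>set p. n \<le> x)}"

definition bounded_parts :: "nat \<Rightarrow> nat \<Rightarrow> nat \<Rightarrow> nat list set" where
  "bounded_parts n m k = {p. is_partition p \<and> set p \<subseteq> {n..n + m} \<and> length p = k}"

lemma finite_partitions: "finite {p. is_partition p \<and> sum_list p = m}"
proof -
  have "quadruples_in (Collect is_partition \<times> {([], [], [])}) m = {p. is_partition p \<and> sum_list p = m} \<times> {([], [], [])}"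
    by (auto simp: quadruples_in_def is_partition_quadruple_of_def is_partition_def)
  moreover have "finite (quadruples_in (Collect is_partition \<times> {([], [], [])}) m)" by (rule finite_quadruples_in)
  ultimately have "finite ({p. is_partition p \<and> sum_list p = m} \<times> {([] :: nat list, [] :: nat list, [] :: nat list)})" by simp
  thus ?thesis by (rule finite_cartesian_productD1) simp
qed

lemma is_partition_snoc: "is_partition (p @ [n]) \<longleftrightarrow> is_partition p \<and> 0 < n \<and> (\<forall>x\<in>set p. n \<le> x)"
  by (auto simp: is_partition_def sorted_wrt_append)

lemma is_partition_Cons: "is_partition (n # p) \<longleftrightarrow> is_partition p \<and> 0 < n \<and> (\<forall>x\<in>set p. x \<le> n)"
  by (auto simp: is_partition_def)

text \<open>
  A partition into parts \<open>\<ge> n\<close> either avoids \<open>n\<close> or ends in a copy of \<open>n\<close>. For generating functions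
  this is the recursion \<open>parts_gf_Suc\<close>.
\<close>

lemma parts_ge_decompose:
  assumes "n > 0"
  shows "parts_ge n = parts_ge (Suc n) \<union> (\<lambda>p. p @ [n]) ` parts_ge n"
    and "parts_ge (Suc n) \<inter> (\<lambda>p. p @ [n]) ` parts_ge n = {}"
proof -
  show "parts_ge (Suc n) \<inter> (\<lambda>p. p @ [n]) ` parts_ge n = {}" by (auto simp: parts_ge_def)
  show "parts_ge n = parts_ge (Suc n) \<union> (\<lambda>p. p @ [n]) ` parts_ge n"
  proof (intro equalityI subsetI)
    fix p assume p: "p \<in> parts_ge n"
    show "p \<in> parts_ge (Suc n) \<union> (\<lambda>p. p @ [n]) ` parts_ge n"
    proof (cases "n \<in> set p")
      case False
      have "Suc n \<le> x" if "x \<in> set p" for x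
      proof -
        have "n \<le> x" using p that by (auto simp: parts_ge_def)
        moreover have "n \<noteq> x" using False that by blast
        ultimately show ?thesis by simp
      qed
      thus ?thesis using p by (auto simp: parts_ge_def)
    next
      case True
      hence "p \<noteq> []" by auto
      then obtain p' y where py: "p = p' @ [y]" by (metis append_butlast_last_id)
      have "y = n" using p True by (auto simp: py parts_ge_def is_partition_snoc intro: antisym)
      thus ?thesis using p by (auto simp: py parts_ge_def is_partition_snoc)
    qed
  next
    fix p assume "p \<in> parts_ge (Suc n) \<union> (\<lambda>p. p @ [n]) ` parts_ge n"
    thus "p \<in> parts_ge n" using assms by (auto simp: parts_ge_def is_partition_snoc)
  qed
qed

lemma bounded_parts_0: "bounded_parts n 0 k = (if n = 0 \<and> k > 0 then {} else {replicate k n})"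
proof -
  have "p = replicate k n" if "set p \<subseteq> {n}" "length p = k" for p
    using that by (metis replicate_eqI singletonD subsetD)
  moreover have "is_partition (replicate k n)" if "\<not> (n = 0 \<and> k > 0)"
    using that by (induction k) (auto simp: is_partition_Cons is_partition_def)
  moreover have "\<not> is_partition (replicate k n)" if "n = 0 \<and> k > 0"
    using that by (auto simp: is_partition_def)
  ultimately show ?thesis by (auto simp: bounded_parts_def)
qed

text \<open>
  The dichotomy for the largest admissible part is Pascal's rule for Gaussian binomials.
\<close>

lemma bounded_parts_decompose:
  assumes "n > 0"
  shows "bounded_parts n (Suc m) (Suc k) = bounded_parts n m (Suc k) \<union> (\<lambda>p. (n + Suc m) # p) ` bounded_parts n (Suc m) k"
    and "bounded_parts n m (Suc k) \<inter> (\<lambda>p. (n + Suc m) # p) ` bounded_parts n (Suc m) k = {}"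
proof -
  show "bounded_parts n m (Suc k) \<inter> (\<lambda>p. (n + Suc m) # p) ` bounded_parts n (Suc m) k = {}" by (auto simp: bounded_parts_def)
  show "bounded_parts n (Suc m) (Suc k) = bounded_parts n m (Suc k) \<union> (\<lambda>p. (n + Suc m) # p) ` bounded_parts n (Suc m) k"
  proof (intro equalityI subsetI)
    fix p assume p: "p \<in> bounded_parts n (Suc m) (Suc k)"
    then obtain y p' where py: "p = y # p'" by (cases p) (auto simp: bounded_parts_def)
    show "p \<in> bounded_parts n m (Suc k) \<union> (\<lambda>p. (n + Suc m) # p) ` bounded_parts n (Suc m) k"
    proof (cases "y = n + Suc m")
      case True
      thus ?thesis using p by (auto simp: py bounded_parts_def is_partition_Cons)
    next
      case False
      hence "y \<le> n + m" using p by (auto simp: py bounded_parts_def)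
      hence "\<forall>x\<in>set p. x \<le> n + m" using p by (auto simp: py bounded_parts_def is_partition_Cons intro: order_trans)
      thus ?thesis using p by (auto simp: bounded_parts_def)
    qed
  next
    fix p assume "p \<in> bounded_parts n m (Suc k) \<union> (\<lambda>p. (n + Suc m) # p) ` bounded_parts n (Suc m) k"
    thus "p \<in> bounded_parts n (Suc m) (Suc k)" using assms by (auto simp: bounded_parts_def is_partition_Cons subset_iff)
  qed
qed

definition quad_size :: "quadruple \<Rightarrow> nat" where
  "quad_size = (\<lambda>(p1, p2, p3, p4). sum_list p1 + (sum_list p2 + (sum_list p3 + sum_list p4)))"

text \<open>
  The contribution of a part of \<open>\<pi>\<^sub>1\<close> to \<^const>\<open>omega\<close> when \<open>n\<close> is the smallest part and \<open>k\<close> the number of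
  parts of \<open>\<pi>\<^sub>4\<close>.
\<close>

definition part_wt :: "nat \<Rightarrow> nat \<Rightarrow> nat \<Rightarrow> int" where
  "part_wt n k x = (if x = n \<or> n + k < x then 1 else 0)"

text \<open>
  The u-rank after a further part \<open>n\<close> has been put into \<open>\<pi>\<^sub>1\<close>: that part always counts for \<^const>\<open>omega\<close>
  and cancels the constant \<open>- 1\<close>. Every summand is a sum over the parts of one partition once \<open>length \<pi>\<^sub>4\<close>
  is known.
\<close>

definition core_rank :: "nat \<Rightarrow> quadruple \<Rightarrow> int" where
  "core_rank n = (\<lambda>(p1, p2, p3, p4). (\<Sum>x\<leftarrow>p1. part_wt n (length p4) x) + ((\<Sum>x\<leftarrow>p2. 2) + ((\<Sum>x\<leftarrow>p3. - 2) + - int (length p4))))"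

text \<open>
  The number \<open>k\<close> of parts of \<open>\<pi>\<^sub>4\<close> is fixed since the weights of the parts of \<open>\<pi>\<^sub>1\<close> depend on it; this
  makes the four components independent.
\<close>

definition core :: "nat \<Rightarrow> nat \<Rightarrow> quadruple set" where
  "core n k = parts_ge n \<times> parts_ge n \<times> parts_ge n \<times> bounded_parts n n k"

section \<open>Weighted generating functions\<close>

text \<open>
  A rank \<open>k\<close> is recorded by \<open>z k\<close>. Two instances are used: the monomials of the Laurent polynomial
  ring, and \<open>x powi k\<close> for a complex \<open>x \<noteq> 0\<close>.
\<close>

locale rank_weight =
  fixes z :: "int \<Rightarrow> 'a::comm_ring_1"
  assumes z_0 [simp]: "z 0 = 1" and z_add: "z (j + k) = z j * z k"
begin

definition Z :: "int \<Rightarrow> 'a fps" where "Z k = fps_const (z k)"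

lemma Z_0 [simp]: "Z 0 = 1" by (simp add: Z_def)
lemma Z_add: "Z (j + k) = Z j * Z k" by (simp add: Z_def z_add)
lemma Z_minus_cancel [simp]: "Z (- k) * Z k = 1" using Z_add[of "- k" k] by simp

definition gf :: "'b set \<Rightarrow> ('b \<Rightarrow> nat) \<Rightarrow> ('b \<Rightarrow> int) \<Rightarrow> 'a fps" where
  "gf S w r = Abs_fps (\<lambda>n. \<Sum>x\<in>{x\<in>S. w x = n}. z (r x))"

definition fibers_finite :: "'b set \<Rightarrow> ('b \<Rightarrow> nat) \<Rightarrow> bool" where
  "fibers_finite S w \<longleftrightarrow> (\<forall>n. finite {x\<in>S. w x = n})"

lemma fibers_finite_subset: "fibers_finite T w \<Longrightarrow> S \<subseteq> T \<Longrightarrow> fibers_finite S w"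
  unfolding fibers_finite_def
proof
  fix n assume *: "\<forall>n. finite {x\<in>T. w x = n}" "S \<subseteq> T"
  show "finite {x\<in>S. w x = n}"
    by (rule finite_subset[of _ "{x\<in>T. w x = n}"]) (use * in auto)
qed

lemma gf_union:
  assumes "fibers_finite (S \<union> T) w" "S \<inter> T = {}"
  shows "gf (S \<union> T) w r = gf S w r + gf T w r"
proof (rule fps_ext)
  fix n
  have "{x \<in> S \<union> T. w x = n} = {x\<in>S. w x = n} \<union> {x\<in>T. w x = n}" by auto
  moreover have "finite {x\<in>S. w x = n}" "finite {x\<in>T. w x = n}"
    using fibers_finite_subset[OF assms(1), of S] fibers_finite_subset[OF assms(1), of T] by (auto simp: fibers_finite_def)
  ultimately show "fps_nth (gf (S \<union> T) w r) n = fps_nth (gf S w r + gf T w r) n"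
    using assms(2) by (simp add: gf_def, subst sum.union_disjoint) auto
qed

lemma gf_singleton: "gf {x} w r = Z (r x) * fps_X ^ w x"
proof (rule fps_ext)
  fix n
  have "{y \<in> {x}. w y = n} = (if w x = n then {x} else {})" by auto
  thus "fps_nth (gf {x} w r) n = fps_nth (Z (r x) * fps_X ^ w x) n"
    by (simp add: gf_def Z_def)
qed

lemma gf_cong:
  assumes "\<And>x. x \<in> S \<Longrightarrow> r x = r' x"
  shows "gf S w r = gf S w r'"
  unfolding gf_def using assms by (intro arg_cong[of _ _ Abs_fps] ext sum.cong) auto

lemma gf_image:
  assumes "inj_on f S" "\<And>x. x \<in> S \<Longrightarrow> w (f x) = w' x + c" "\<And>x. x \<in> S \<Longrightarrow> r (f x) = r' x + k"
  shows "gf (f ` S) w r = Z k * fps_X ^ c * gf S w' r'"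
proof (rule fps_ext)
  fix n
  have "fps_nth (gf (f ` S) w r) n = (\<Sum>x\<in>{x\<in>S. w' x + c = n}. z (r (f x)))"
  proof -
    have "{y \<in> f ` S. w y = n} = f ` {x\<in>S. w' x + c = n}" using assms by auto
    moreover have "inj_on f {x\<in>S. w' x + c = n}" using assms(1) by (rule inj_on_subset) auto
    ultimately show ?thesis by (simp add: gf_def sum.reindex o_def)
  qed
  also have "\<dots> = (\<Sum>x\<in>{x\<in>S. w' x + c = n}. z k * z (r' x))"
    by (rule sum.cong) (use assms(3) in \<open>auto simp: z_add mult.commute\<close>)
  also have "\<dots> = z k * (if n < c then 0 else fps_nth (gf S w' r') (n - c))"
  proof (cases "n < c")
    case True
    hence "{x\<in>S. w' x + c = n} = {}" by auto
    thus ?thesis using True by simp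
  next
    case False
    hence "{x\<in>S. w' x + c = n} = {x\<in>S. w' x = n - c}" by auto
    thus ?thesis using False by (simp add: gf_def sum_distrib_left)
  qed
  also have "\<dots> = fps_nth (Z k * fps_X ^ c * gf S w' r') n"
    by (simp add: Z_def mult.assoc fps_X_power_mult_nth)
  finally show "fps_nth (gf (f ` S) w r) n = fps_nth (Z k * fps_X ^ c * gf S w' r') n" .
qed

lemma gf_times:
  assumes "fibers_finite S w" "fibers_finite T w'"
  shows "gf (S \<times> T) (\<lambda>(x, y). w x + w' y) (\<lambda>(x, y). r x + r' y) = gf S w r * gf T w' r'"
    and "fibers_finite (S \<times> T) (\<lambda>(x, y). w x + w' y)"
proof -
  have eq: "{p \<in> S \<times> T. (\<lambda>(x, y). w x + w' y) p = n} = (\<Union>i\<in>{0..n}. {x\<in>S. w x = i} \<times> {y\<in>T. w' y = n - i})" for n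
    by auto
  have fin: "finite ({x\<in>S. w x = i} \<times> {y\<in>T. w' y = j})" for i j
    using assms by (auto simp: fibers_finite_def)
  show "fibers_finite (S \<times> T) (\<lambda>(x, y). w x + w' y)"
    unfolding fibers_finite_def eq by (auto intro: fin)
  show "gf (S \<times> T) (\<lambda>(x, y). w x + w' y) (\<lambda>(x, y). r x + r' y) = gf S w r * gf T w' r'"
  proof (rule fps_ext)
    fix n
    have "fps_nth (gf (S \<times> T) (\<lambda>(x, y). w x + w' y) (\<lambda>(x, y). r x + r' y)) n
       = (\<Sum>p\<in>(\<Union>i\<in>{0..n}. {x\<in>S. w x = i} \<times> {y\<in>T. w' y = n - i}). z (case p of (x, y) \<Rightarrow> r x + r' y))"
      unfolding gf_def fps_nth_Abs_fps eq ..
    also have "\<dots> = (\<Sum>i\<in>{0..n}. \<Sum>p\<in>{x\<in>S. w x = i} \<times> {y\<in>T. w' y = n - i}. z (case p of (x, y) \<Rightarrow> r x + r' y))"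
      by (rule sum.UNION_disjoint) (use fin in auto)
    also have "\<dots> = (\<Sum>i=0..n. fps_nth (gf S w r) i * fps_nth (gf T w' r') (n - i))"
      by (rule sum.cong[OF refl])
         (simp add: gf_def sum_product sum.cartesian_product z_add case_prod_unfold)
    finally show "fps_nth (gf (S \<times> T) (\<lambda>(x, y). w x + w' y) (\<lambda>(x, y). r x + r' y)) n = fps_nth (gf S w r * gf T w' r') n"
      by (simp add: fps_mult_nth)
  qed
qed

lemma fibers_finite_partition:
  assumes "\<And>p. p \<in> S \<Longrightarrow> is_partition p"
  shows "fibers_finite S sum_list"
  unfolding fibers_finite_def
proof
  fix n
  show "finite {p\<in>S. sum_list p = n}"
    by (rule finite_subset[OF _ finite_partitions[of n]]) (use assms in auto)
qed

definition parts_gf :: "(nat \<Rightarrow> int) \<Rightarrow> nat \<Rightarrow> 'a fps" where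
  "parts_gf wt n = gf (parts_ge n) sum_list (\<lambda>p. \<Sum>x\<leftarrow>p. wt x)"

lemma parts_gf_Suc:
  assumes "n > 0"
  shows "(1 - Z (wt n) * fps_X ^ n) * parts_gf wt n = parts_gf wt (Suc n)"
proof -
  have "parts_gf wt n = parts_gf wt (Suc n) + gf ((\<lambda>p. p @ [n]) ` parts_ge n) sum_list (\<lambda>p. \<Sum>x\<leftarrow>p. wt x)"
  proof -
    have "fibers_finite (parts_ge (Suc n) \<union> (\<lambda>p. p @ [n]) ` parts_ge n) sum_list"
      unfolding parts_ge_decompose(1)[OF assms, symmetric]
      by (rule fibers_finite_partition) (simp add: parts_ge_def)
    from gf_union[OF this parts_ge_decompose(2)[OF assms]] show ?thesis
      unfolding parts_gf_def parts_ge_decompose(1)[OF assms, symmetric] .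
  qed
  also have "gf ((\<lambda>p. p @ [n]) ` parts_ge n) sum_list (\<lambda>p. \<Sum>x\<leftarrow>p. wt x) = Z (wt n) * fps_X ^ n * parts_gf wt n"
    unfolding parts_gf_def by (rule gf_image) (auto simp: inj_on_def)
  finally have "parts_gf wt n - Z (wt n) * fps_X ^ n * parts_gf wt n = parts_gf wt (Suc n)"
    by (metis add_diff_cancel_right')
  thus ?thesis by (simp only: left_diff_distrib mult_1_left)
qed

lemma fps_eq_parts_gf: "fps_eq n (parts_gf wt n) 1"
  unfolding fps_eq_def
proof safe
  fix m assume m: "m < n"
  have "{p \<in> parts_ge n. sum_list p = m} = (if m = 0 then {[]} else {})"
  proof -
    have "p = []" if "p \<in> parts_ge n" "sum_list p = m" for p
    proof (rule ccontr)
      assume "p \<noteq> []"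
      then obtain x where "x \<in> set p" by (cases p) auto
      hence "n \<le> x" "x \<le> sum_list p" using that by (auto simp: parts_ge_def member_le_sum_list)
      thus False using that m by simp
    qed
    moreover have "[] \<in> parts_ge n" by (simp add: parts_ge_def is_partition_def)
    moreover have "sum_list [] = (0::nat)" by simp
    ultimately show ?thesis by (cases "m = 0") force+
  qed
  thus "fps_nth (parts_gf wt n) m = fps_nth 1 m" by (simp add: parts_gf_def gf_def)
qed

lemma parts_gf_steps:
  assumes "n > 0" "\<And>i. i < k \<Longrightarrow> wt (n + i) = c"
  shows "fpoch (Z c * fps_X ^ n) k * parts_gf wt n = parts_gf wt (n + k)"
  using assms(2)
proof (induction k)
  case (Suc k)
  have "fpoch (Z c * fps_X ^ n) (Suc k) * parts_gf wt n = (1 - Z c * fps_X ^ (n + k)) * (fpoch (Z c * fps_X ^ n) k * parts_gf wt n)"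
    by (simp add: fpoch_Suc power_add mult_ac)
  also have "\<dots> = (1 - Z (wt (n + k)) * fps_X ^ (n + k)) * parts_gf wt (n + k)"
    using Suc by simp
  also have "\<dots> = parts_gf wt (n + Suc k)"
    using parts_gf_Suc[of "n + k" wt] assms(1) by simp
  finally show ?case .
qed simp

lemma parts_gf_const:
  assumes "n > 0" "\<And>i. i \<ge> n \<Longrightarrow> wt i = c"
  shows "fpinf (Z c * fps_X ^ n) * parts_gf wt n = 1"
proof (rule fps_eqI)
  fix N
  have "fps_eq N (fpinf (Z c * fps_X ^ n) * parts_gf wt n) (fpoch (Z c * fps_X ^ n) N * parts_gf wt n)"
    by (intro fps_eq_mult fps_eq_fpinf fps_eq_refl)
  also have "fpoch (Z c * fps_X ^ n) N * parts_gf wt n = parts_gf wt (n + N)"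
    by (rule parts_gf_steps) (use assms in auto)
  also have "fps_eq N \<dots> 1" by (rule fps_eq_mono[OF fps_eq_parts_gf]) simp
  finally show "fps_eq N (fpinf (Z c * fps_X ^ n) * parts_gf wt n) 1" .
qed

definition bounded_gf :: "nat \<Rightarrow> nat \<Rightarrow> nat \<Rightarrow> 'a fps" where
  "bounded_gf n m k = gf (bounded_parts n m k) sum_list (\<lambda>_. 0)"

text \<open>
  The Gaussian binomial coefficient for partitions in a box, without division so that it holds in
  every commutative ring.
\<close>

lemma bounded_gf_eq:
  assumes n: "n > 0"
  shows "fpoch fps_X k * bounded_gf n m k = fps_X ^ (n * k) * fpoch (fps_X ^ (m + 1)) k"
proof (induction "m + k" arbitrary: m k)
  case (0 m k)
  have "gf {[]} sum_list (\<lambda>_. 0) = 1"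
    by (simp add: gf_singleton)
  thus ?case using 0 n by (simp add: bounded_gf_def bounded_parts_0)
next
  case (Suc s m k)
  show ?case
  proof (cases k)
    case 0
    have "bounded_parts n m 0 = {[]}" by (auto simp: bounded_parts_def is_partition_def)
    moreover have "gf {[]} sum_list (\<lambda>_. 0) = 1"
      by (simp add: gf_singleton)
    ultimately show ?thesis using 0 by (simp add: bounded_gf_def)
  next
    case k: (Suc k')
    show ?thesis
    proof (cases m)
      case 0
      have "gf {replicate k n} sum_list (\<lambda>_. 0) = fps_X ^ (n * k)"
        by (simp add: gf_singleton sum_list_replicate mult.commute)
      thus ?thesis using 0 n by (simp add: bounded_gf_def bounded_parts_0)
    next
      case m: (Suc m')
      have "bounded_gf n m k = bounded_gf n m' k + gf ((\<lambda>p. (n + m) # p) ` bounded_parts n m k') sum_list (\<lambda>_. 0)"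
      proof -
        have "fibers_finite (bounded_parts n m' (Suc k') \<union> (\<lambda>p. (n + Suc m') # p) ` bounded_parts n (Suc m') k') sum_list"
          unfolding bounded_parts_decompose(1)[OF n, symmetric]
          by (rule fibers_finite_partition) (simp add: bounded_parts_def)
        from gf_union[OF this bounded_parts_decompose(2)[OF n]] show ?thesis
          unfolding bounded_gf_def m k bounded_parts_decompose(1)[OF n, symmetric] .
      qed
      also have "gf ((\<lambda>p. (n + m) # p) ` bounded_parts n m k') sum_list (\<lambda>_. 0) = Z 0 * fps_X ^ (n + m) * bounded_gf n m k'"
        unfolding bounded_gf_def by (rule gf_image) (auto simp: inj_on_def)
      finally have "fpoch fps_X k * bounded_gf n m k = fpoch fps_X k * bounded_gf n m' k + (1 - fps_X ^ k) * fps_X ^ (n + m) * (fpoch fps_X k' * bounded_gf n m k')"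
        by (simp add: k fpoch_Suc algebra_simps)
      also have "fpoch fps_X k * bounded_gf n m' k = fps_X ^ (n * k) * fpoch (fps_X ^ (m' + 1)) k"
        by (rule Suc.hyps) (use Suc.hyps(2) m in simp)
      also have "fpoch fps_X k' * bounded_gf n m k' = fps_X ^ (n * k') * fpoch (fps_X ^ (m + 1)) k'"
        by (rule Suc.hyps) (use Suc.hyps(2) k in simp)
      also have "fpoch (fps_X ^ (m' + 1)) k = (1 - fps_X ^ m) * fpoch (fps_X ^ (m + 1)) k'"
        by (simp add: k m fpoch_Suc_left mult.commute flip: power_Suc)
      also have "fps_X ^ (n * k) * ((1 - fps_X ^ m) * fpoch (fps_X ^ (m + 1)) k') + (1 - fps_X ^ k) * fps_X ^ (n + m) * (fps_X ^ (n * k') * fpoch (fps_X ^ (m + 1)) k')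
         = fps_X ^ (n * k) * fpoch (fps_X ^ (m + 1)) k"
        by (simp add: k fpoch_Suc algebra_simps power_add)
      finally show ?thesis .
    qed
  qed
qed

lemma gf_core:
  "gf (core n k) quad_size (core_rank n) =
     parts_gf (part_wt n k) n * (parts_gf (\<lambda>_. 2) n * (parts_gf (\<lambda>_. - 2) n * (Z (- int k) * bounded_gf n n k)))"
  "fibers_finite (core n k) quad_size"
proof -
  have f: "fibers_finite (parts_ge n) sum_list" "fibers_finite (bounded_parts n n k) sum_list"
    by (rule fibers_finite_partition, simp add: parts_ge_def bounded_parts_def)+
  note t3 = gf_times(1)[OF f, of "\<lambda>p. \<Sum>x\<leftarrow>p. - 2" "\<lambda>_. - int k"] gf_times(2)[OF f]
  note t2 = gf_times(1)[OF f(1) t3(2), of "\<lambda>p. \<Sum>x\<leftarrow>p. 2" "\<lambda>(x, y). (\<Sum>x\<leftarrow>x. - 2) + - int k"] gf_times(2)[OF f(1) t3(2)]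
  note t1 = gf_times(1)[OF f(1) t2(2), of "\<lambda>p. \<Sum>x\<leftarrow>p. part_wt n k x" "\<lambda>(x, y, z). (\<Sum>x\<leftarrow>x. 2) + ((\<Sum>x\<leftarrow>y. - 2) + - int k)"]
     gf_times(2)[OF f(1) t2(2)]
  have w: "quad_size = (\<lambda>(x, y). sum_list x + (case y of (x, y) \<Rightarrow> sum_list x + (case y of (x, y) \<Rightarrow> sum_list x + sum_list y)))"
    by (auto simp: quad_size_def)
  show "fibers_finite (core n k) quad_size"
    unfolding core_def w by (rule t1(2))
  have b: "gf (bounded_parts n n k) sum_list (\<lambda>_. - int k) = Z (- int k) * bounded_gf n n k"
  proof -
    have "gf (id ` bounded_parts n n k) sum_list (\<lambda>_. - int k) = Z (- int k) * fps_X ^ 0 * gf (bounded_parts n n k) sum_list (\<lambda>_. 0)"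
      by (rule gf_image) auto
    thus ?thesis by (simp add: bounded_gf_def)
  qed
  have "gf (core n k) quad_size (core_rank n) = gf (core n k) quad_size
     (\<lambda>(x, y). (\<Sum>x\<leftarrow>x. part_wt n k x) + (case y of (x, y, z) \<Rightarrow> (\<Sum>x\<leftarrow>x. 2) + ((\<Sum>x\<leftarrow>y. - 2) + - int k)))"
    by (rule gf_cong) (auto simp: core_def core_rank_def bounded_parts_def)
  also have "\<dots> = parts_gf (part_wt n k) n * (parts_gf (\<lambda>_. 2) n * (parts_gf (\<lambda>_. - 2) n * (Z (- int k) * bounded_gf n n k)))"
    using t1(1) t2(1) t3(1) unfolding core_def w parts_gf_def b[symmetric] by (simp add: case_prod_unfold)
  finally show "gf (core n k) quad_size (core_rank n) =
     parts_gf (part_wt n k) n * (parts_gf (\<lambda>_. 2) n * (parts_gf (\<lambda>_. - 2) n * (Z (- int k) * bounded_gf n n k)))" .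
qed

text \<open>
  All parts have weight \<open>z 1\<close> except those in \<open>{n+1..n+k}\<close>, which have weight 1. Hence the generating
  function is \<open>1 / (z q\<^sup>n)\<^sub>\<infinity>\<close> with \<open>k\<close> factors exchanged.
\<close>

lemma parts_gf_part_wt:
  assumes "n > 0"
  shows "fpinf (Z 1 * fps_X ^ n) * parts_gf (part_wt n k) n * fpoch (fps_X ^ (n + 1)) k = fpoch (Z 1 * fps_X ^ (n + 1)) k"
proof -
  let ?G = "parts_gf (part_wt n k)"
  have 1: "(1 - Z 1 * fps_X ^ n) * ?G n = ?G (Suc n)"
    using parts_gf_Suc[OF assms, of "part_wt n k"] by (simp add: part_wt_def)
  have 2: "fpoch (fps_X ^ Suc n) k * ?G (Suc n) = ?G (Suc n + k)"
    using parts_gf_steps[of "Suc n" k "part_wt n k" 0] by (simp add: part_wt_def)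
  have 3: "fpinf (Z 1 * fps_X ^ (Suc n + k)) * ?G (Suc n + k) = 1"
    by (rule parts_gf_const) (auto simp: part_wt_def)
  have 4: "fpinf (Z 1 * fps_X ^ n) = (1 - Z 1 * fps_X ^ n) * (fpoch (Z 1 * fps_X ^ Suc n) k * fpinf (Z 1 * fps_X ^ (Suc n + k)))"
    using fpinf_split[of "Z 1 * fps_X ^ n" "Suc k"]
    by (simp add: fpoch_Suc_left power_add mult_ac)
  have "fpinf (Z 1 * fps_X ^ n) * ?G n * fpoch (fps_X ^ Suc n) k
     = fpoch (Z 1 * fps_X ^ Suc n) k * (fpinf (Z 1 * fps_X ^ (Suc n + k)) * (fpoch (fps_X ^ Suc n) k * ((1 - Z 1 * fps_X ^ n) * ?G n)))"
    unfolding 4 by (simp only: mult_ac)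
  also have "\<dots> = fpoch (Z 1 * fps_X ^ Suc n) k"
    unfolding 1 2 3 by simp
  finally show ?thesis by simp
qed

section \<open>The q-binomial theorem\<close>

text \<open>
  The quotient \<open>(a; q)\<^sub>k / (q; q)\<^sub>k\<close>; the right inverse of power series replaces the division that a
  general commutative ring lacks.
\<close>

definition qbin :: "'a fps \<Rightarrow> nat \<Rightarrow> 'a fps" where
  "qbin a k = fpoch a k * fps_right_inverse (fpoch fps_X k) 1"

lemma qbin_mult: "fpoch fps_X k * qbin a k = fpoch a k"
proof -
  have "fpoch fps_X k * fps_right_inverse (fpoch fps_X k) 1 = (1 :: 'a fps)"
    using fpoch_X_nth_0 by (intro fps_right_inverse) simp
  thus ?thesis unfolding qbin_def by (metis mult.left_commute mult_1_right)
qed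

lemma qbin_0 [simp]: "qbin a 0 = 1"
  using qbin_mult[of 0 a] by simp

lemma qbin_Suc: "qbin a (Suc k) * (1 - fps_X ^ Suc k) = qbin a k * (1 - a * fps_X ^ k)"
proof (rule fps_unit_cancel[OF _ fpoch_X_nth_0])
  have "fpoch fps_X (Suc k) = fpoch fps_X k * (1 - fps_X ^ Suc k :: 'a fps)" by (simp add: fpoch_Suc)
  hence "fpoch fps_X k * (qbin a (Suc k) * (1 - fps_X ^ Suc k)) = fpoch fps_X (Suc k) * qbin a (Suc k)"
    by (simp only: mult_ac)
  also have "\<dots> = fpoch a k * (1 - a * fps_X ^ k)" unfolding qbin_mult by (rule fpoch_Suc)
  also have "\<dots> = fpoch fps_X k * (qbin a k * (1 - a * fps_X ^ k))"
    by (simp only: qbin_mult flip: mult.assoc)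
  finally show "fpoch fps_X k * (qbin a (Suc k) * (1 - fps_X ^ Suc k)) = fpoch fps_X k * (qbin a k * (1 - a * fps_X ^ k))" .
qed

text \<open>
  The functional equation \<open>(1 - t) \<Phi>(t) = (1 - a t) \<Phi>(t q)\<close> of the q-binomial series in a form for
  partial sums. The boundary term is divisible by a high power of \<open>t\<close>.
\<close>

lemma qbin_telescope:
  "(1 - t) * (\<Sum>k\<le>K. t ^ k * qbin a k) = (1 - a * t) * (\<Sum>k\<le>K. (t * fps_X) ^ k * qbin a k) - t ^ Suc K * (qbin a K * (1 - a * fps_X ^ K))"
proof (induction K)
  case (Suc K)
  define c where "c = qbin a (Suc K)"
  define Y where "Y = (fps_X :: 'a fps) ^ Suc K"
  have e: "qbin a K * (1 - a * fps_X ^ K) = c * (1 - Y)" unfolding c_def Y_def by (simp only: qbin_Suc)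
  have "(1 - t) * (\<Sum>k\<le>Suc K. t ^ k * qbin a k) = (1 - t) * (\<Sum>k\<le>K. t ^ k * qbin a k) + (1 - t) * (t ^ Suc K * c)"
    by (simp add: c_def distrib_left)
  also have "\<dots> = (1 - a * t) * (\<Sum>k\<le>K. (t * fps_X) ^ k * qbin a k) - t ^ Suc K * (c * (1 - Y)) + (1 - t) * (t ^ Suc K * c)"
    unfolding Suc e ..
  also have "\<dots> = (1 - a * t) * ((\<Sum>k\<le>K. (t * fps_X) ^ k * qbin a k) + t ^ Suc K * Y * c) - t ^ Suc (Suc K) * (c * (1 - a * Y))"
    by (simp add: algebra_simps)
  also have "\<dots> = (1 - a * t) * (\<Sum>k\<le>Suc K. (t * fps_X) ^ k * qbin a k) - t ^ Suc (Suc K) * (c * (1 - a * Y))"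
    by (simp add: c_def Y_def power_mult_distrib)
  finally show ?case by (simp add: c_def Y_def)
qed (simp add: algebra_simps)

text \<open>
  The functional equation is iterated from \<open>t = z (-1) q\<^sup>n\<close> on. Since \<open>n > 0\<close>, every \<open>t\<close> that occurs has
  positive order, so that cutting the series off after \<open>K\<close> does not affect the first coefficients; along
  the iteration \<open>t\<close> tends to 0 and the series to 1.
\<close>

lemma qbinomial_theorem:
  assumes "n > 0"
  shows "fps_eq (Suc K) (fpinf (Z (-1) * fps_X ^ n) * (\<Sum>k\<le>K. (Z (-1) * fps_X ^ n) ^ k * qbin (Z 1 * fps_X ^ (n + 1)) k))
            (fpinf (fps_X ^ (2 * n + 1)))"
proof -
  define a where "a = Z 1 * fps_X ^ (n + 1)"
  define g where "g = (\<lambda>i. \<Sum>k\<le>K. (Z (-1) * fps_X ^ i) ^ k * qbin a k)"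
  have step: "fps_eq (Suc K) ((1 - Z (-1) * fps_X ^ i) * g i) ((1 - fps_X ^ (n + 1 + i)) * g (Suc i))" if "i > 0" for i
  proof -
    define t where "t = Z (-1) * fps_X ^ i"
    have at: "a * t = fps_X ^ (n + 1 + i)"
    proof -
      have "a * t = (Z (-1) * Z 1) * (fps_X ^ (n + 1) * fps_X ^ i)" by (simp only: a_def t_def mult_ac)
      thus ?thesis by (simp only: Z_minus_cancel[of 1] power_add mult_1_left)
    qed
    have tK: "t ^ Suc K * Y = fps_X ^ (i * Suc K) * (Z (-1) ^ Suc K * Y)" for Y
      by (simp add: t_def power_mult_distrib power_add mult_ac flip: power_mult)
    have tX: "t * fps_X = Z (-1) * fps_X ^ Suc i" by (simp add: t_def mult_ac)
    have "(1 - t) * g i = (1 - a * t) * g (Suc i) + fps_X ^ (i * Suc K) * (- (Z (-1) ^ Suc K * (qbin a K * (1 - a * fps_X ^ K))))"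
      using qbin_telescope[where t = t and K = K and a = a] unfolding tK tX g_def t_def[symmetric]
      by (simp only: mult_minus_right diff_conv_add_uminus)
    also have "fps_eq (Suc K) \<dots> ((1 - a * t) * g (Suc i) + 0)"
      by (intro fps_eq_add fps_eq_refl fps_eq_X_power_mult) (use that mult_le_mono1[of 1 i "Suc K"] in simp)
    also have "(1 - a * t) * g (Suc i) + 0 = (1 - fps_X ^ (n + 1 + i)) * g (Suc i)" unfolding at by simp
    finally show ?thesis unfolding t_def .
  qed
  \<comment> \<open>Every step contributes one factor to each of the two products.\<close>
  have iter: "fps_eq (Suc K) (fpoch (Z (-1) * fps_X ^ n) N * g n) (fpoch (fps_X ^ (2 * n + 1)) N * g (n + N))" for N
  proof (induction N)
    case (Suc N)
    have "fpoch (Z (-1) * fps_X ^ n) (Suc N) * g n = (1 - Z (-1) * fps_X ^ (n + N)) * (fpoch (Z (-1) * fps_X ^ n) N * g n)"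
      by (simp add: fpoch_Suc power_add mult_ac)
    also have "fps_eq (Suc K) \<dots> ((1 - Z (-1) * fps_X ^ (n + N)) * (fpoch (fps_X ^ (2 * n + 1)) N * g (n + N)))"
      by (intro fps_eq_mult fps_eq_refl Suc)
    also have "\<dots> = fpoch (fps_X ^ (2 * n + 1)) N * ((1 - Z (-1) * fps_X ^ (n + N)) * g (n + N))" by (simp only: mult_ac)
    also have "fps_eq (Suc K) \<dots> (fpoch (fps_X ^ (2 * n + 1)) N * ((1 - fps_X ^ (n + 1 + (n + N))) * g (Suc (n + N))))"
      by (intro fps_eq_mult fps_eq_refl step) (use assms in simp)
    also have "\<dots> = fpoch (fps_X ^ (2 * n + 1)) (Suc N) * g (n + Suc N)"
    proof -
      have "n + 1 + (n + N) = 2 * n + 1 + N" by simp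
      thus ?thesis by (simp only: fpoch_Suc power_add mult.assoc add_Suc_right)
    qed
    finally show ?case .
  qed simp
  have g1: "fps_eq (Suc K) (g (n + Suc K)) 1"
  proof -
    have "fps_eq (Suc K) (g (n + Suc K)) (\<Sum>k\<le>K. if k = 0 then 1 else 0)"
      unfolding g_def
    proof (rule fps_eq_sum)
      fix k
      show "fps_eq (Suc K) ((Z (-1) * fps_X ^ (n + Suc K)) ^ k * qbin a k) (if k = 0 then 1 else 0)"
      proof (cases k)
        case (Suc j)
        have "(Z (-1) * fps_X ^ (n + Suc K)) ^ k * qbin a k = fps_X ^ ((n + Suc K) * k) * (Z (-1) ^ k * qbin a k)"
          by (simp only: power_mult_distrib power_mult[symmetric] mult_ac)
        also have "fps_eq (Suc K) \<dots> 0" by (rule fps_eq_X_power_mult) (simp add: Suc)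
        finally show ?thesis by (simp add: Suc)
      qed simp
    qed
    thus ?thesis by simp
  qed
  have "fps_eq (Suc K) (fpinf (Z (-1) * fps_X ^ n) * g n) (fpoch (Z (-1) * fps_X ^ n) (Suc K) * g n)"
    by (intro fps_eq_mult fps_eq_refl fps_eq_fpinf)
  also have "fps_eq (Suc K) \<dots> (fpoch (fps_X ^ (2 * n + 1)) (Suc K) * g (n + Suc K))" by (rule iter)
  also have "fps_eq (Suc K) \<dots> (fpinf (fps_X ^ (2 * n + 1)) * 1)"
    by (intro fps_eq_mult g1 fps_eq_sym[OF fps_eq_fpinf])
  finally show ?thesis by (simp add: g_def a_def)
qed

end

section \<open>Adding the smallest part\<close>

text \<open>
  The quadruples that become members of \<^const>\<open>U_set\<close> with smallest part \<open>n\<close> in \<open>\<pi>\<^sub>1\<close> when one part \<open>n\<close> is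
  appended to \<open>\<pi>\<^sub>1\<close>.
\<close>

definition fill :: "nat \<Rightarrow> quadruple set" where
  "fill n = (\<Union>k. core n k)"

definition append_part :: "nat \<Rightarrow> quadruple \<Rightarrow> quadruple" where
  "append_part n = (\<lambda>(p1, p2, p3, p4). (p1 @ [n], p2, p3, p4))"

definition smallest_is :: "nat \<Rightarrow> quadruple set \<Rightarrow> quadruple set" where
  "smallest_is n S = {Q \<in> S. smallest_part (fst Q) = enat n}"

lemma smallest_part_eq_iff:
  "is_partition p \<Longrightarrow> smallest_part p = enat n \<longleftrightarrow> n \<in> set p \<and> (\<forall>x\<in>set p. n \<le> x)"
  by (auto simp: smallest_part_def Min_eq_iff)

lemma smallest_part_ge_iff: "enat n \<le> smallest_part p \<longleftrightarrow> (\<forall>x\<in>set p. n \<le> x)"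
  by (auto simp: smallest_part_def)

lemma two_enat: "2 * enat n = enat (2 * n)"
  by (simp add: numeral_eq_enat)

lemma mem_smallest_is_U_set:
  "(p1, p2, p3, p4) \<in> smallest_is n U_set \<longleftrightarrow>
     p1 \<in> parts_ge n \<and> n \<in> set p1 \<and> p2 \<in> parts_ge n \<and> p3 \<in> parts_ge n \<and> p4 \<in> parts_ge n \<and> (\<forall>x\<in>set p4. x \<le> 2 * n)"
proof (cases "is_partition p1 \<and> smallest_part p1 = enat n")
  case True
  have "enat (largest_part p4) \<le> 2 * smallest_part p1 \<longleftrightarrow> (\<forall>x\<in>set p4. x \<le> 2 * n)"
    using True by (auto simp: two_enat largest_part_def)
  moreover have "2 * smallest_part p1 < \<infinity>" using True by (simp add: two_enat)
  ultimately show ?thesis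
    using True by (auto simp: smallest_is_def U_set_def smallest_part_eq_iff smallest_part_ge_iff parts_ge_def)
next
  case False
  thus ?thesis by (auto simp: smallest_is_def U_set_def smallest_part_eq_iff parts_ge_def)
qed

lemma mem_fill:
  "(p1, p2, p3, p4) \<in> fill n \<longleftrightarrow>
     p1 \<in> parts_ge n \<and> p2 \<in> parts_ge n \<and> p3 \<in> parts_ge n \<and> p4 \<in> parts_ge n \<and> (\<forall>x\<in>set p4. x \<le> 2 * n)"
  by (auto simp: fill_def core_def bounded_parts_def parts_ge_def)

lemma ex_snoc_parts_ge:
  assumes "p \<in> parts_ge n" "n \<in> set p"
  obtains p' where "p = p' @ [n]" "p' \<in> parts_ge n"
proof -
  from assms have "p \<noteq> []" by auto
  then obtain p' y where py: "p = p' @ [y]" by (metis append_butlast_last_id)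
  have "y = n" using assms by (auto simp: py parts_ge_def is_partition_snoc intro: antisym)
  thus ?thesis using assms(1) by (intro that[of p']) (auto simp: py parts_ge_def is_partition_snoc)
qed

lemma smallest_is_U_set:
  assumes "n > 0"
  shows "smallest_is n U_set = append_part n ` fill n"
proof (intro equalityI subsetI)
  fix Q assume Q: "Q \<in> smallest_is n U_set"
  obtain p1 p2 p3 p4 where Qp: "Q = (p1, p2, p3, p4)" by (cases Q)
  from Q have *: "p1 \<in> parts_ge n" "n \<in> set p1" "p2 \<in> parts_ge n" "p3 \<in> parts_ge n" "p4 \<in> parts_ge n" "\<forall>x\<in>set p4. x \<le> 2 * n"
    by (simp_all add: Qp mem_smallest_is_U_set)
  from *(1,2) obtain p' where p': "p1 = p' @ [n]" "p' \<in> parts_ge n" by (rule ex_snoc_parts_ge)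
  have "Q = append_part n (p', p2, p3, p4)" by (simp add: append_part_def Qp p')
  moreover have "(p', p2, p3, p4) \<in> fill n" using * p' by (simp add: mem_fill)
  ultimately show "Q \<in> append_part n ` fill n" by blast
next
  fix Q assume "Q \<in> append_part n ` fill n"
  then obtain p1 p2 p3 p4 where "(p1, p2, p3, p4) \<in> fill n" "Q = append_part n (p1, p2, p3, p4)" by auto
  thus "Q \<in> smallest_is n U_set"
    using assms by (auto simp: append_part_def mem_fill mem_smallest_is_U_set parts_ge_def is_partition_snoc)
qed

text \<open>
  Members of \<^const>\<open>V_set\<close> have the smallest part twice, so they arise by appending it once more.
\<close>

lemma smallest_is_V_set:
  assumes "n > 0"
  shows "smallest_is n V_set = append_part n ` smallest_is n U_set"
proof (intro equalityI subsetI)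
  fix Q assume Q: "Q \<in> smallest_is n V_set"
  obtain p1 p2 p3 p4 where Qp: "Q = (p1, p2, p3, p4)" by (cases Q)
  from Q have QU: "(p1, p2, p3, p4) \<in> smallest_is n U_set" and len: "2 \<le> length (filter (\<lambda>x. enat x = smallest_part p1) p1)"
    and sm: "smallest_part p1 = enat n"
    by (auto simp: Qp smallest_is_def V_set_def)
  hence *: "p1 \<in> parts_ge n" "n \<in> set p1" by (simp_all add: mem_smallest_is_U_set)
  from * obtain p' where p': "p1 = p' @ [n]" "p' \<in> parts_ge n" by (rule ex_snoc_parts_ge)
  have "length (filter (\<lambda>x. x = n) p') \<noteq> 0" using len unfolding sm unfolding p' by force
  hence "n \<in> set p'" by (auto simp: filter_empty_conv)
  hence "(p', p2, p3, p4) \<in> smallest_is n U_set" using QU p' by (simp add: mem_smallest_is_U_set)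
  moreover have "Q = append_part n (p', p2, p3, p4)" by (simp add: append_part_def Qp p')
  ultimately show "Q \<in> append_part n ` smallest_is n U_set" by blast
next
  fix Q assume "Q \<in> append_part n ` smallest_is n U_set"
  then obtain p1 p2 p3 p4 where *: "(p1, p2, p3, p4) \<in> smallest_is n U_set" and Q: "Q = (p1 @ [n], p2, p3, p4)"
    by (auto simp: append_part_def)
  have "Q \<in> smallest_is n U_set"
    using * assms by (auto simp: Q mem_smallest_is_U_set parts_ge_def is_partition_snoc)
  moreover from this have "smallest_part (p1 @ [n]) = enat n" by (simp add: Q smallest_is_def)
  moreover have "filter (\<lambda>x. x = n) p1 \<noteq> []"
    using * by (auto simp: mem_smallest_is_U_set filter_empty_conv)
  hence "1 \<le> length (filter (\<lambda>x. x = n) p1)" by (cases "filter (\<lambda>x. x = n) p1") auto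
  ultimately show "Q \<in> smallest_is n V_set"
    by (simp add: smallest_is_def V_set_def Q)
qed

lemma omega_append_part:
  assumes "Q \<in> smallest_is n U_set" "n > 0"
  shows "omega (append_part n Q) = Suc (omega Q)"
proof -
  obtain p1 p2 p3 p4 where Q: "Q = (p1, p2, p3, p4)" by (cases Q)
  have "append_part n Q \<in> smallest_is n U_set"
    using assms by (auto simp: Q append_part_def mem_smallest_is_U_set parts_ge_def is_partition_snoc)
  hence "smallest_part (p1 @ [n]) = enat n" by (simp add: Q smallest_is_def append_part_def)
  moreover have "smallest_part p1 = enat n" using assms by (simp add: Q smallest_is_def)
  ultimately show ?thesis by (simp add: Q omega_def append_part_def)
qed

lemma u_rank_append_part:
  assumes "Q \<in> fill n" "n > 0"
  shows "u_rank (append_part n Q) = core_rank n Q"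
proof -
  obtain p1 p2 p3 p4 where Q: "Q = (p1, p2, p3, p4)" by (cases Q)
  have p1: "\<forall>x\<in>set p1. n \<le> x" using assms by (auto simp: Q mem_fill parts_ge_def)
  have "append_part n Q \<in> smallest_is n U_set" using assms by (auto simp: smallest_is_U_set)
  hence s: "smallest_part (p1 @ [n]) = enat n" by (simp add: Q smallest_is_def append_part_def)
  have "int (length (filter P p1)) = (\<Sum>x\<leftarrow>p1. if P x then 1 else 0)" for P
    by (induction p1) auto
  note f = this
  have "int (omega (append_part n Q)) = (\<Sum>x\<leftarrow>p1. part_wt n (length p4) x) + 1"
  proof (cases "p4 = []")
    case True
    have "(\<Sum>x\<leftarrow>p1. part_wt n 0 x) = (\<Sum>x\<leftarrow>p1. 1)"
      using p1 by (intro arg_cong[of _ _ sum_list] map_cong) (auto simp: part_wt_def)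
    thus ?thesis using True by (simp add: Q omega_def append_part_def sum_list_triv)
  next
    case False
    thus ?thesis by (simp add: Q omega_def append_part_def s f part_wt_def)
  qed
  thus ?thesis by (simp add: u_rank_def Q append_part_def core_rank_def sum_list_triv)
qed

context rank_weight begin

text \<open>
  The product \<open>(z q\<^sup>n)\<^sub>\<infinity>\<close> times the generating functions of \<open>\<pi>\<^sub>1\<close> and of \<open>\<pi>\<^sub>4\<close> is a term of the q-binomial
  series: the factor \<open>(q\<^sup>n\<^sup>+\<^sup>1; q)\<^sub>k\<close> in the denominator of the first cancels against the box generating
  function of the second.
\<close>

lemma core_first_factor:
  assumes "n > 0"
  shows "fpinf (Z 1 * fps_X ^ n) * parts_gf (part_wt n k) n * bounded_gf n n k = fps_X ^ (n * k) * qbin (Z 1 * fps_X ^ (n + 1)) k"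
proof (rule fps_unit_cancel[OF _ fpoch_X_nth_0])
  have "fpoch fps_X k * (fpinf (Z 1 * fps_X ^ n) * parts_gf (part_wt n k) n * bounded_gf n n k)
      = fpinf (Z 1 * fps_X ^ n) * parts_gf (part_wt n k) n * (fpoch fps_X k * bounded_gf n n k)" by (simp only: mult_ac)
  also have "\<dots> = fps_X ^ (n * k) * (fpinf (Z 1 * fps_X ^ n) * parts_gf (part_wt n k) n * fpoch (fps_X ^ (n + 1)) k)"
    unfolding bounded_gf_eq[OF assms] by (simp only: mult_ac)
  also have "\<dots> = fps_X ^ (n * k) * (fpoch fps_X k * qbin (Z 1 * fps_X ^ (n + 1)) k)"
    unfolding parts_gf_part_wt[OF assms] qbin_mult ..
  finally show "fpoch fps_X k * (fpinf (Z 1 * fps_X ^ n) * parts_gf (part_wt n k) n * bounded_gf n n k)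
     = fpoch fps_X k * (fps_X ^ (n * k) * qbin (Z 1 * fps_X ^ (n + 1)) k)" by (simp only: mult_ac)
qed

text \<open>
  Each of the \<open>k\<close> parts of \<open>\<pi>\<^sub>4\<close> is at least 1, so only \<open>k \<le> K\<close> matters up to order \<open>K\<close>.
\<close>

lemma fps_eq_gf_fill:
  assumes "n > 0"
  shows "fps_eq (Suc K) (gf (fill n) quad_size (core_rank n)) (\<Sum>k\<le>K. gf (core n k) quad_size (core_rank n))"
  unfolding fps_eq_def
proof safe
  fix m assume m: "m < Suc K"
  have len: "length p4 \<le> sum_list p4" if "p4 \<in> bounded_parts n n k" for p4 k
  proof -
    have "(\<Sum>x\<leftarrow>p4. 1) \<le> (\<Sum>x\<leftarrow>p4. x)"
      by (rule sum_list_mono) (use that assms in \<open>auto simp: bounded_parts_def\<close>)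
    thus ?thesis by (simp add: sum_list_triv)
  qed
  have "{Q \<in> fill n. quad_size Q = m} = (\<Union>k\<in>{..K}. {Q \<in> core n k. quad_size Q = m})"
  proof (intro equalityI subsetI)
    fix Q assume "Q \<in> {Q \<in> fill n. quad_size Q = m}"
    then obtain k where k: "Q \<in> core n k" "quad_size Q = m" by (auto simp: fill_def)
    obtain p1 p2 p3 p4 where Q: "Q = (p1, p2, p3, p4)" by (cases Q)
    have p4: "p4 \<in> bounded_parts n n k" using k by (auto simp: Q core_def)
    have "k = length p4" using p4 by (simp add: bounded_parts_def)
    also have "\<dots> \<le> quad_size Q" using len[OF p4] by (simp add: Q quad_size_def)
    finally show "Q \<in> (\<Union>k\<in>{..K}. {Q \<in> core n k. quad_size Q = m})" using k m by auto
  qed (auto simp: fill_def)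
  hence "fps_nth (gf (fill n) quad_size (core_rank n)) m = (\<Sum>Q\<in>(\<Union>k\<in>{..K}. {Q \<in> core n k. quad_size Q = m}). z (core_rank n Q))"
    by (simp add: gf_def)
  also have "\<dots> = (\<Sum>k\<le>K. \<Sum>Q\<in>{Q \<in> core n k. quad_size Q = m}. z (core_rank n Q))"
  proof (rule sum.UNION_disjoint)
    show "\<forall>k\<in>{..K}. finite {Q \<in> core n k. quad_size Q = m}"
      using gf_core(2)[of n] by (simp add: fibers_finite_def)
  qed (auto simp: core_def bounded_parts_def)
  also have "\<dots> = fps_nth (\<Sum>k\<le>K. gf (core n k) quad_size (core_rank n)) m"
    by (simp add: fps_sum_nth gf_def)
  finally show "fps_nth (gf (fill n) quad_size (core_rank n)) m = fps_nth (\<Sum>k\<le>K. gf (core n k) quad_size (core_rank n)) m" .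
qed

lemma Z_minus_of_nat: "Z (- int k) = Z (-1) ^ k"
proof (induction k)
  case (Suc k)
  have "- int (Suc k) = -1 + (- int k)" by simp
  thus ?case by (simp only: Z_add Suc power_Suc)
qed simp

text \<open>
  The generating function of the quadruples from which one smallest part has been removed; after the
  products of \<open>\<pi>\<^sub>2\<close> and \<open>\<pi>\<^sub>3\<close> are cleared, the sum over \<open>k\<close> is the left-hand side of the q-binomial theorem.
\<close>

theorem gf_fill:
  assumes n: "n > 0"
  shows "fpinf (Z 1 * fps_X ^ n) * fpinf (Z (-1) * fps_X ^ n) * fpinf (Z 2 * fps_X ^ n) * fpinf (Z (-2) * fps_X ^ n)
     * gf (fill n) quad_size (core_rank n) = fpinf (fps_X ^ (2 * n + 1))"
proof (rule fps_eqI)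
  fix K
  define A where "A = fpinf (Z 1 * fps_X ^ n)"
  define B where "B = fpinf (Z (-1) * fps_X ^ n)"
  define C where "C = fpinf (Z 2 * fps_X ^ n)"
  define D where "D = fpinf (Z (-2) * fps_X ^ n)"
  have C: "C * parts_gf (\<lambda>_. 2) n = 1" unfolding C_def by (rule parts_gf_const[OF n]) simp
  have D: "D * parts_gf (\<lambda>_. - 2) n = 1" unfolding D_def by (rule parts_gf_const[OF n]) simp
  have k: "A * C * D * gf (core n k) quad_size (core_rank n) = (Z (-1) * fps_X ^ n) ^ k * qbin (Z 1 * fps_X ^ (n + 1)) k" for k
  proof -
    have "A * C * D * gf (core n k) quad_size (core_rank n)
      = Z (- int k) * (A * parts_gf (part_wt n k) n * bounded_gf n n k) * (C * parts_gf (\<lambda>_. 2) n) * (D * parts_gf (\<lambda>_. - 2) n)"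
      unfolding gf_core(1) by (simp only: mult_ac)
    also have "\<dots> = Z (-1) ^ k * (fps_X ^ (n * k) * qbin (Z 1 * fps_X ^ (n + 1)) k)"
      unfolding C D A_def core_first_factor[OF n] Z_minus_of_nat by simp
    finally show ?thesis by (simp only: power_mult_distrib power_mult mult.assoc)
  qed
  have "fps_eq (Suc K) (A * B * C * D * gf (fill n) quad_size (core_rank n)) (A * B * C * D * (\<Sum>k\<le>K. gf (core n k) quad_size (core_rank n)))"
    by (intro fps_eq_mult fps_eq_refl fps_eq_gf_fill n)
  also have "A * B * C * D * (\<Sum>k\<le>K. gf (core n k) quad_size (core_rank n)) = B * (\<Sum>k\<le>K. A * C * D * gf (core n k) quad_size (core_rank n))"
    by (simp add: sum_distrib_left mult_ac)
  also have "fps_eq (Suc K) \<dots> (fpinf (fps_X ^ (2 * n + 1)))"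
    unfolding k B_def by (rule qbinomial_theorem[OF n])
  finally show "fps_eq K (fpinf (Z 1 * fps_X ^ n) * fpinf (Z (-1) * fps_X ^ n) * fpinf (Z 2 * fps_X ^ n) * fpinf (Z (-2) * fps_X ^ n)
     * gf (fill n) quad_size (core_rank n)) (fpinf (fps_X ^ (2 * n + 1)))"
    unfolding A_def B_def C_def D_def by (rule fps_eq_mono) simp
qed

lemma gf_smallest_is_U:
  assumes "n > 0"
  shows "gf (smallest_is n U_set) quad_size u_rank = fps_X ^ n * gf (fill n) quad_size (core_rank n)"
proof -
  have "gf (append_part n ` fill n) quad_size u_rank = Z 0 * fps_X ^ n * gf (fill n) quad_size (core_rank n)"
  proof (rule gf_image)
    fix Q assume Q: "Q \<in> fill n"
    show "u_rank (append_part n Q) = core_rank n Q + 0" using u_rank_append_part[OF Q assms] by simp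
  qed (auto simp: inj_on_def append_part_def quad_size_def)
  thus ?thesis by (simp add: smallest_is_U_set[OF assms])
qed

lemma gf_smallest_is_V:
  assumes "n > 0"
  shows "gf (smallest_is n V_set) quad_size v_rank = fps_X ^ (2 * n) * gf (fill n) quad_size (core_rank n)"
proof -
  have "gf (append_part n ` smallest_is n U_set) quad_size v_rank = Z 0 * fps_X ^ n * gf (smallest_is n U_set) quad_size u_rank"
  proof (rule gf_image)
    fix Q assume Q: "Q \<in> smallest_is n U_set"
    show "v_rank (append_part n Q) = u_rank Q + 0"
      using omega_append_part[OF Q assms] by (cases Q) (simp add: v_rank_def u_rank_def append_part_def)
  qed (auto simp: inj_on_def append_part_def quad_size_def)
  thus ?thesis by (simp add: smallest_is_V_set[OF assms] gf_smallest_is_U[OF assms] power_add mult_2 mult.assoc)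
qed

lemma fibers_eq_quadruples_in:
  assumes "S \<subseteq> U_set"
  shows "{Q \<in> S. quad_size Q = n} = quadruples_in S n"
  using assms by (auto simp: quadruples_in_def is_partition_quadruple_of_def U_set_def quad_size_def)

text \<open>
  A quadruple of size \<open>m\<close> has its smallest part in \<open>{1..m}\<close>.
\<close>

lemma gf_by_smallest:
  assumes "S \<subseteq> U_set" "m \<le> N"
  shows "fps_nth (gf S quad_size r) m = fps_nth (\<Sum>i<N. gf (smallest_is (Suc i) S) quad_size r) m"
proof -
  have "{Q \<in> S. quad_size Q = m} = (\<Union>i\<in>{..<N}. {Q \<in> smallest_is (Suc i) S. quad_size Q = m})"
  proof (intro equalityI subsetI)
    fix Q assume "Q \<in> {Q \<in> S. quad_size Q = m}"
    hence Q: "Q \<in> S" "quad_size Q = m" by auto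
    obtain p1 p2 p3 p4 where Qp: "Q = (p1, p2, p3, p4)" by (cases Q)
    have *: "is_partition p1" "2 * smallest_part p1 < \<infinity>" using Q assms by (auto simp: Qp U_set_def)
    have "p1 \<noteq> []"
    proof
      assume "p1 = []"
      hence "smallest_part p1 = \<infinity>" by (simp add: smallest_part_def)
      thus False using *(2) by (simp add: numeral_eq_enat)
    qed
    then obtain k where k: "smallest_part p1 = enat k" by (simp add: smallest_part_def)
    have kp: "k \<in> set p1" using k * by (simp add: smallest_part_eq_iff)
    hence "k > 0" using * by (auto simp: is_partition_def)
    moreover have "k \<le> m" using member_le_sum_list[OF kp] Q(2) by (simp add: Qp quad_size_def)
    ultimately have "Suc (k - 1) = k" "k - 1 < N" using assms(2) by auto
    moreover have "Q \<in> smallest_is k S" using Q(1) k by (simp add: smallest_is_def Qp)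
    ultimately show "Q \<in> (\<Union>i\<in>{..<N}. {Q \<in> smallest_is (Suc i) S. quad_size Q = m})" using Q(2) by (intro UN_I[of "k - 1"]) auto
  qed (auto simp: smallest_is_def)
  hence "fps_nth (gf S quad_size r) m = (\<Sum>Q\<in>(\<Union>i\<in>{..<N}. {Q \<in> smallest_is (Suc i) S. quad_size Q = m}). z (r Q))"
    by (simp add: gf_def)
  also have "\<dots> = (\<Sum>i<N. \<Sum>Q\<in>{Q \<in> smallest_is (Suc i) S. quad_size Q = m}. z (r Q))"
  proof (rule sum.UNION_disjoint)
    show "\<forall>i\<in>{..<N}. finite {Q \<in> smallest_is (Suc i) S. quad_size Q = m}"
    proof
      fix i
      have "{Q \<in> smallest_is (Suc i) S. quad_size Q = m} = quadruples_in (smallest_is (Suc i) S) m"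
        by (rule fibers_eq_quadruples_in) (use assms in \<open>auto simp: smallest_is_def\<close>)
      thus "finite {Q \<in> smallest_is (Suc i) S. quad_size Q = m}" by (simp add: finite_quadruples_in)
    qed
  qed (auto simp: smallest_is_def)
  also have "\<dots> = fps_nth (\<Sum>i<N. gf (smallest_is (Suc i) S) quad_size r) m"
    by (simp add: fps_sum_nth gf_def)
  finally show ?thesis .
qed

lemma V_set_subset: "V_set \<subseteq> U_set"
  by (auto simp: V_set_def)

end

section \<open>The series RU and RV over Laurent polynomials\<close>

interpretation laurent: rank_weight "\<lambda>k. Poly_Mapping.single k (1::int)"
  by unfold_locales (simp_all add: mult_single flip: single_one)

lemma laurent_Z: "laurent.Z k = z_pow k"
  by (simp add: laurent.Z_def z_pow_def)

lemma qpoch_inf_eq_fpinf: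
  assumes "fps_nth a 0 = 0"
  shows "qpoch_inf a = fpinf a"
proof (rule LIMSEQ_unique)
  show "(\<lambda>n. \<Prod>j\<le>n. 1 - a * q ^ j) \<longlonglongrightarrow> qpoch_inf a"
    using has_prod_imp_tendsto[OF qpoch_inf_has_prod(1)[OF assms]] .
  show "(\<lambda>n. \<Prod>j\<le>n. 1 - a * q ^ j) \<longlonglongrightarrow> fpinf a"
  proof (rule tendsto_fps_coeffwise)
    fix m n :: nat assume "m \<le> n"
    thus "fps_nth (\<Prod>j\<le>n. 1 - a * q ^ j) m = fps_nth (fpinf a) m"
      using fps_eq_fpinf[of "Suc n" a] by (simp add: fps_eq_def fpoch_def lessThan_Suc_atMost)
  qed
qed

lemma summand_eq_gf:
  assumes "n > 0"
  shows "summand n = laurent.gf (fill n) quad_size (core_rank n)"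
proof -
  define P where "P = qpoch_inf (z_pow 1 * q ^ n) * qpoch_inf (z_pow (-1) * q ^ n) *
            qpoch_inf (z_pow 2 * q ^ n) * qpoch_inf (z_pow (-2) * q ^ n)"
  have e: "qpoch_inf (z_pow k * q ^ n) = fpinf (laurent.Z k * fps_X ^ n)" for k
    unfolding laurent_Z by (rule qpoch_inf_eq_fpinf) (use assms in simp)
  define G where "G = laurent.gf (fill n) quad_size (core_rank n)"
  have 1: "P * recip P = 1" by (rule mult_recip) (use assms in \<open>simp add: P_def e fpinf_nth_0\<close>)
  have 2: "qpoch_inf (q ^ (2 * n + 1)) = P * G"
    unfolding P_def G_def e laurent.gf_fill[OF assms] by (rule qpoch_inf_eq_fpinf) simp
  have "summand n = G * (P * recip P)" unfolding summand_def P_def[symmetric] 2 by (simp only: mult_ac)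
  thus ?thesis by (simp add: 1 G_def)
qed

lemma RU_eq_gf: "RU = laurent.gf U_set quad_size u_rank"
proof (rule LIMSEQ_unique)
  show "(\<lambda>N. \<Sum>n<N. q ^ Suc n * summand (Suc n)) \<longlonglongrightarrow> RU"
    using RU_sums by (simp only: sums_def)
  show "(\<lambda>N. \<Sum>n<N. q ^ Suc n * summand (Suc n)) \<longlonglongrightarrow> laurent.gf U_set quad_size u_rank"
    by (rule tendsto_fps_coeffwise)
       (simp only: summand_eq_gf zero_less_Suc laurent.gf_smallest_is_U[symmetric] laurent.gf_by_smallest subset_refl)
qed

lemma RV_eq_gf: "RV = laurent.gf V_set quad_size v_rank"
proof (rule LIMSEQ_unique)
  show "(\<lambda>N. \<Sum>n<N. q ^ (2 * Suc n) * summand (Suc n)) \<longlonglongrightarrow> RV"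
    using RV_sums by (simp only: sums_def)
  show "(\<lambda>N. \<Sum>n<N. q ^ (2 * Suc n) * summand (Suc n)) \<longlonglongrightarrow> laurent.gf V_set quad_size v_rank"
    by (rule tendsto_fps_coeffwise)
       (simp only: summand_eq_gf zero_less_Suc laurent.gf_smallest_is_V[symmetric] laurent.gf_by_smallest laurent.V_set_subset)
qed

lemma lookup_gf:
  assumes "S \<subseteq> U_set"
  shows "Poly_Mapping.lookup (fps_nth (laurent.gf S quad_size r) n) m = int (card {Q \<in> quadruples_in S n. r Q = m})"
proof -
  have "Poly_Mapping.lookup (fps_nth (laurent.gf S quad_size r) n) m = (\<Sum>Q\<in>quadruples_in S n. if r Q = m then 1 else 0)"
    by (auto simp: laurent.gf_def laurent.fibers_eq_quadruples_in[OF assms] lookup_sum lookup_single when_def intro!: sum.cong)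
  also have "\<dots> = int (card {Q \<in> quadruples_in S n. r Q = m})"
    by (simp add: sum.If_cases finite_quadruples_in Int_def)
  finally show ?thesis .
qed

lemma ru_eq: "ru m n = int (card {Q \<in> quadruples_in U_set n. u_rank Q = m})"
  unfolding ru_def RU_eq_gf by (rule lookup_gf) simp

lemma rv_eq: "rv m n = int (card {Q \<in> quadruples_in V_set n. v_rank Q = m})"
  unfolding rv_def RV_eq_gf by (rule lookup_gf) (rule laurent.V_set_subset)

section \<open>Triangular exponents, theta functions and Appell sums\<close>

text \<open>
  The binomial coefficient \<open>n choose 2\<close>, extended to negative \<open>n\<close>.
\<close>

definition tri :: "int \<Rightarrow> int" where "tri n = n * (n - 1) div 2"

lemma two_tri: "2 * tri n = n * (n - 1)"
  unfolding tri_def by simp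

lemma tri_add: "tri (n + k) = tri n + tri k + n * k"
proof -
  have "2 * tri (n + k) = 2 * (tri n + tri k + n * k)"
    by (simp only: two_tri distrib_left) (simp add: algebra_simps)
  thus ?thesis by simp
qed

lemma tri_minus: "tri (- n) = tri n + n"
  using two_tri[of n] two_tri[of "-n"] by (simp add: algebra_simps)

lemma tri_simps [simp]: "tri 0 = 0" "tri 1 = 0" "tri 2 = 1" "tri 3 = 3" "tri 4 = 6" "tri 5 = 10" "tri 6 = 15"
  by (simp_all add: tri_def)

lemma tri_Suc: "tri (n + 1) = tri n + n"
  by (simp add: tri_add)

lemma tri_nonneg: "0 \<le> tri n"
proof -
  have "0 \<le> n * (n - 1)" by (cases "n \<le> 0") (auto intro: mult_nonpos_nonpos)
  thus ?thesis by (simp add: tri_def)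
qed

lemma tri_ge: "\<bar>n\<bar> \<le> tri n + 1"
proof -
  have "2 * n \<le> n * (n - 1) + 2"
  proof -
    have "n * (n - 1) + 2 - 2 * n = (n - 1) * (n - 2)" by (simp add: algebra_simps)
    moreover have "(n - 1) * (n - 2) \<ge> 0" by (cases "n \<le> 1") (auto intro: mult_nonpos_nonpos)
    ultimately show ?thesis by linarith
  qed
  moreover have "- 2 * n \<le> n * (n - 1) + 2"
  proof -
    have "n * (n - 1) + 2 * n = n * (n + 1)" by (simp add: algebra_simps)
    moreover have "n * (n + 1) \<ge> 0" by (cases "n \<ge> 0") (auto intro: mult_nonpos_nonpos)
    ultimately show ?thesis by linarith
  qed
  ultimately show ?thesis using two_tri[of n] by linarith
qed

lemma summable_on_int:
  fixes f :: "int \<Rightarrow> real"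
  assumes "summable (\<lambda>n::nat. f (int n))" "summable (\<lambda>n::nat. f (- int n))" "\<And>n. 0 \<le> f n"
  shows "f summable_on UNIV"
proof -
  have 1: "f summable_on range int"
  proof (subst summable_on_reindex)
    show "f \<circ> int summable_on UNIV"
      using assms by (simp add: summable_on_UNIV_nonneg_real_iff o_def)
  qed simp
  have 2: "f summable_on range (\<lambda>n::nat. - int n)"
  proof (subst summable_on_reindex)
    show "f \<circ> (\<lambda>n. - int n) summable_on UNIV"
      using assms by (simp add: summable_on_UNIV_nonneg_real_iff o_def)
  qed (simp add: inj_on_def)
  have "range int \<union> range (\<lambda>n::nat. - int n) = UNIV"
  proof -
    have "x \<in> range int \<union> range (\<lambda>n::nat. - int n)" for x
      by (cases x rule: int_cases2) auto
    thus ?thesis by blast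
  qed
  with summable_on_union[OF 1 2] show ?thesis by simp
qed

lemma summable_gauss:
  fixes R V :: real
  assumes "0 < R" "R < 1" "0 \<le> V"
  shows "summable (\<lambda>n::nat. R powi tri (int n) * V ^ n)"
proof -
  have "(\<lambda>n. R ^ n * V) \<longlonglongrightarrow> 0 * V"
    by (intro tendsto_mult tendsto_const LIMSEQ_power_zero) (use assms in auto)
  hence "eventually (\<lambda>n. R ^ n * V < 1/2) sequentially"
    by (rule order_tendstoD) simp
  then obtain N where N: "\<And>n. n \<ge> N \<Longrightarrow> R ^ n * V < 1/2"
    by (auto simp: eventually_sequentially)
  show ?thesis
  proof (rule summable_ratio_test[of "1/2" N])
    fix n assume n: "n \<ge> N"
    have "R powi tri (int (Suc n)) = R powi tri (int n) * R ^ n"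
      using assms by (simp add: tri_Suc[of "int n", simplified add.commute] power_int_add add.commute)
    hence "norm (R powi tri (int (Suc n)) * V ^ Suc n) = (R ^ n * V) * (R powi tri (int n) * V ^ n)"
      using assms by (simp add: abs_mult mult_ac)
    also have "\<dots> \<le> 1/2 * (R powi tri (int n) * V ^ n)"
      using N[OF n] assms by (intro mult_right_mono) auto
    finally show "norm (R powi tri (int (Suc n)) * V ^ Suc n) \<le> 1/2 * norm (R powi tri (int n) * V ^ n)"
      using assms by simp
  qed simp
qed

lemma summable_theta_real:
  fixes R V :: real
  assumes "0 < R" "R < 1" "0 < V"
  shows "(\<lambda>n. R powi tri n * V powi n) summable_on UNIV"
proof (rule summable_on_int)
  show "summable (\<lambda>n::nat. R powi tri (int n) * V powi int n)"
    using summable_gauss[of R V] assms by simp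
  have "R powi tri (- int n) * V powi (- int n) = R powi tri (int n) * (R / V) ^ n" for n
    using assms by (simp add: tri_minus power_int_add power_int_minus power_divide field_simps)
  thus "summable (\<lambda>n::nat. R powi tri (- int n) * V powi (- int n))"
    using summable_gauss[of R "R / V"] assms by simp
qed (use assms in simp)

text \<open>The Cauchy product of two bilateral series.\<close>

lemma int_convolution:
  fixes s t :: "int \<Rightarrow> complex"
  assumes s: "(\<lambda>n. norm (s n)) summable_on UNIV" and t: "(\<lambda>n. norm (t n)) summable_on UNIV"
  shows "((\<lambda>N. \<Sum>\<^sub>\<infinity>n\<in>UNIV. s n * t (N - n)) has_sum (infsum s UNIV * infsum t UNIV)) UNIV"
    and "(\<lambda>n. s n * t (N - n)) summable_on UNIV"
proof -
  have sT: "(t has_sum infsum t UNIV) UNIV" and sS: "(s has_sum infsum s UNIV) UNIV"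
    using abs_summable_summable[OF s] abs_summable_summable[OF t] by auto
  have "(\<lambda>(n, k). norm (s n * t k)) summable_on UNIV \<times> UNIV"
  proof (rule summable_on_SigmaI)
    show "((\<lambda>k. case (n, k) of (n, k) \<Rightarrow> norm (s n * t k)) has_sum (norm (s n) * (\<Sum>\<^sub>\<infinity>k\<in>UNIV. norm (t k)))) UNIV" for n
      using has_sum_cmult_right[OF has_sum_infsum[OF t], of "norm (s n)"] by (simp add: norm_mult)
    show "(\<lambda>n. norm (s n) * (\<Sum>\<^sub>\<infinity>k\<in>UNIV. norm (t k))) summable_on UNIV"
      by (rule summable_on_cmult_left) (rule s)
  qed auto
  hence "(\<lambda>x. norm (case x of (n, k) \<Rightarrow> s n * t k)) summable_on UNIV \<times> UNIV"
    by (simp add: case_prod_unfold)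
  hence sm: "(\<lambda>(n, k). s n * t k) summable_on UNIV \<times> UNIV"
    by (rule abs_summable_summable)
  have "((\<lambda>(n, k). s n * t k) has_sum (infsum s UNIV * infsum t UNIV)) (UNIV \<times> UNIV)"
  proof (rule has_sum_SigmaI[OF _ _ sm])
    show "((\<lambda>k. case (n, k) of (n, k) \<Rightarrow> s n * t k) has_sum (s n * infsum t UNIV)) UNIV" for n
      using has_sum_cmult_right[OF sT] by simp
    show "((\<lambda>n. s n * infsum t UNIV) has_sum (infsum s UNIV * infsum t UNIV)) UNIV"
      by (rule has_sum_cmult_left[OF sS])
  qed
  also have "?this \<longleftrightarrow> ((\<lambda>(N, n). s n * t (N - n)) has_sum (infsum s UNIV * infsum t UNIV)) (UNIV \<times> UNIV)"
    by (rule has_sum_reindex_bij_witness[of _ "\<lambda>(N, n). (n, N - n)" "\<lambda>(n, k). (n + k, n)"]) auto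
  finally have hs: "((\<lambda>(N, n). s n * t (N - n)) has_sum (infsum s UNIV * infsum t UNIV)) (UNIV \<times> UNIV)" .
  have inner: "(\<lambda>n. s n * t (N - n)) summable_on UNIV" for N
    using summable_on_SigmaD1[of "\<lambda>N n. s n * t (N - n)" UNIV "\<lambda>_. UNIV" N] hs
    by (auto simp: summable_on_def)
  thus "(\<lambda>n. s n * t (N - n)) summable_on UNIV" .
  show "((\<lambda>N. \<Sum>\<^sub>\<infinity>n\<in>UNIV. s n * t (N - n)) has_sum (infsum s UNIV * infsum t UNIV)) UNIV"
    by (rule has_sum_SigmaD[OF hs]) (use inner in auto)
qed

text \<open>
  By the triple product identity, \<open>theta p v\<close> is \<open>(p; p)\<^sub>\<infinity> (v; p)\<^sub>\<infinity> (p/v; p)\<^sub>\<infinity>\<close>.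
\<close>

definition theta :: "complex \<Rightarrow> complex \<Rightarrow> complex" where
  "theta p v = (\<Sum>\<^sub>\<infinity>n\<in>UNIV. (-1) powi n * p powi tri n * v powi n)"

text \<open>The level one Appell--Lerch sum.\<close>

definition appell :: "complex \<Rightarrow> complex \<Rightarrow> complex \<Rightarrow> complex" where
  "appell p u v = (\<Sum>\<^sub>\<infinity>n\<in>UNIV. (-1) powi n * p powi tri (n + 1) * v powi n / (1 - u * p powi n))"

context
  fixes p :: complex
  assumes p: "0 < norm p" "norm p < 1"
begin

lemma p0: "p \<noteq> 0" using p by auto

context notes p0 [simp] begin

lemma abs_summable_theta:
  assumes "v \<noteq> 0"
  shows "(\<lambda>n. norm ((-1) powi n * p powi tri n * v powi n)) summable_on UNIV"
  using summable_theta_real[of "norm p" "norm v"] p assms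
  by (simp add: norm_mult norm_power_int)

lemma summable_theta:
  assumes "v \<noteq> 0"
  shows "(\<lambda>n. (-1) powi n * p powi tri n * v powi n) summable_on UNIV"
  using abs_summable_theta[OF assms] by (rule abs_summable_summable)

text \<open>
  The numbers \<open>u p\<^sup>n\<close> tend to 0 in one direction and to infinity in the other, so that all but finitely
  many of them keep a fixed distance from 1.
\<close>

lemma denominator_bounded:
  assumes "\<And>n. u * p powi n \<noteq> 1"
  shows "\<exists>C>0. \<forall>n. norm (1 / (1 - u * p powi n)) \<le> C"
proof (cases "u = 0")
  case True
  thus ?thesis by (intro exI[of _ 1]) auto
next
  case False
  define r where "r = norm p"
  have lim: "(\<lambda>n. K * r ^ n) \<longlonglongrightarrow> K * 0" for K :: real
    by (intro tendsto_mult tendsto_const LIMSEQ_power_zero) (use p in \<open>auto simp: r_def\<close>)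
  have "eventually (\<lambda>n. norm u * r ^ n < 1/2) sequentially"
    by (rule order_tendstoD(2)[OF lim]) simp
  then obtain N where N: "\<And>n. n \<ge> N \<Longrightarrow> norm u * r ^ n < 1/2"
    by (auto simp: eventually_sequentially)
  have "eventually (\<lambda>n. (1 / norm u) * r ^ n < 1/2) sequentially"
    by (rule order_tendstoD(2)[OF lim]) simp
  then obtain M where M: "\<And>n. n \<ge> M \<Longrightarrow> (1 / norm u) * r ^ n < 1/2"
    by (auto simp: eventually_sequentially)
  define B where "B = (\<Sum>n\<in>{-int M..int N}. norm (1 / (1 - u * p powi n)))"
  have B: "norm (1 / (1 - u * p powi n)) \<le> B" if "n \<in> {-int M..int N}" for n
    unfolding B_def using that by (intro member_le_sum) auto
  have big: "norm (1 / (1 - u * p powi n)) \<le> 2" if "n > int N" for n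
  proof -
    have "norm (u * p powi n) = norm u * r ^ nat n"
      using that by (simp add: norm_mult norm_power r_def power_int_def)
    also have "\<dots> < 1/2" using that by (intro N) auto
    finally have "norm (1 - u * p powi n) \<ge> 1/2"
      using norm_triangle_ineq2[of 1 "u * p powi n"] by simp
    thus ?thesis by (simp add: norm_divide divide_simps split: if_splits)
  qed
  have small: "norm (1 / (1 - u * p powi n)) \<le> 2" if "n < - int M" for n
  proof -
    have "norm u * r powi n = 1 / ((1 / norm u) * r ^ nat (-n))"
      using that p False by (simp add: r_def power_int_def power_inverse field_simps)
    moreover have "(1 / norm u) * r ^ nat (-n) < 1/2" using that by (intro M) auto
    moreover have "(1 / norm u) * r ^ nat (-n) > 0" using p False by (simp add: r_def)
    moreover have "1 / z > 2" if "0 < z" "z < 1/2" for z :: real using that by (simp add: field_simps)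
    ultimately have "norm u * r powi n > 2" by metis
    hence "norm (u * p powi n) > 2" by (simp add: norm_mult norm_power_int r_def)
    hence "norm (1 - u * p powi n) \<ge> 1"
      using norm_triangle_ineq2[of "u * p powi n" 1] by (simp add: norm_minus_commute)
    thus ?thesis by (simp add: norm_divide divide_simps split: if_splits)
  qed
  show ?thesis
  proof (intro exI[of _ "max B 2"] conjI allI)
    fix n show "norm (1 / (1 - u * p powi n)) \<le> max B 2"
      using B[of n] big[of n] small[of n] by (cases "n > int N"; cases "n < - int M") auto
  qed simp
qed

lemma abs_summable_appell:
  assumes "\<And>n. u * p powi n \<noteq> 1" "v \<noteq> 0"
  shows "(\<lambda>n. norm ((-1) powi n * p powi tri (n + 1) * v powi n / (1 - u * p powi n))) summable_on UNIV"
proof -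
  obtain C where C: "C > 0" "\<And>n. norm (1 / (1 - u * p powi n)) \<le> C"
    using denominator_bounded[OF assms(1)] by auto
  have s: "(\<lambda>n. C * norm ((-1) powi n * p powi tri n * (p * v) powi n)) summable_on UNIV"
    by (rule summable_on_cmult_right, rule abs_summable_theta) (use assms in simp)
  show ?thesis
  proof (rule summable_on_comparison_test[OF s])
    fix n :: int
    have "norm ((-1) powi n * p powi tri (n + 1) * v powi n / (1 - u * p powi n))
       = norm ((-1) powi n * p powi tri n * (p * v) powi n) * norm (1 / (1 - u * p powi n))"
      by (simp add: tri_Suc power_int_add norm_mult norm_divide power_int_mult_distrib)
    also have "\<dots> \<le> norm ((-1) powi n * p powi tri n * (p * v) powi n) * C"
      by (rule mult_left_mono[OF C(2)]) simp
    finally show "norm ((-1) powi n * p powi tri (n + 1) * v powi n / (1 - u * p powi n))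
       \<le> C * norm ((-1) powi n * p powi tri n * (p * v) powi n)" by (simp add: mult.commute)
  qed simp
qed

lemma summable_appell:
  assumes "\<And>n. u * p powi n \<noteq> 1" "v \<noteq> 0"
  shows "(\<lambda>n. (-1) powi n * p powi tri (n + 1) * v powi n / (1 - u * p powi n)) summable_on UNIV"
  using abs_summable_appell[OF assms] by (rule abs_summable_summable)

lemma theta_inverse:
  assumes "v \<noteq> 0"
  shows "theta p (1 / v) = - theta p v / v"
proof -
  have "theta p (1 / v) = (\<Sum>\<^sub>\<infinity>n\<in>UNIV. (-1) powi (1 - n) * p powi tri (1 - n) * (1 / v) powi (1 - n))"
    unfolding theta_def
    by (rule infsum_reindex_bij_witness[of _ "\<lambda>n. 1 - n" "\<lambda>n. 1 - n"]) auto
  also have "\<dots> = (\<Sum>\<^sub>\<infinity>n\<in>UNIV. (- (1 / v)) * ((-1) powi n * p powi tri n * v powi n))"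
  proof (rule infsum_cong)
    fix n :: int
    have "tri (1 - n) = tri n"
      using two_tri[of n] two_tri[of "1 - n"] by (simp add: algebra_simps)
    thus "(-1) powi (1 - n) * p powi tri (1 - n) * (1 / v) powi (1 - n)
        = (- (1 / v)) * ((-1) powi n * p powi tri n * v powi n)"
      using assms by (simp add: power_int_diff power_int_divide_distrib power_int_minus_one_minus flip: power_int_minus_left) (simp add: field_simps power_int_minus_left)
  qed
  also have "\<dots> = - theta p v / v"
    unfolding theta_def by (subst infsum_cmult_right') simp
  finally show ?thesis .
qed

lemma theta_shift:
  assumes "v \<noteq> 0"
  shows "theta p (p * v) = - theta p v / v"
proof -
  have "theta p v = (\<Sum>\<^sub>\<infinity>n\<in>UNIV. (-1) powi (n + 1) * p powi tri (n + 1) * v powi (n + 1))"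
    unfolding theta_def
    by (rule infsum_reindex_bij_witness[of _ "\<lambda>n. n + 1" "\<lambda>n. n - 1"]) auto
  also have "\<dots> = (\<Sum>\<^sub>\<infinity>n\<in>UNIV. (- v) * ((-1) powi n * p powi tri n * (p * v) powi n))"
    by (rule infsum_cong) (use assms in \<open>simp add: power_int_add tri_Suc power_int_mult_distrib\<close>)
  also have "\<dots> = - v * theta p (p * v)"
    unfolding theta_def by (subst infsum_cmult_right') simp
  finally show ?thesis using assms by simp
qed

lemma theta_one: "theta p 1 = 0"
  using theta_inverse[of 1] by simp

lemma appell_inverse:
  assumes "u \<noteq> 0" "v \<noteq> 0"
  shows "appell p (1 / u) (1 / v) = - u * appell p u v"
proof -
  have "appell p (1 / u) (1 / v) = (\<Sum>\<^sub>\<infinity>n\<in>UNIV. (-1) powi (- n) * p powi tri (- n + 1) * (1 / v) powi (- n) / (1 - 1 / u * p powi (- n)))"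
    unfolding appell_def
    by (rule infsum_reindex_bij_witness[of _ uminus uminus]) auto
  also have "\<dots> = (\<Sum>\<^sub>\<infinity>n\<in>UNIV. (- u) * ((-1) powi n * p powi tri (n + 1) * v powi n / (1 - u * p powi n)))"
  proof (rule infsum_cong)
    fix n :: int
    have 1: "tri (- n + 1) = tri n"
      using two_tri[of n] two_tri[of "- n + 1"] by (simp add: algebra_simps)
    have 2: "1 - 1 / u * p powi (- n) = - (1 - u * p powi n) / (u * p powi n)"
      using assms by (simp add: power_int_minus field_simps)
    have 3: "(-1 :: complex) powi (- n) = (-1) powi n"
      by (simp add: power_int_minus_one_minus)
    have 4: "(1 / v) powi (- n) = v powi n"
      using assms by (simp add: power_int_divide_distrib power_int_minus field_simps)
    show "(-1) powi (- n) * p powi tri (- n + 1) * (1 / v) powi (- n) / (1 - 1 / u * p powi (- n))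
        = (- u) * ((-1) powi n * p powi tri (n + 1) * v powi n / (1 - u * p powi n))"
      unfolding 1 2 3 4
      by (cases "u * p powi n = 1") (simp, simp add: tri_Suc power_int_add divide_simps, simp add: algebra_simps)
  qed
  also have "\<dots> = - u * appell p u v"
    unfolding appell_def by (subst infsum_cmult_right') simp
  finally show ?thesis .
qed

lemma appell_shift:
  assumes "v \<noteq> 0"
  shows "appell p (p * u) (p * v) = - appell p u v / (p * v)"
proof -
  have "appell p u v = (\<Sum>\<^sub>\<infinity>n\<in>UNIV. (-1) powi (n + 1) * p powi tri (n + 1 + 1) * v powi (n + 1) / (1 - u * p powi (n + 1)))"
    unfolding appell_def
    by (rule infsum_reindex_bij_witness[of _ "\<lambda>n. n + 1" "\<lambda>n. n - 1"]) auto
  also have "\<dots> = (\<Sum>\<^sub>\<infinity>n\<in>UNIV. (- (p * v)) * ((-1) powi n * p powi tri (n + 1) * (p * v) powi n / (1 - p * u * p powi n)))"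
  proof (rule infsum_cong)
    fix n :: int
    have 1: "tri (n + 1 + 1) = tri (n + 1) + (n + 1)" by (rule tri_Suc)
    show "(-1) powi (n + 1) * p powi tri (n + 1 + 1) * v powi (n + 1) / (1 - u * p powi (n + 1))
      = (- (p * v)) * ((-1) powi n * p powi tri (n + 1) * (p * v) powi n / (1 - p * u * p powi n))"
      unfolding 1 using assms by (simp add: power_int_add power_int_mult_distrib mult_ac)
  qed
  also have "\<dots> = - (p * v) * appell p (p * u) (p * v)"
    unfolding appell_def by (subst infsum_cmult_right') simp
  finally show ?thesis using assms by simp
qed

text \<open>
  The product as a Laurent series in \<open>a\<close>: the quadratic exponents combine to \<open>tri N + n (n + 1 - N)\<close>, and
  the part that depends on \<open>N\<close> alone is the general term of \<open>theta p a\<close>.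
\<close>

lemma appell_times_theta:
  assumes "\<And>n. b * p powi n \<noteq> 1" "a \<noteq> 0" "b \<noteq> 0" "c \<noteq> 0"
  defines "E \<equiv> (\<lambda>N. \<Sum>\<^sub>\<infinity>n\<in>UNIV. p powi (n * (n + 1 - N)) * (b / c) powi n / (1 - b * p powi n))"
  shows "((\<lambda>N. (-1) powi N * p powi tri N * a powi N * (b powi (-N) * E N)) has_sum
           (appell p b (a / c) * theta p (a / b))) UNIV"
    and "(\<lambda>n. p powi (n * (n + 1 - N)) * (b / c) powi n / (1 - b * p powi n)) summable_on UNIV"
proof -
  define s where "s = (\<lambda>n. (-1) powi n * p powi tri (n + 1) * (a / c) powi n / (1 - b * p powi n))"
  define t where "t = (\<lambda>k. (-1) powi k * p powi tri k * (a / b) powi k)"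
  have st: "s n * t (N - n) = (-1) powi N * p powi tri N * a powi N * b powi (-N) *
              (p powi (n * (n + 1 - N)) * (b / c) powi n / (1 - b * p powi n))" for n N
  proof -
    have e: "tri (n + 1) + tri (N - n) = tri N + n * (n + 1 - N)"
      using two_tri[of "n + 1"] two_tri[of "N - n"] two_tri[of N] by (simp add: algebra_simps)
    have "p powi tri (n + 1) * p powi tri (N - n) = p powi tri N * p powi (n * (n + 1 - N))"
      by (simp flip: power_int_add add: e)
    moreover have "(-1::complex) powi n * (-1) powi (N - n) = (-1) powi N"
      by (simp flip: power_int_add)
    moreover have "(a / c) powi n * (a / b) powi (N - n) = a powi N * b powi (-N) * (b / c) powi n"
      using assms by (simp add: power_int_divide_distrib power_int_diff power_int_minus field_simps)
    moreover have "s n * t (N - n) = ((-1) powi n * (-1) powi (N - n)) * (p powi tri (n + 1) * p powi tri (N - n)) *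
        ((a / c) powi n * (a / b) powi (N - n)) / (1 - b * p powi n)"
      by (simp add: s_def t_def)
    ultimately show ?thesis by (simp add: mult_ac)
  qed
  have s: "(\<lambda>n. norm (s n)) summable_on UNIV"
    unfolding s_def by (rule abs_summable_appell) (use assms in auto)
  have t: "(\<lambda>n. norm (t n)) summable_on UNIV"
    unfolding t_def by (rule abs_summable_theta) (use assms in auto)
  note c = int_convolution[OF s t]
  have "appell p b (a / c) * theta p (a / b) = infsum s UNIV * infsum t UNIV"
    by (simp add: appell_def theta_def s_def t_def)
  with c(1) have "((\<lambda>N. \<Sum>\<^sub>\<infinity>n\<in>UNIV. s n * t (N - n)) has_sum (appell p b (a / c) * theta p (a / b))) UNIV" by simp
  moreover have "(\<Sum>\<^sub>\<infinity>n\<in>UNIV. s n * t (N - n)) = (-1) powi N * p powi tri N * a powi N * (b powi (-N) * E N)" for N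
    unfolding st E_def by (subst infsum_cmult_right') simp
  ultimately show "((\<lambda>N. (-1) powi N * p powi tri N * a powi N * (b powi (-N) * E N)) has_sum
           (appell p b (a / c) * theta p (a / b))) UNIV" by simp
  from c(2)[of N] show "(\<lambda>n. p powi (n * (n + 1 - N)) * (b / c) powi n / (1 - b * p powi n)) summable_on UNIV"
    unfolding st using assms by (subst (asm) summable_on_cmult_right') auto
qed

text \<open>
  The left-hand side is a Laurent series in \<open>a\<close> with the coefficients of \<open>theta p a\<close>, multiplied by
  numbers \<open>D N\<close>. These do not depend on \<open>N\<close>: going from \<open>N\<close> to \<open>N + 1\<close> cancels the denominators and
  changes \<open>E b c\<close> by a bilateral Gaussian sum \<open>G b c\<close>, which up to a monomial is symmetric in \<open>b\<close> and \<open>c\<close>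
  by the reflection \<open>n \<mapsto> N - n\<close>.
\<close>

lemma appell_exchange_aux:
  assumes "\<And>n. b * p powi n \<noteq> 1" "\<And>n. c * p powi n \<noteq> 1" "b \<noteq> 0" "c \<noteq> 0"
  shows "\<exists>D. \<forall>a. a \<noteq> 0 \<longrightarrow> appell p b (a / c) * theta p (a / b)
           - c / b * (appell p c (a / b) * theta p (a / c)) = D * theta p a"
proof -
  define E where "E = (\<lambda>b c N. \<Sum>\<^sub>\<infinity>n\<in>UNIV. p powi (n * (n + 1 - N)) * (b / c) powi n / (1 - b * p powi n))"
  define D where "D = (\<lambda>N. b powi (-N) * E b c N - c / b * (c powi (-N) * E c b N))"
  define G where "G = (\<lambda>b c N. \<Sum>\<^sub>\<infinity>n\<in>UNIV. p powi (n * (n - N)) * (b / c) powi n)"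
  have step: "E b c (N + 1) = b * E b c N + G b c N"
    if b: "\<And>n. b * p powi n \<noteq> 1" "b \<noteq> 0" "c \<noteq> 0" for N b c
  proof -
    define f where "f = (\<lambda>N n. p powi (n * (n + 1 - N)) * (b / c) powi n / (1 - b * p powi n))"
    have f: "(f N has_sum E b c N) UNIV" for N
      using appell_times_theta(2)[OF b(1), of 1 c N] b unfolding f_def E_def by auto
    have "((\<lambda>n. f (N + 1) n + - (b * f N n)) has_sum (E b c (N + 1) + - (b * E b c N))) UNIV"
      by (intro has_sum_add f has_sum_uminusI has_sum_cmult_right)
    also have "(\<lambda>n. f (N + 1) n + - (b * f N n)) = (\<lambda>n. p powi (n * (n - N)) * (b / c) powi n)"
    proof
      fix n
      define X where "X = p powi (n * (n - N)) * (b / c) powi n"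
      have e: "n * (n + 1 - N) = n * (n - N) + n" "n * (n + 1 - (N + 1)) = n * (n - N)"
        by (simp_all add: algebra_simps)
      have "f (N + 1) n = X / (1 - b * p powi n)" "f N n = p powi n * X / (1 - b * p powi n)"
        unfolding f_def e X_def by (simp_all add: power_int_add)
      moreover have "X / (1 - b * p powi n) + - (b * (p powi n * X / (1 - b * p powi n))) = X"
      proof -
        have "1 - b * p powi n \<noteq> 0" using b(1)[of n] by simp
        moreover have "X / d - Y / d = (X - Y) / d" for d Y :: complex by (simp add: diff_divide_distrib)
        moreover have "X - b * (p powi n * X) = X * (1 - b * p powi n)" by (simp add: algebra_simps)
        ultimately show ?thesis by simp
      qed
      ultimately show "f (N + 1) n + - (b * f N n) = p powi (n * (n - N)) * (b / c) powi n"
        unfolding X_def by metis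
    qed
    finally have "G b c N = E b c (N + 1) + - (b * E b c N)"
      unfolding G_def by (rule infsumI)
    thus ?thesis by simp
  qed
  have sym: "G c b N = (c / b) powi N * G b c N" for N
  proof -
    have "G c b N = (\<Sum>\<^sub>\<infinity>n\<in>UNIV. p powi ((N - n) * (N - n - N)) * (c / b) powi (N - n))"
      unfolding G_def by (rule infsum_reindex_bij_witness[of _ "\<lambda>n. N - n" "\<lambda>n. N - n"]) auto
    also have "\<dots> = (\<Sum>\<^sub>\<infinity>n\<in>UNIV. (c / b) powi N * (p powi (n * (n - N)) * (b / c) powi n))"
    proof (rule infsum_cong)
      fix n
      have "(N - n) * (N - n - N) = n * (n - N)" by (simp add: algebra_simps)
      thus "p powi ((N - n) * (N - n - N)) * (c / b) powi (N - n) = (c / b) powi N * (p powi (n * (n - N)) * (b / c) powi n)"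
        using assms by (simp add: power_int_diff power_int_divide_distrib field_simps)
    qed
    also have "\<dots> = (c / b) powi N * G b c N"
      unfolding G_def by (subst infsum_cmult_right') simp
    finally show ?thesis .
  qed
  have "D (N + 1) = D N" for N
  proof -
    have "b powi (- (N + 1)) * E b c (N + 1) = b powi (-N) * E b c N + b powi (-N) / b * G b c N"
      using assms by (subst step) (auto simp: power_int_diff field_simps power_int_add power_int_minus)
    moreover have "c / b * (c powi (- (N + 1)) * E c b (N + 1)) = c / b * (c powi (-N) * E c b N) + b powi (-N) / b * G b c N"
      using assms by (subst step) (auto simp: sym power_int_diff field_simps power_int_add power_int_minus power_int_divide_distrib)
    ultimately show ?thesis by (simp add: D_def)
  qed
  hence up: "D (int n) = D 0" and down: "D (- int n) = D 0" for n
  proof -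
    assume *: "\<And>N. D (N + 1) = D N"
    show "D (int n) = D 0"
    proof (induction n)
      case (Suc n)
      thus ?case using *[of "int n"] by (simp add: add.commute)
    qed simp
    show "D (- int n) = D 0"
    proof (induction n)
      case (Suc n)
      thus ?case using *[of "- int (Suc n)"] by simp
    qed simp
  qed
  have D: "D N = D 0" for N
    using up down by (cases N rule: int_cases2) auto
  show ?thesis
  proof (intro exI allI impI)
    fix a :: complex assume a: "a \<noteq> 0"
    have "((\<lambda>N. (-1) powi N * p powi tri N * a powi N * (b powi (-N) * E b c N) +
           - (c / b * ((-1) powi N * p powi tri N * a powi N * (c powi (-N) * E c b N)))) has_sum
           (appell p b (a / c) * theta p (a / b) + - (c / b * (appell p c (a / b) * theta p (a / c))))) UNIV"
      unfolding E_def by (intro has_sum_add has_sum_uminusI has_sum_cmult_right appell_times_theta(1)) (use assms a in auto)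
    also have "(\<lambda>N. (-1) powi N * p powi tri N * a powi N * (b powi (-N) * E b c N) +
           - (c / b * ((-1) powi N * p powi tri N * a powi N * (c powi (-N) * E c b N))))
        = (\<lambda>N. D 0 * ((-1) powi N * p powi tri N * a powi N))"
    proof
      fix N
      have "D 0 = b powi (-N) * E b c N - c / b * (c powi (-N) * E c b N)"
        using D[of N] by (simp add: D_def)
      moreover have "T * x + - (d * (T * y)) = (x - d * y) * T" for T x y d :: complex
        by (simp add: algebra_simps)
      ultimately show "(-1) powi N * p powi tri N * a powi N * (b powi (-N) * E b c N) +
           - (c / b * ((-1) powi N * p powi tri N * a powi N * (c powi (-N) * E c b N)))
        = D 0 * ((-1) powi N * p powi tri N * a powi N)"
        by metis
    qed
    finally have "((\<lambda>N. D 0 * ((-1) powi N * p powi tri N * a powi N)) has_sum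
           (appell p b (a / c) * theta p (a / b) + - (c / b * (appell p c (a / b) * theta p (a / c))))) UNIV" .
    moreover have "((\<lambda>N. D 0 * ((-1) powi N * p powi tri N * a powi N)) has_sum (D 0 * theta p a)) UNIV"
      unfolding theta_def by (intro has_sum_cmult_right has_sum_infsum summable_theta a)
    ultimately show "appell p b (a / c) * theta p (a / b) - c / b * (appell p c (a / b) * theta p (a / c)) = D 0 * theta p a"
      using has_sum_unique by fastforce
  qed
qed

text \<open>
  The constant is found by setting \<open>a = b\<close>, where one of the two products vanishes because
  \<open>theta p 1 = 0\<close>. The choice \<open>a = c\<close> gives a second expression for it.
\<close>

lemma appell_exchange:
  assumes "\<And>n. b * p powi n \<noteq> 1" "\<And>n. c * p powi n \<noteq> 1" "a \<noteq> 0" "b \<noteq> 0" "c \<noteq> 0"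
    and "theta p b \<noteq> 0" "theta p c \<noteq> 0"
  shows "appell p b (a / c) * theta p (a / b) - c / b * (appell p c (a / b) * theta p (a / c))
           = appell p c 1 * theta p c * theta p a * theta p (c / b) / (theta p b * theta p c)"
    and "theta p (c / b) \<noteq> 0 \<Longrightarrow> appell p b 1 * theta p b = appell p c 1 * theta p c"
proof -
  obtain D where D: "\<And>a. a \<noteq> 0 \<Longrightarrow> appell p b (a / c) * theta p (a / b)
           - c / b * (appell p c (a / b) * theta p (a / c)) = D * theta p a"
    using appell_exchange_aux[of b c] assms by blast
  have "theta p (b / c) = - (b / c) * theta p (c / b)"
    using theta_inverse[of "c / b"] assms by simp
  hence b: "appell p c 1 * theta p (c / b) = D * theta p b"
    using D[of b] assms by (simp add: theta_one)
  hence D': "D = appell p c 1 * theta p (c / b) / theta p b"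
    using assms by simp
  have c: "appell p b 1 * theta p (c / b) = D * theta p c"
    using D[of c] assms by (simp add: theta_one)
  show "appell p b (a / c) * theta p (a / b) - c / b * (appell p c (a / b) * theta p (a / c))
           = appell p c 1 * theta p c * theta p a * theta p (c / b) / (theta p b * theta p c)"
    using D[of a] assms by (simp add: D')
  show "appell p b 1 * theta p b = appell p c 1 * theta p c" if "theta p (c / b) \<noteq> 0"
    using c D' that assms by (simp add: field_simps)
qed

end

end

text \<open>
  Dissection modulo \<open>l\<close> leads to the base \<open>Q\<^sup>l\<close> with arguments that are powers of \<open>Q\<close>, where \<open>Q\<close> is the
  \<open>l\<close>-th power of the original variable.
\<close>

definition th :: "int \<Rightarrow> complex \<Rightarrow> int \<Rightarrow> complex" where
  "th l Q k = theta (Q powi l) (Q powi k)"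

definition ap :: "int \<Rightarrow> complex \<Rightarrow> int \<Rightarrow> int \<Rightarrow> complex" where
  "ap l Q r s = appell (Q powi l) (Q powi r) (Q powi s)"

context
  fixes l :: int and Q :: complex
  assumes Q: "0 < norm Q" "norm Q < 1 / 3" and l: "l > 1"
begin

lemma Q0: "Q \<noteq> 0" using Q by auto

context notes Q0 [simp] begin

lemma base: "0 < norm (Q powi l)" "norm (Q powi l) < 1"
proof -
  show "0 < norm (Q powi l)" using Q by (simp add: norm_power_int)
  have "norm Q ^ nat l < 1" using Q l by (subst power_less_one_iff) auto
  thus "norm (Q powi l) < 1" using l by (simp add: norm_power power_int_def)
qed

lemma th_minus: "th l Q (- k) = - th l Q k / Q powi k"
  using theta_inverse[OF base, of "Q powi k"] by (simp add: th_def power_int_minus inverse_eq_divide)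

lemma th_shift: "th l Q (k + l) = - th l Q k / Q powi k"
  using theta_shift[OF base, of "Q powi k"] by (simp add: th_def power_int_add mult.commute)

lemma th_reflect: "th l Q (l - k) = th l Q k"
  using th_shift[of "- k"] by (simp add: th_minus power_int_minus algebra_simps)

lemma th_0: "th l Q 0 = 0"
  using theta_one[OF base] by (simp add: th_def)

lemma ap_minus: "ap l Q (- r) (- s) = - (Q powi r) * ap l Q r s"
  using appell_inverse[OF base, of "Q powi r" "Q powi s"] by (simp add: ap_def power_int_minus inverse_eq_divide)

lemma ap_shift: "ap l Q (r + l) (s + l) = - ap l Q r s / Q powi (s + l)"
  using appell_shift[OF base, of "Q powi s" "Q powi r"] by (simp add: ap_def power_int_add mult.commute)

lemma ap_reflect: "ap l Q (l - r) (l - s) = Q powi (r + s - l) * ap l Q r s"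
  using ap_shift[of "- r" "- s"]
  by (simp add: ap_minus power_int_diff power_int_add power_int_minus field_simps)

text \<open>
  The constant term 1 dominates. The other terms are bounded by \<open>\<bar>Q\<bar> ^ \<bar>n\<bar>\<close>, and their sum is at most
  \<open>2 \<bar>Q\<bar> / (1 - \<bar>Q\<bar>)\<close>, which is less than 1 for \<open>\<bar>Q\<bar> < 1 / 3\<close>.
\<close>

lemma th_nonzero:
  assumes "0 < k" "k < l"
  shows "th l Q k \<noteq> 0"
proof
  assume th0: "th l Q k = 0"
  define f where "f = (\<lambda>n. (-1) powi n * (Q powi l) powi tri n * (Q powi k) powi n)"
  define r where "r = norm Q"
  have r: "0 < r" "r < 1 / 3" using Q by (simp_all add: r_def)
  have nf: "norm (f n) = r powi (l * tri n + k * n)" for n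
    using r by (simp add: f_def norm_mult norm_power_int r_def power_int_add power_int_mult)
  have sf: "f summable_on UNIV"
    unfolding f_def using summable_theta[OF base, of "Q powi k"] by simp
  have "infsum f UNIV = 0" using th0 by (simp add: th_def theta_def f_def)
  hence A: "(f has_sum 0) UNIV" using sf by (simp add: has_sum_iff)
  have f': "f summable_on (UNIV - {0})" using sf by (rule summable_on_subset_banach) auto
  hence "(f has_sum (f 0 + infsum f (UNIV - {0}))) (insert 0 (UNIV - {0}))"
    by (intro has_sum_insert) auto
  hence "(f has_sum (f 0 + infsum f (UNIV - {0}))) UNIV" by (simp add: insert_absorb)
  from has_sum_unique[OF A this] have tail: "infsum f (UNIV - {0}) = - 1"
    by (simp add: f_def add_eq_0_iff)
  have bound: "norm (f n) \<le> r ^ nat \<bar>n\<bar>" if "n \<noteq> 0" for n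
  proof -
    have "\<bar>n\<bar> \<le> l * tri n + k * n"
    proof (cases "n > 0")
      case True
      have "n \<le> k * n" using True assms mult_right_mono[of 1 k n] by simp
      moreover have "0 \<le> l * tri n" using tri_nonneg[of n] l by simp
      ultimately show ?thesis using True by linarith
    next
      case False
      have "n * (n + 1) \<ge> 0" using False that by (intro mult_nonpos_nonpos) auto
      hence "- n \<le> tri n" using two_tri[of n] by (simp add: algebra_simps)
      hence "l * (- n) \<le> l * tri n" using l by (intro mult_left_mono) auto
      moreover have "(l - k) * (- n) \<ge> 1 * (- n)" using False assms by (intro mult_right_mono) auto
      ultimately show ?thesis using False by (simp add: algebra_simps)
    qed
    hence "r powi (l * tri n + k * n) \<le> r powi \<bar>n\<bar>"
      using r by (intro power_int_decreasing) auto
    thus ?thesis by (simp add: nf power_int_def)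
  qed
  have geo: "((\<lambda>n. r ^ n) has_sum (r / (1 - r))) {1..}"
    using has_sum_geometric_from_1[of r] r by simp
  have "((\<lambda>n. r ^ nat \<bar>n\<bar>) has_sum (r / (1 - r))) {0<..}"
    using geo by (subst has_sum_reindex_bij_witness[of _ int nat "{1..}" "\<lambda>n. r ^ n"]) auto
  moreover have "((\<lambda>n. r ^ nat \<bar>n\<bar>) has_sum (r / (1 - r))) {..<0}"
    using geo by (subst has_sum_reindex_bij_witness[of _ "\<lambda>n. - int n" "\<lambda>n. nat (- n)" "{1..}" "\<lambda>n. r ^ n"]) auto
  ultimately have "((\<lambda>n. r ^ nat \<bar>n\<bar>) has_sum (r / (1 - r) + r / (1 - r))) ({0<..} \<union> {..<0})"
    by (rule has_sum_Un_disjoint) auto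
  also have "{0<..} \<union> {..<0} = UNIV - {0::int}" by auto
  finally have g: "((\<lambda>n. r ^ nat \<bar>n\<bar>) has_sum (r / (1 - r) + r / (1 - r))) (UNIV - {0})" .
  have "norm (infsum f (UNIV - {0})) \<le> (r / (1 - r) + r / (1 - r))"
    by (rule norm_infsum_le[OF _ g]) (use f' bound in auto)
  also have "r / (1 - r) < 1 / 2" using r by (simp add: pos_divide_less_eq)
  hence "r / (1 - r) + r / (1 - r) < 1" by linarith
  finally show False using tail by simp
qed

lemma pole_free:
  assumes "\<not> l dvd r"
  shows "Q powi r * (Q powi l) powi n \<noteq> 1"
proof
  assume "Q powi r * (Q powi l) powi n = 1"
  hence "Q powi (r + l * n) = 1" by (simp add: power_int_add power_int_mult)
  hence 1: "norm Q powi (r + l * n) = 1" by (metis norm_one norm_power_int)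
  have "r + l * n = 0"
  proof (rule ccontr)
    assume nz: "r + l * n \<noteq> 0"
    show False
    proof (cases "r + l * n > 0")
      case True
      have "norm Q ^ nat (r + l * n) < 1" using Q True by (subst power_less_one_iff) auto
      with 1 True show False by (simp add: power_int_def)
    next
      case False
      have "norm Q ^ nat (- (r + l * n)) < 1" using Q False nz by (subst power_less_one_iff) auto
      moreover have "norm Q ^ nat (- (r + l * n)) = 1"
        using 1 False nz Q by (simp add: power_int_def power_inverse)
      ultimately show False by simp
    qed
  qed
  hence "r = l * (- n)" by simp
  hence "l dvd r" by (metis dvd_triv_left)
  with assms show False by simp
qed

text \<open>
  The products \<open>ap l Q j 0 * th l Q j\<close> have the same value for all \<open>j\<close>, so the right-hand side can be
  expressed through the one for \<open>j = 1\<close>.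
\<close>

lemma ap_exchange:
  assumes "0 < i" "i < l" "0 < j" "j < l"
  shows "ap l Q i (k - j) * th l Q (k - i) - Q powi (j - i) * (ap l Q j (k - i) * th l Q (k - j))
       = ap l Q 1 0 * th l Q 1 * th l Q k * th l Q (j - i) / (th l Q i * th l Q j)"
proof -
  have d: "\<not> l dvd m" if "0 < m" "m < l" for m using that zdvd_imp_le by fastforce
  have nz: "th l Q i \<noteq> 0" "th l Q j \<noteq> 0" "th l Q 1 \<noteq> 0"
    using th_nonzero assms l by auto
  have const: "ap l Q j 0 * th l Q j = ap l Q 1 0 * th l Q 1"
  proof (cases "j = 1")
    case False
    hence "th l Q (1 - j) \<noteq> 0"
      using th_nonzero[of "j - 1"] th_minus[of "j - 1"] assms by auto
    hence "theta (Q powi l) (Q powi 1 / Q powi j) \<noteq> 0" by (simp add: th_def power_int_diff)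
    from appell_exchange(2)[OF base pole_free pole_free _ _ _ _ _ this, of 1] nz
    show ?thesis using d assms l by (simp add: ap_def th_def)
  qed auto
  have "ap l Q i (k - j) * th l Q (k - i) - Q powi (j - i) * (ap l Q j (k - i) * th l Q (k - j))
     = ap l Q j 0 * th l Q j * th l Q k * th l Q (j - i) / (th l Q i * th l Q j)"
    using appell_exchange(1)[OF base pole_free[of i] pole_free[of j], of "Q powi k"] nz d assms
    by (simp add: ap_def th_def power_int_diff)
  thus ?thesis by (simp only: const)
qed

lemma ap_exchange':
  assumes "0 < i" "i < l" "0 < j" "j < l"
  shows "(ap l Q i (k - j) * th l Q (k - i) - Q powi (j - i) * (ap l Q j (k - i) * th l Q (k - j))) * (th l Q i * th l Q j)
       = ap l Q 1 0 * th l Q 1 * th l Q k * th l Q (j - i)"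
  using ap_exchange[OF assms, of k] th_nonzero[of i] th_nonzero[of j] assms by simp

end
end

section \<open>Relations between Appell sums to the bases \<open>Q ^ 5\<close> and \<open>Q ^ 7\<close>\<close>

lemma cancel_factor: "c \<noteq> 0 \<Longrightarrow> c * x = c * y \<Longrightarrow> x = (y :: complex)" by simp

context
  fixes Q :: complex
  assumes Q: "0 < norm Q" "norm Q < 1 / 3"
begin

abbreviation (input) "A5 \<equiv> ap 5 Q"
abbreviation (input) "t5 \<equiv> th 5 Q"
abbreviation (input) "K5 \<equiv> A5 1 0 * t5 1"

lemma Q_nonzero: "Q \<noteq> 0" using Q by auto

lemma t5_simps:
  "t5 3 = t5 2" "t5 4 = t5 1" "t5 5 = 0" "t5 6 = - t5 1 / Q" "t5 (-1) = - t5 1 / Q" "t5 (-2) = - t5 2 / Q ^ 2" "t5 0 = 0"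
  using th_reflect[OF Q, of 5 2] th_reflect[OF Q, of 5 1] th_reflect[OF Q, of 5 0] th_shift[OF Q, of 5 1]
     th_minus[OF Q, of 5 1] th_minus[OF Q, of 5 2] th_0[OF Q, of 5] 
  by (simp_all)

lemma t5_nz: "t5 1 \<noteq> 0" "t5 2 \<noteq> 0"
  using th_nonzero[OF Q, of 5 1] th_nonzero[OF Q, of 5 2] by simp_all

lemma A5_simps: "A5 4 3 = A5 1 2 / Q ^ 2" "A5 3 1 = Q * A5 2 4" "A5 4 2 = A5 1 3 / Q" "A5 3 2 = A5 2 3"
  "A5 3 3 = A5 2 2 / Q" "A5 3 4 = A5 2 1 / Q ^ 2" "A5 3 5 = A5 2 0 / Q ^ 3"
  using ap_reflect[OF Q, of 5 2 2] ap_reflect[OF Q, of 5 2 1] ap_reflect[OF Q, of 5 2 0] ap_reflect[OF Q, of 5 1 2] ap_reflect[OF Q, of 5 2 4] ap_reflect[OF Q, of 5 1 3] ap_reflect[OF Q, of 5 2 3]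
  by (simp_all add: power_int_minus field_simps)

text \<open>
  Rules that bring the indices of \<^const>\<open>th\<close> and \<^const>\<open>ap\<close> to the base \<open>Q\<^sup>5\<close> into the range up to 2.
\<close>

lemmas index5_simps = t5_simps A5_simps power_int_minus field_simps eval_nat_numeral

abbreviation (input) "A7 \<equiv> ap 7 Q"
abbreviation (input) "t7 \<equiv> th 7 Q"
abbreviation (input) "K7 \<equiv> A7 1 0 * t7 1"

lemma t7_simps:
  "t7 4 = t7 3" "t7 5 = t7 2" "t7 6 = t7 1" "t7 7 = 0" "t7 8 = - t7 1 / Q" "t7 9 = - t7 2 / Q ^ 2" "t7 (-1) = - t7 1 / Q" "t7 (-2) = - t7 2 / Q ^ 2"  "t7 (-3) = - t7 3 / Q ^ 3" "t7 0 = 0"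
  using th_reflect[OF Q, of 7 3] th_reflect[OF Q, of 7 2] th_reflect[OF Q, of 7 1] th_reflect[OF Q, of 7 0]
     th_shift[OF Q, of 7 1] th_shift[OF Q, of 7 2]
     th_minus[OF Q, of 7 1] th_minus[OF Q, of 7 2] th_minus[OF Q, of 7 3] th_0[OF Q, of 7]
  by (simp_all)

lemma t7_nz: "t7 1 \<noteq> 0" "t7 2 \<noteq> 0" "t7 3 \<noteq> 0"
  using th_nonzero[OF Q, of 7 1] th_nonzero[OF Q, of 7 2] th_nonzero[OF Q, of 7 3] by simp_all

lemma A7_simps: "A7 4 1 = Q ^ 2 * A7 3 6" "A7 5 2 = A7 2 5" "A7 6 5 = A7 1 2 / Q ^ 4" "A7 6 4 = A7 1 3 / Q ^ 3"
  "A7 5 3 = A7 2 4 / Q" "A7 4 2 = Q * A7 3 5" "A7 4 3 = A7 3 4" "A7 5 4 = A7 2 3 / Q ^ 2"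
  "A7 4 4 = A7 3 3 / Q" "A7 4 5 = A7 3 2 / Q ^ 2" "A7 4 6 = A7 3 1 / Q ^ 3" "A7 5 5 = A7 2 2 / Q ^ 3" "A7 5 6 = A7 2 1 / Q ^ 4" "A7 5 7 = A7 2 0 / Q ^ 5"
  using ap_reflect[OF Q, of 7 3 3] ap_reflect[OF Q, of 7 3 2] ap_reflect[OF Q, of 7 3 1] ap_reflect[OF Q, of 7 2 2] ap_reflect[OF Q, of 7 2 1] ap_reflect[OF Q, of 7 2 0] ap_reflect[OF Q, of 7 3 6] ap_reflect[OF Q, of 7 2 5] ap_reflect[OF Q, of 7 1 2] ap_reflect[OF Q, of 7 1 3]
    ap_reflect[OF Q, of 7 2 4] ap_reflect[OF Q, of 7 3 5] ap_reflect[OF Q, of 7 3 4] ap_reflect[OF Q, of 7 2 3]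
  by (simp_all add: power_int_minus field_simps)

text \<open>The same for the base \<open>Q\<^sup>7\<close> and the range up to 3.\<close>

lemmas index7_simps = t7_simps A7_simps power_int_minus field_simps eval_nat_numeral

text \<open>
  Each of the following relations is one instance of the exchange identity, with the last three
  numbers as its indices \<open>i\<close>, \<open>j\<close>, \<open>k\<close>. The constant \<open>K5\<close> or \<open>K7\<close> drops out if \<open>k\<close> is a multiple of the
  modulus, because \<open>th l Q k\<close> is then zero.
\<close>

lemma A5_20: "A5 2 0 * t5 2 = K5"
  by (rule cancel_factor[of "t5 1"])
    (use t5_nz Q_nonzero in simp, use ap_exchange'[OF Q, of 5 2 1 1] Q_nonzero in \<open>simp add: index5_simps\<close>)

lemma A5_21: "A5 2 1 * t5 2 = A5 1 2 * t5 1"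
  by (rule cancel_factor[of "t5 1 * t5 2"])
    (use t5_nz Q_nonzero in simp, use ap_exchange'[OF Q, of 5 2 4 5] Q_nonzero in \<open>simp add: index5_simps\<close>)

lemma A5_11: "A5 1 1 * t5 2 - Q * A5 2 2 * t5 1 = K5"
  by (rule cancel_factor[of "t5 1 * t5 2"])
    (use t5_nz Q_nonzero in simp, use ap_exchange'[OF Q, of 5 1 2 3] Q_nonzero in \<open>simp add: index5_simps\<close>)

lemma A5_1m1: "(A5 1 (-1) + Q ^ 2 * A5 2 4) * t5 1 ^ 2 = K5 * t5 2"
  by (rule cancel_factor[of "t5 2"])
    (use t5_nz Q_nonzero in simp, use ap_exchange'[OF Q, of 5 1 3 2] Q_nonzero in \<open>simp add: index5_simps\<close>)

lemma A5_24: "Q * A5 2 4 * t5 2 = A5 1 3 * t5 1"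
  by (rule cancel_factor[of "t5 1 * t5 2"])
    (use t5_nz Q_nonzero in simp, use ap_exchange'[OF Q, of 5 3 4 5] Q_nonzero in \<open>simp add: index5_simps\<close>)

lemma A5_12: "(A5 1 2 - Q * A5 2 3) * t5 2 ^ 2 = K5 * t5 1"
  by (rule cancel_factor[of "t5 1"])
    (use t5_nz Q_nonzero in simp, use ap_exchange'[OF Q, of 5 4 3 6] Q_nonzero in \<open>simp add: index5_simps\<close>)

lemma A7_30: "A7 3 0 * t7 3 = K7"
  by (rule cancel_factor[of "t7 1 * t7 2"])
    (use t7_nz Q_nonzero in simp, use ap_exchange'[OF Q, of 7 3 1 1] Q_nonzero in \<open>simp add: index7_simps\<close>)

lemma A7_2m1: "(A7 2 (-1) + Q ^ 3 * A7 3 6) * t7 1 = K7"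
  by (rule cancel_factor[of "t7 2 * t7 3"])
    (use t7_nz Q_nonzero in simp, use ap_exchange'[OF Q, of 7 2 4 3] Q_nonzero in \<open>simp add: index7_simps\<close>)

lemma A7_1m2: "(A7 1 (-2) + Q ^ 2 * A7 2 5) * (t7 1 * t7 2 ^ 2) = K7 * t7 3 ^ 2"
  by (rule cancel_factor[of "Q"])
    (use t7_nz Q_nonzero in simp, use ap_exchange'[OF Q, of 7 1 5 3] Q_nonzero in \<open>simp add: index7_simps\<close>)

lemma A7_32: "(A7 1 2 - Q * A7 3 2) * t7 2 = K7"
  by (rule cancel_factor[of "t7 1 * t7 3"])
    (use t7_nz Q_nonzero in simp, use ap_exchange'[OF Q, of 7 6 3 8] Q_nonzero in \<open>simp add: index7_simps\<close>)

lemma A7_24: "(A7 1 3 - Q * A7 2 4) * t7 3 = K7"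
  by (rule cancel_factor[of "Q ^ 2 * (t7 1 * t7 2)"])
    (use t7_nz Q_nonzero in simp, use ap_exchange'[OF Q, of 7 5 6 9] Q_nonzero in \<open>simp add: index7_simps\<close>)

lemma A7_21: "A7 2 1 * t7 2 = A7 1 2 * t7 1"
  by (rule cancel_factor[of "t7 1 * t7 2"])
    (use t7_nz Q_nonzero in simp, use ap_exchange'[OF Q, of 7 2 6 7] Q_nonzero in \<open>simp add: index7_simps\<close>)

lemma A7_35: "Q * A7 3 5 * t7 3 = A7 2 4 * t7 2"
  by (rule cancel_factor[of "t7 3 * t7 2"])
    (use t7_nz Q_nonzero in simp, use ap_exchange'[OF Q, of 7 4 5 7] Q_nonzero in \<open>simp add: index7_simps\<close>)

lemma A7_1m1: "(A7 1 (-1) * t7 3 + Q ^ 2 * t7 1 * A7 2 4) * (t7 1 * t7 2) = K7 * t7 3 ^ 2"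
  by (rule cancel_factor[of "Q"])
    (use t7_nz Q_nonzero in simp, use ap_exchange'[OF Q, of 7 1 5 4] Q_nonzero in \<open>simp add: index7_simps\<close>)

lemma A7_22: "(A7 2 2 * t7 3 - Q * t7 2 * A7 3 3) * t7 3 = K7 * t7 1"
  by (rule cancel_factor[of "t7 2"])
    (use t7_nz Q_nonzero in simp, use ap_exchange'[OF Q, of 7 2 3 5] Q_nonzero in \<open>simp add: index7_simps\<close>)

lemma A7_31: "(A7 3 1 * t7 3 - Q * t7 1 * A7 2 4) * t7 3 = K7 * t7 1"
  by (rule cancel_factor[of "t7 2"])
    (use t7_nz Q_nonzero in simp, use ap_exchange'[OF Q, of 7 3 5 6] Q_nonzero in \<open>simp add: index7_simps\<close>)

lemma A7_34: "(A7 1 2 * t7 3 - Q ^ 2 * A7 3 4 * t7 2) * (t7 1 * t7 3) = K7 * t7 2 ^ 2"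
  by (rule cancel_factor[of "Q"])
    (use t7_nz Q_nonzero in simp, use ap_exchange'[OF Q, of 7 6 4 9] Q_nonzero in \<open>simp add: index7_simps\<close>)

lemma A7_11: "(A7 1 1 * t7 3 - Q ^ 2 * t7 1 * A7 3 3) * t7 1 = K7 * t7 2"
  by (rule cancel_factor[of "t7 3"])
    (use t7_nz Q_nonzero in simp, use ap_exchange'[OF Q, of 7 1 3 4] Q_nonzero in \<open>simp add: index7_simps\<close>)

lemma A7_23: "A7 2 3 * t7 2 = A7 3 2 * t7 3"
  by (rule cancel_factor[of "t7 2 * t7 3"])
    (use t7_nz Q_nonzero in simp, use ap_exchange'[OF Q, of 7 3 5 7] Q_nonzero t7_nz in \<open>simp add: index7_simps\<close>)

end

section \<open>Dissection by residue classes\<close>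

lemma has_sum_residue_classes:
  fixes f :: "int \<Rightarrow> complex" and l :: int
  assumes l: "l > 0" and f: "\<And>r. 0 \<le> r \<Longrightarrow> r < l \<Longrightarrow> ((\<lambda>m. f (l * m + r)) has_sum S r) UNIV"
  shows "(f has_sum (\<Sum>r\<in>{0..<l}. S r)) UNIV"
proof -
  define B where "B = (\<lambda>r. {n. n mod l = r})"
  have 1: "(f has_sum S r) (B r)" if "r \<in> {0..<l}" for r
  proof -
    have "((\<lambda>m. f (l * m + r)) has_sum S r) UNIV \<longleftrightarrow> (f has_sum S r) (B r)"
      by (rule has_sum_reindex_bij_witness[of _ "\<lambda>n. n div l" "\<lambda>m. l * m + r"])
         (use l that in \<open>auto simp: B_def\<close>)
    thus ?thesis using f that by auto
  qed
  have "(f has_sum sum S {0..<l}) (\<Union>(B ` {0..<l}))"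
    by (rule sum_has_sum) (use 1 in \<open>auto simp: B_def\<close>)
  moreover have "\<Union>(B ` {0..<l}) = UNIV" using l by (auto simp: B_def)
  ultimately show ?thesis by simp
qed

lemma has_sum_finite_sum:
  fixes f :: "'j \<Rightarrow> 'i \<Rightarrow> complex"
  assumes "finite J" "\<And>j. j \<in> J \<Longrightarrow> (f j has_sum S j) A"
  shows "((\<lambda>x. \<Sum>j\<in>J. f j x) has_sum (\<Sum>j\<in>J. S j)) A"
  using assms by (induction J rule: finite_induct) (auto intro!: has_sum_add)

lemma power_int_eq_one_imp:
  fixes x :: real
  assumes "0 < x" "x < 1" "x powi n = 1"
  shows "n = 0"
proof (rule ccontr)
  assume nz: "n \<noteq> 0"
  have "x ^ nat \<bar>n\<bar> < 1" using assms nz by (subst power_less_one_iff) auto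
  moreover have "x ^ nat \<bar>n\<bar> = 1"
    using assms nz by (cases "n > 0") (auto simp: power_int_def power_inverse)
  ultimately show False by simp
qed

lemma minus_one_powi_odd_mult: "odd (l::int) \<Longrightarrow> (-1::complex) powi (l * m + r) = (-1) powi m * (-1) powi r"
  by (simp add: power_int_add power_int_mult power_int_minus_one_minus)

text \<open>
  For \<open>n = l m + r\<close> the exponent \<open>tri n\<close> equals \<open>l\<^sup>2 tri m\<close> up to terms linear in \<open>m\<close>. The
  shift by \<open>k = (l - 1) / 2\<close> comes from \<open>tri (l m)\<close>.
\<close>

lemma theta_dissection:
  assumes w: "0 < norm w" "norm w < 1" and v: "v \<noteq> 0" "v powi l = 1" and l: "l = 2 * k + 1" "l > 1"
  shows "theta w v = (\<Sum>r\<in>{0..<l}. (-1) powi r * w powi tri r * v powi r * th l (w powi l) (r + k))"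
proof -
  have q0: "w \<noteq> 0" using w by auto
  have ql: "norm (w powi l) < 1" "0 < norm (w powi l)"
  proof -
    have "norm w ^ nat l < 1" using w l by (subst power_less_one_iff) auto
    thus "norm (w powi l) < 1" using l by (simp add: norm_power power_int_def)
    show "0 < norm (w powi l)" using w by (simp add: norm_power_int)
  qed
  have qll: "0 < norm ((w powi l) powi l)" "norm ((w powi l) powi l) < 1"
  proof -
    have "norm (w powi l) ^ nat l < 1" using ql l by (subst power_less_one_iff) auto
    thus "norm ((w powi l) powi l) < 1" using l by (simp add: norm_power power_int_def)
    show "0 < norm ((w powi l) powi l)" using w by (simp add: norm_power_int)
  qed
  define f where "f = (\<lambda>n. (-1) powi n * w powi tri n * v powi n)"
  have "(f has_sum (\<Sum>r\<in>{0..<l}. (-1) powi r * w powi tri r * v powi r * th l (w powi l) (r + k))) UNIV"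
  proof (rule has_sum_residue_classes)
    fix r assume r: "0 \<le> r" "r < l"
    have e: "tri (l * m + r) = l * (l * tri m) + tri r + l * ((r + k) * m)" for m
    proof -
      have "2 * tri (l * m + r) = l * l * (2 * tri m) + 2 * tri r + 2 * (l * ((r + k) * m))"
        unfolding two_tri l by (simp add: algebra_simps)
      thus ?thesis by simp
    qed
    have "f (l * m + r) = ((-1) powi r * w powi tri r * v powi r) *
       ((-1) powi m * ((w powi l) powi l) powi tri m * ((w powi l) powi (r + k)) powi m)" for m
    proof -
      have "v powi (l * m + r) = v powi r" using v by (simp add: power_int_add power_int_mult)
      moreover have "(-1::complex) powi (l * m + r) = (-1) powi m * (-1) powi r"
        by (rule minus_one_powi_odd_mult) (simp add: l)
      moreover have "w powi tri (l * m + r) = ((w powi l) powi l) powi tri m * w powi tri r * ((w powi l) powi (r + k)) powi m"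
        using q0 unfolding e by (simp add: power_int_add mult.assoc flip: power_int_mult)
      ultimately show ?thesis by (simp add: f_def)
    qed
    moreover have "((\<lambda>m. ((-1) powi r * w powi tri r * v powi r) *
       ((-1) powi m * ((w powi l) powi l) powi tri m * ((w powi l) powi (r + k)) powi m)) has_sum
       ((-1) powi r * w powi tri r * v powi r) * th l (w powi l) (r + k)) UNIV"
      unfolding th_def theta_def by (intro has_sum_cmult_right has_sum_infsum summable_theta qll) (use q0 in simp)
    ultimately show "((\<lambda>m. f (l * m + r)) has_sum (-1) powi r * w powi tri r * v powi r * th l (w powi l) (r + k)) UNIV"
      by simp
  qed (use l in simp)
  thus ?thesis unfolding theta_def f_def by (rule infsumI)
qed

text \<open>
  The polynomial with coefficients \<open>U j\<close> extends each denominator \<open>D t\<close> to \<open>1 - t\<^sup>l\<close>, so that for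
  \<open>n = l m + r\<close> the denominator becomes that of an Appell sum in \<open>m\<close>. This sum would have a pole
  for \<open>r = 0\<close>, but there, and for \<open>r = l - 1\<close>, the numerators \<open>C\<close> vanish.
\<close>

lemma lambert_dissection:
  fixes C :: "int \<Rightarrow> complex" and U :: "nat \<Rightarrow> complex" and D :: "complex \<Rightarrow> complex" and s :: int
  assumes w: "0 < norm w" "norm w < 1" and l: "l = 2 * k + 1" "k > 0"
    and C: "\<And>m r. C (l * m + r) = C r" "C 0 = 0" "C (-1) = 0"
    and D: "\<And>t. D t * (\<Sum>j<nat (l - 1). U j * t ^ j) = 1 - t powi l"
  shows "((\<lambda>n. (-1) powi n * w powi (tri (n + 1) + s * n) * C n / D (w powi n)) has_sum
     (\<Sum>r\<in>{1..l-2}. \<Sum>j<nat (l - 1). (-1) powi r * C r * U j * w powi (tri (r + 1) + (int j + s) * r) *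
         ap l (w powi l) r (r + int j + s - k))) UNIV"
proof -
  have q0: "w \<noteq> 0" using w by auto
  have ql: "norm (w powi l) < 1" "0 < norm (w powi l)"
  proof -
    have "norm w ^ nat l < 1" using w l by (subst power_less_one_iff) auto
    thus "norm (w powi l) < 1" using l by (simp add: norm_power power_int_def)
    show "0 < norm (w powi l)" using w by (simp add: norm_power_int)
  qed
  have qll: "0 < norm ((w powi l) powi l)" "norm ((w powi l) powi l) < 1"
  proof -
    have "norm (w powi l) ^ nat l < 1" using ql l by (subst power_less_one_iff) auto
    thus "norm ((w powi l) powi l) < 1" using l by (simp add: norm_power power_int_def)
    show "0 < norm ((w powi l) powi l)" using w by (simp add: norm_power_int)
  qed
  define f where "f = (\<lambda>n. (-1) powi n * w powi (tri (n + 1) + s * n) * C n / D (w powi n))"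
  define S where "S = (\<lambda>r. if r \<in> {1..l-2} then \<Sum>j<nat (l - 1). (-1) powi r * C r * U j * w powi (tri (r + 1) + (int j + s) * r) *
         ap l (w powi l) r (r + int j + s - k) else 0)"
  have "(f has_sum (\<Sum>r\<in>{0..<l}. S r)) UNIV"
  proof (rule has_sum_residue_classes)
    fix r assume r: "0 \<le> r" "r < l"
    show "((\<lambda>m. f (l * m + r)) has_sum S r) UNIV"
    proof (cases "r \<in> {1..l-2}")
      case False
      hence "r = 0 \<or> r = l - 1" using r by auto
      hence "C r = 0" using C(1)[of 1 "-1"] C by auto
      hence "f (l * m + r) = 0" for m by (simp add: f_def C)
      hence "S r = 0" "(\<lambda>m. f (l * m + r)) = (\<lambda>m. 0)" using False by (auto simp: S_def)
      thus ?thesis by simp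
    next
      case True
      have e: "tri (l * m + r + 1) + (int j + s) * (l * m + r) =
          l * (l * tri (m + 1)) + l * ((r + int j + s - k) * m) + (tri (r + 1) + (int j + s) * r)" for m j
      proof -
        have "2 * tri (l * m + r + 1) + 2 * ((int j + s) * (l * m + r)) = l * l * (2 * tri (m + 1)) +
            2 * (l * ((r + int j + s - k) * m)) + (2 * tri (r + 1) + 2 * ((int j + s) * r))"
          unfolding two_tri l by (simp add: algebra_simps)
        thus ?thesis by simp
      qed
      have nd: "(w powi l) powi r * ((w powi l) powi l) powi m \<noteq> 1" for m
      proof
        assume "(w powi l) powi r * ((w powi l) powi l) powi m = 1"
        hence "w powi (l * (r + l * m)) = 1" using q0 by (simp add: power_int_add power_int_mult algebra_simps)
        hence "norm w powi (l * (r + l * m)) = 1" by (metis norm_one norm_power_int)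
        moreover have "r + l * m \<noteq> 0"
        proof
          assume "r + l * m = 0"
          hence "r = l * (- m)" by simp
          hence "l dvd r" by (metis dvd_triv_left)
          with True show False by (auto dest: zdvd_imp_le)
        qed
        ultimately show False using power_int_eq_one_imp[of "norm w" "l * (r + l * m)"] w l by auto
      qed
      have "f (l * m + r) = (\<Sum>j<nat (l - 1). ((-1) powi r * C r * U j * w powi (tri (r + 1) + (int j + s) * r)) *
          ((-1) powi m * ((w powi l) powi l) powi tri (m + 1) * ((w powi l) powi (r + int j + s - k)) powi m
            / (1 - (w powi l) powi r * ((w powi l) powi l) powi m)))" for m
      proof -
        define n where "n = l * m + r"
        have t: "(w powi n) powi l = (w powi l) powi r * ((w powi l) powi l) powi m"
          using q0 by (simp add: n_def power_int_add algebra_simps power_int_mult_distrib flip: power_int_mult)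
        have "1 - (w powi n) powi l \<noteq> 0" using nd[of m] by (simp add: t)
        hence "1 / D (w powi n) = (\<Sum>j<nat (l - 1). U j * (w powi n) ^ j) / (1 - (w powi n) powi l)"
          using D[of "w powi n"] by (metis (no_types) div_by_0 divide_divide_eq_right eq_divide_eq mult.commute mult_cancel_right1 mult_zero_left nonzero_mult_div_cancel_left)
        hence "f n = (\<Sum>j<nat (l - 1). (-1) powi n * (w powi (tri (n + 1) + s * n) * (w powi n) ^ j) * C n * U j / (1 - (w powi n) powi l))"
          by (simp add: f_def sum_divide_distrib sum_distrib_left mult_ac divide_inverse)
        also have "\<dots> = (\<Sum>j<nat (l - 1). ((-1) powi r * C r * U j * w powi (tri (r + 1) + (int j + s) * r)) *
          ((-1) powi m * ((w powi l) powi l) powi tri (m + 1) * ((w powi l) powi (r + int j + s - k)) powi m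
            / (1 - (w powi l) powi r * ((w powi l) powi l) powi m)))"
        proof (rule sum.cong[OF refl])
          fix j
          have "w powi (tri (n + 1) + s * n) * (w powi n) ^ j = w powi (tri (n + 1) + (int j + s) * n)"
            using q0 by (simp add: power_int_add power_int_mult algebra_simps)
          also have "\<dots> = ((w powi l) powi l) powi tri (m + 1) * ((w powi l) powi (r + int j + s - k)) powi m * w powi (tri (r + 1) + (int j + s) * r)"
            using q0 unfolding n_def e by (simp add: power_int_add mult.assoc flip: power_int_mult)
          finally have 1: "w powi (tri (n + 1) + s * n) * (w powi n) ^ j = \<dots>" .
          have 2: "(-1::complex) powi n = (-1) powi m * (-1) powi r"
            unfolding n_def by (rule minus_one_powi_odd_mult) (simp add: l)
          have 3: "C n = C r" by (simp add: n_def C)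
          show "(-1) powi n * (w powi (tri (n + 1) + s * n) * (w powi n) ^ j) * C n * U j / (1 - (w powi n) powi l)
             = ((-1) powi r * C r * U j * w powi (tri (r + 1) + (int j + s) * r)) *
          ((-1) powi m * ((w powi l) powi l) powi tri (m + 1) * ((w powi l) powi (r + int j + s - k)) powi m
            / (1 - (w powi l) powi r * ((w powi l) powi l) powi m))"
            unfolding 1 2 3 t by simp
        qed
        finally show ?thesis by (simp add: n_def)
      qed
      moreover have "((\<lambda>m. \<Sum>j<nat (l - 1). ((-1) powi r * C r * U j * w powi (tri (r + 1) + (int j + s) * r)) *
          ((-1) powi m * ((w powi l) powi l) powi tri (m + 1) * ((w powi l) powi (r + int j + s - k)) powi m
            / (1 - (w powi l) powi r * ((w powi l) powi l) powi m))) has_sum S r) UNIV"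
      proof -
        have "S r = (\<Sum>j<nat (l - 1). (-1) powi r * C r * U j * w powi (tri (r + 1) + (int j + s) * r) *
         ap l (w powi l) r (r + int j + s - k))" using True by (simp add: S_def)
        thus ?thesis unfolding ap_def appell_def
          by (simp only:) (intro has_sum_finite_sum finite_lessThan has_sum_cmult_right has_sum_infsum summable_appell qll nd, use q0 in simp)
      qed
      ultimately show ?thesis by simp
    qed
  qed (use l in simp)
  moreover have "(\<Sum>r\<in>{0..<l}. S r) = (\<Sum>r\<in>{1..l-2}. S r)"
    by (rule sum.mono_neutral_right) (use l in \<open>auto simp: S_def\<close>)
  ultimately show ?thesis by (simp add: f_def S_def)
qed

section \<open>The Lambert series at third and fifth roots of unity\<close>

text \<open>
  Equal to \<open>x powi (-n) * (1 - x powi n) * (1 - x powi (n + 1))\<close> for \<open>x \<noteq> 0\<close>; in particular it is 0 at 0 and \<open>-1\<close>.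
\<close>

definition numer :: "complex \<Rightarrow> int \<Rightarrow> complex" where
  "numer x n = x powi (-n) + x powi (n + 1) - 1 - x"

definition denom :: "complex \<Rightarrow> complex \<Rightarrow> complex" where
  "denom y t = (1 - y * t) * (1 - t / y)"

text \<open>
  The value \<open>s = 0\<close> belongs to \<^const>\<open>RU\<close> and \<open>s = 1\<close> to \<^const>\<open>RV\<close>.
\<close>

definition lambert :: "int \<Rightarrow> complex \<Rightarrow> complex \<Rightarrow> complex" where
  "lambert s x w = (\<Sum>\<^sub>\<infinity>n\<in>UNIV. (-1) powi n * w powi (tri (n + 1) + s * n) * numer x n / denom (x ^ 2) (w powi n))"

text \<open>
  The quotient \<open>(y\<^sup>j\<^sup>+\<^sup>1 - y\<^sup>-\<^sup>j\<^sup>-\<^sup>1) / (y - y\<^sup>-\<^sup>1)\<close> as a sum, which is also meaningful for \<open>y\<^sup>2 = 1\<close>.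
\<close>

definition geo :: "complex \<Rightarrow> nat \<Rightarrow> complex" where
  "geo y j = (\<Sum>i\<le>j. y ^ i * (1 / y) ^ (j - i))"

lemma numer_periodic:
  assumes "x \<noteq> 0" "x powi l = 1"
  shows "numer x (l * m + r) = numer x r"
proof -
  have "x powi (l * k) = 1" for k using assms by (simp add: power_int_mult)
  from this[of m] this[of "-m"] show ?thesis
    using assms by (simp add: numer_def power_int_add power_int_diff power_int_minus inverse_eq_divide)
qed

lemma geo_Suc: "y \<noteq> 0 \<Longrightarrow> geo y (Suc j) = geo y j / y + y ^ Suc j"
proof -
  assume y: "y \<noteq> 0"
  have "(\<Sum>i\<le>j. y ^ i * (1 / y) ^ (Suc j - i)) = (\<Sum>i\<le>j. y ^ i * (1 / y) ^ (j - i) / y)"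
    by (rule sum.cong) (simp_all add: Suc_diff_le)
  thus ?thesis by (simp add: geo_def sum_divide_distrib)
qed

text \<open>
  The \<^const>\<open>geo\<close> are the Taylor coefficients of \<open>1 / denom y t\<close>. If \<open>y\<^sup>n\<^sup>+\<^sup>1 = 1\<close> and
  \<open>y\<^sup>2 \<noteq> 1\<close>, the right-hand side is \<open>1 - t\<^sup>n\<^sup>+\<^sup>1\<close>.
\<close>

lemma denom_times_geo:
  assumes "y \<noteq> 0"
  shows "denom y t * (\<Sum>j<n. geo y j * t ^ j) = 1 - geo y n * t ^ n + (if n = 0 then 0 else geo y (n - 1) * t ^ (n + 1))"
proof (induction n)
  case 0
  show ?case by (simp add: geo_def)
next
  case (Suc n)
  have d: "denom y t = 1 - (y + 1 / y) * t + t ^ 2"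
    using assms by (simp add: denom_def algebra_simps power2_eq_square)
  have r: "geo y (Suc n) = (y + 1 / y) * geo y n - (if n = 0 then 0 else geo y (n - 1))"
  proof (cases n)
    case 0
    thus ?thesis using assms by (simp add: geo_def)
  next
    case (Suc m)
    have "y ^ Suc (Suc m) = y * geo y (Suc m) - geo y m"
      unfolding geo_Suc[OF assms] using assms by (simp add: distrib_left)
    thus ?thesis using geo_Suc[OF assms, of n] Suc by (simp add: algebra_simps)
  qed
  have "denom y t * (\<Sum>j<Suc n. geo y j * t ^ j) =
     1 - geo y n * t ^ n + (if n = 0 then 0 else geo y (n - 1) * t ^ (n + 1)) + denom y t * (geo y n * t ^ n)"
    using Suc by (simp add: distrib_left)
  also have "\<dots> = 1 - geo y (Suc n) * t ^ Suc n + geo y n * t ^ (Suc n + 1)"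
    unfolding d r by (simp add: algebra_simps power2_eq_square)
  finally show ?case by simp
qed

lemma lambert_expand:
  assumes w: "0 < norm w" "norm w < 1" and l: "l = 2 * k + 1" "k > 0" and x: "x powi l = 1" "geo (x ^ 2) (nat (l - 1)) = 0" "geo (x ^ 2) (nat (l - 1) - 1) = -1"
  shows "lambert s x w = (\<Sum>r\<in>{1..l-2}. \<Sum>j<nat (l - 1). (-1) powi r * numer x r * geo (x ^ 2) j * w powi (tri (r + 1) + (int j + s) * r) *
         ap l (w powi l) r (r + int j + s - k))"
  unfolding lambert_def
proof (rule infsumI, rule lambert_dissection[OF w l])
  have x0: "x \<noteq> 0" using x(1) l by (auto simp: power_int_0_left_if split: if_splits)
  show "numer x (l * m + r) = numer x r" for m r by (rule numer_periodic) (use x x0 in auto)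
  show "numer x 0 = 0" "numer x (-1) = 0" by (simp_all add: numer_def)
  show "denom (x ^ 2) t * (\<Sum>j<nat (l - 1). geo (x ^ 2) j * t ^ j) = 1 - t powi l" for t
    using denom_times_geo[of "x ^ 2" t "nat (l - 1)"] x x0 l by (simp add: power_int_def nat_add_distrib nat_diff_distrib)
qed

lemma fifth_root_relations:
  assumes x: "x ^ 5 = (1::complex)" "x \<noteq> 1"
  shows "x ^ 4 = - 1 - x - x ^ 2 - x ^ 3" "x \<noteq> 0" "1 / x = x ^ 4"
proof -
  have "(1 - x) * (1 + x + x ^ 2 + x ^ 3 + x ^ 4) = 1 - x ^ 5"
    by (simp add: algebra_simps eval_nat_numeral)
  hence "1 + x + x ^ 2 + x ^ 3 + x ^ 4 = 0" using x by simp
  thus "x ^ 4 = - 1 - x - x ^ 2 - x ^ 3" by (simp add: add_eq_0_iff algebra_simps)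
  show "x \<noteq> 0" using x by auto
  thus "1 / x = x ^ 4" using x(1) by (simp add: field_simps eval_nat_numeral)
qed

text \<open>
  All coefficients of the dissected series lie in the ring generated by \<open>a\<close>, a root of \<open>a\<^sup>2 + a = 1\<close>, up to
  the common factor \<open>numer x 1\<close>.
\<close>

lemma fifth_root_constants:
  assumes x: "x ^ 5 = (1::complex)" "x \<noteq> 1"
  defines "a \<equiv> x ^ 2 + x ^ 3"
  shows "a ^ 2 = 1 - a" "geo (x ^ 2) 0 = 1" "geo (x ^ 2) (Suc 0) = a" "geo (x ^ 2) 2 = - a" "geo (x ^ 2) 3 = -1" "geo (x ^ 2) 4 = 0"
    "numer x 2 = - a * numer x 1" "numer x 3 = numer x 1" 
proof -
  note r = fifth_root_relations[OF x]
  have y: "1 / x ^ 2 = x ^ 3" using x(1) r(2) by (simp add: field_simps eval_nat_numeral)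
  show "a ^ 2 = 1 - a" using r(1) x(1) unfolding a_def by algebra
  show g0: "geo (x ^ 2) 0 = 1" by (simp add: geo_def)
  have g: "geo (x ^ 2) (Suc j) = geo (x ^ 2) j * x ^ 3 + (x ^ 2) ^ Suc j" for j
    using geo_Suc[of "x ^ 2" j] r(2) y by (simp add: divide_inverse)
  show g1: "geo (x ^ 2) (Suc 0) = a" using g[of 0] g0 by (simp add: a_def)
  show g2: "geo (x ^ 2) 2 = - a" using g[of 1] g1 r(1) x(1) by (simp add: numeral_2_eq_2 [symmetric] a_def) algebra
  show g3: "geo (x ^ 2) 3 = - 1" using g[of 2] g2 r(1) x(1) by (simp add: a_def) algebra
  show g4: "geo (x ^ 2) 4 = 0" using g[of 3] g3 r(1) x(1) by simp algebra
  have n: "numer x 1 = x ^ 4 + x ^ 2 - 1 - x" "numer x 2 = x ^ 3 + x ^ 3 - 1 - x" "numer x 3 = x ^ 2 + x ^ 4 - 1 - x"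
    using r(2,3) y x(1) by (simp_all add: numer_def power_int_minus inverse_eq_divide) (simp_all add: field_simps eval_nat_numeral)
  show "numer x 2 = - a * numer x 1" unfolding n a_def using r(1) x(1) by algebra
  show "numer x 3 = numer x 1" unfolding n by simp
qed

lemma norm_power_lt:
  assumes "0 < norm w" "norm (w::complex) < 1 / 3" "n > 0"
  shows "0 < norm (w ^ n)" "norm (w ^ n) < 1 / 3"
proof -
  show "0 < norm (w ^ n)" using assms by simp
  have "norm w ^ n \<le> norm w ^ 1" using assms by (intro power_decreasing) auto
  thus "norm (w ^ n) < 1 / 3" using assms by (simp add: norm_power)
qed

lemma theta5:
  assumes w: "0 < norm w" "norm w < 1 / 3" and x: "x ^ 5 = (1::complex)" "x \<noteq> 1"
  shows "theta w x = (1 - x) * (th 5 (w ^ 5) 2 + (x ^ 2 + x ^ 3) * w * th 5 (w ^ 5) 1)"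
proof -
  have i: "{0..<5::int} = {0, 1, 2, 3, 4}" by auto
  note r = fifth_root_relations[OF x]
  note Q = norm_power_lt[OF w, of 5, OF zero_less_numeral]
  have q0: "w \<noteq> 0" using w by auto
  have "theta w x = (\<Sum>r\<in>{0..<5}. (-1) powi r * w powi tri r * x powi r * th 5 (w powi 5) (r + 2))"
    by (rule theta_dissection) (use w x r in simp_all)
  also have "\<dots> = (1 - x) * th 5 (w ^ 5) 2 + (x ^ 2 - x ^ 4) * w * th 5 (w ^ 5) 1"
    using q0 by (simp add: i t5_simps[OF Q]) (simp add: field_simps eval_nat_numeral)
  also have "\<dots> = (1 - x) * (th 5 (w ^ 5) 2 + (x ^ 2 + x ^ 3) * w * th 5 (w ^ 5) 1)"
    by (simp add: algebra_simps eval_nat_numeral)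
  finally show ?thesis .
qed

lemma theta_quotient:
  fixes L :: complex
  shows "L = n * (T * g) \<Longrightarrow> \<theta> = (1 - x) * T \<Longrightarrow> x \<noteq> 1 \<Longrightarrow> L = n / (1 - x) * \<theta> * g"
  by simp

text \<open>
  The dissected Lambert series is a polynomial in \<open>w\<close> and \<open>a\<close> with Appell sums as coefficients. The
  relations between Appell sums exhibit it as the dissected theta function times terms with
  exponents 1, 2 and 4 modulo 5.
\<close>

lemma lambert_U5:
  assumes w: "0 < norm w" "norm w < 1 / 3" and x: "x ^ 5 = (1::complex)" "x \<noteq> 1"
  defines "Q \<equiv> w ^ 5"
  shows "lambert 0 x w = numer x 1 / (1 - x) * theta w x *
     (w * (- (ap 5 Q 1 (-1) + Q ^ 2 * ap 5 Q 2 4) / th 5 Q 2) + w ^ 2 * ((ap 5 Q 1 1 - ap 5 Q 2 0) / th 5 Q 1)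
        + w ^ 4 * (ap 5 Q 1 2 / th 5 Q 2))"
proof -
  have i: "{1..3::int} = {1, 2, 3}" by auto
  have j: "{..<4::nat} = {0, 1, 2, 3}" by auto
  define a where "a = x ^ 2 + x ^ 3"
  note c = fifth_root_constants[OF x, folded a_def]
  note Q = norm_power_lt[OF w, of 5, folded Q_def, OF zero_less_numeral]
  note nz = t5_nz[OF Q]
  have q0: "w \<noteq> 0" using w by auto
  have q1: "norm w < 1" using w by simp
  have "lambert 0 x w = (\<Sum>r\<in>{1..5-2}. \<Sum>j<nat (5 - 1). (-1) powi r * numer x r * geo (x ^ 2) j * w powi (tri (r + 1) + (int j + 0) * r) *
         ap 5 (w powi 5) r (r + int j + 0 - 2))"
    by (rule lambert_expand) (use w q1 x c in simp_all)
  also have "\<dots> = numer x 1 * (- (w * ap 5 Q 1 (-1) + a * w ^ 2 * ap 5 Q 1 0 - a * w ^ 3 * ap 5 Q 1 1 - w ^ 4 * ap 5 Q 1 2)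
      - a * (w ^ 3 * ap 5 Q 2 0 + a * w ^ 5 * ap 5 Q 2 1 - a * w ^ 7 * ap 5 Q 2 2 - w ^ 9 * ap 5 Q 2 3)
      - (w ^ 6 * ap 5 Q 3 1 + a * w ^ 9 * ap 5 Q 3 2 - a * w ^ 12 * ap 5 Q 3 3 - w ^ 15 * ap 5 Q 3 4))" (is "_ = _ * ?B")
    by (simp add: i j c Q_def algebra_simps)
  finally have L: "lambert 0 x w = numer x 1 * ?B" .
  define G where "G = w * (- (ap 5 Q 1 (-1) + Q ^ 2 * ap 5 Q 2 4)) * th 5 Q 1 + w ^ 2 * (ap 5 Q 1 1 - ap 5 Q 2 0) * th 5 Q 2
        + w ^ 4 * ap 5 Q 1 2 * th 5 Q 1"
  have refl: "ap 5 Q 3 1 = w ^ 5 * ap 5 Q 2 4" "ap 5 Q 3 2 = ap 5 Q 2 3" "w ^ 5 * ap 5 Q 3 3 = ap 5 Q 2 2" "w ^ 10 * ap 5 Q 3 4 = ap 5 Q 2 1"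
    using A5_simps[OF Q] q0 by (simp_all add: Q_def flip: power_mult)
  have "th 5 Q 1 * th 5 Q 2 * ?B = (th 5 Q 2 + a * w * th 5 Q 1) * G"
    using refl c(1) A5_20[OF Q] A5_21[OF Q] A5_11[OF Q] A5_1m1[OF Q] unfolding G_def Q_def by algebra
  hence B: "?B = (th 5 Q 2 + a * w * th 5 Q 1) * (G / (th 5 Q 1 * th 5 Q 2))"
    using nz by (simp add: field_simps)
  have G: "G / (th 5 Q 1 * th 5 Q 2) = (w * (- (ap 5 Q 1 (-1) + Q ^ 2 * ap 5 Q 2 4) / th 5 Q 2) + w ^ 2 * ((ap 5 Q 1 1 - ap 5 Q 2 0) / th 5 Q 1)
        + w ^ 4 * (ap 5 Q 1 2 / th 5 Q 2))"
    using nz unfolding G_def by (simp add: field_simps)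
  show ?thesis
    by (rule theta_quotient[OF L[unfolded B G] theta5[OF w x, folded Q_def a_def] x(2)])
qed

lemma lambert_V5:
  assumes w: "0 < norm w" "norm w < 1 / 3" and x: "x ^ 5 = (1::complex)" "x \<noteq> 1"
  defines "Q \<equiv> w ^ 5"
  shows "lambert 1 x w = numer x 1 / (1 - x) * theta w x *
     (Q * ap 5 Q 1 3 / th 5 Q 2 - w ^ 2 * ((Q * ap 5 Q 2 2 + ap 5 Q 1 0) / th 5 Q 2)
        + w ^ 3 * ((ap 5 Q 1 2 - Q * ap 5 Q 2 3) / th 5 Q 1))"
proof -
  have i: "{1..3::int} = {1, 2, 3}" by auto
  have j: "{..<4::nat} = {0, 1, 2, 3}" by auto
  define a where "a = x ^ 2 + x ^ 3"
  note c = fifth_root_constants[OF x, folded a_def]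
  note Q = norm_power_lt[OF w, of 5, folded Q_def, OF zero_less_numeral]
  note nz = t5_nz[OF Q]
  have q0: "w \<noteq> 0" using w by auto
  have q1: "norm w < 1" using w by simp
  have "lambert 1 x w = (\<Sum>r\<in>{1..5-2}. \<Sum>j<nat (5 - 1). (-1) powi r * numer x r * geo (x ^ 2) j * w powi (tri (r + 1) + (int j + 1) * r) *
         ap 5 (w powi 5) r (r + int j + 1 - 2))"
    by (rule lambert_expand) (use w q1 x c in simp_all)
  also have "\<dots> = numer x 1 * (- (w ^ 2 * ap 5 Q 1 0 + a * w ^ 3 * ap 5 Q 1 1 - a * w ^ 4 * ap 5 Q 1 2 - w ^ 5 * ap 5 Q 1 3)
      - a * (w ^ 5 * ap 5 Q 2 1 + a * w ^ 7 * ap 5 Q 2 2 - a * w ^ 9 * ap 5 Q 2 3 - w ^ 11 * ap 5 Q 2 4)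
      - (w ^ 9 * ap 5 Q 3 2 + a * w ^ 12 * ap 5 Q 3 3 - a * w ^ 15 * ap 5 Q 3 4 - w ^ 18 * ap 5 Q 3 5))" (is "_ = _ * ?B")
    by (simp add: i j c Q_def algebra_simps)
  finally have L: "lambert 1 x w = numer x 1 * ?B" .
  define G where "G = Q * ap 5 Q 1 3 * th 5 Q 1 - w ^ 2 * (Q * ap 5 Q 2 2 + ap 5 Q 1 0) * th 5 Q 1
        + w ^ 3 * (ap 5 Q 1 2 - Q * ap 5 Q 2 3) * th 5 Q 2"
  have refl: "ap 5 Q 3 2 = ap 5 Q 2 3" "w ^ 12 * ap 5 Q 3 3 = w ^ 7 * ap 5 Q 2 2" "w ^ 15 * ap 5 Q 3 4 = w ^ 5 * ap 5 Q 2 1" "w ^ 18 * ap 5 Q 3 5 = w ^ 3 * ap 5 Q 2 0"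
  proof -
    have 0: "ap 5 Q 3 2 = ap 5 Q 2 3" "w ^ 5 * ap 5 Q 3 3 = ap 5 Q 2 2" "w ^ 10 * ap 5 Q 3 4 = ap 5 Q 2 1" "w ^ 15 * ap 5 Q 3 5 = ap 5 Q 2 0"
      using A5_simps[OF Q] q0 by (simp_all add: Q_def flip: power_mult)
    have "w ^ 12 * X = w ^ 7 * (w ^ 5 * X)" "w ^ 15 * X = w ^ 5 * (w ^ 10 * X)" "w ^ 18 * X = w ^ 3 * (w ^ 15 * X)" for X
      by (simp_all flip: mult.assoc power_add)
    from this(1)[of "ap 5 Q 3 3"] this(2)[of "ap 5 Q 3 4"] this(3)[of "ap 5 Q 3 5"] 0
    show "ap 5 Q 3 2 = ap 5 Q 2 3" "w ^ 12 * ap 5 Q 3 3 = w ^ 7 * ap 5 Q 2 2" "w ^ 15 * ap 5 Q 3 4 = w ^ 5 * ap 5 Q 2 1" "w ^ 18 * ap 5 Q 3 5 = w ^ 3 * ap 5 Q 2 0"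
      by (simp_all only:)
  qed
  have e: "ap 5 Q 2 0 * th 5 Q 1 = (ap 5 Q 1 2 - Q * ap 5 Q 2 3) * th 5 Q 2"
    by (rule cancel_factor[OF nz(2)]) (use A5_20[OF Q] A5_12[OF Q] in algebra)
  have "?B = - (w ^ 2 * (Q * ap 5 Q 2 2 + ap 5 Q 1 0)) + w ^ 3 * ap 5 Q 2 0 - a * w ^ 3 * ap 5 Q 1 1
      + a * w ^ 4 * (ap 5 Q 1 2 - Q * ap 5 Q 2 3) + Q * ap 5 Q 1 3 + a * w * Q * (Q * ap 5 Q 2 4)"
    using c(1) by (simp add: refl mult.assoc) (simp add: Q_def, algebra)
  moreover have "th 5 Q 1 * th 5 Q 2 * (- (w ^ 2 * (Q * ap 5 Q 2 2 + ap 5 Q 1 0)) + w ^ 3 * ap 5 Q 2 0 - a * w ^ 3 * ap 5 Q 1 1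
      + a * w ^ 4 * (ap 5 Q 1 2 - Q * ap 5 Q 2 3) + Q * ap 5 Q 1 3 + a * w * Q * (Q * ap 5 Q 2 4)) = (th 5 Q 2 + a * w * th 5 Q 1) * G"
    using A5_24[OF Q] A5_11[OF Q] e unfolding G_def by algebra
  ultimately have "th 5 Q 1 * th 5 Q 2 * ?B = (th 5 Q 2 + a * w * th 5 Q 1) * G" by (simp only:)
  hence B: "?B = (th 5 Q 2 + a * w * th 5 Q 1) * (G / (th 5 Q 1 * th 5 Q 2))"
    using nz by (simp add: field_simps)
  have G: "G / (th 5 Q 1 * th 5 Q 2) = (Q * ap 5 Q 1 3 / th 5 Q 2 - w ^ 2 * ((Q * ap 5 Q 2 2 + ap 5 Q 1 0) / th 5 Q 2)
        + w ^ 3 * ((ap 5 Q 1 2 - Q * ap 5 Q 2 3) / th 5 Q 1))"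
    using nz unfolding G_def by (simp add: field_simps)
  show ?thesis
    by (rule theta_quotient[OF L[unfolded B G] theta5[OF w x, folded Q_def a_def] x(2)])
qed

lemma third_root_constants:
  assumes x: "x ^ 3 = (1::complex)" "x \<noteq> 1"
  shows "x \<noteq> 0" "geo (x ^ 2) 0 = 1" "geo (x ^ 2) (Suc 0) = -1" "geo (x ^ 2) 2 = 0"
proof -
  have "(1 - x) * (1 + x + x ^ 2) = 1 - x ^ 3"
    by (simp add: algebra_simps eval_nat_numeral)
  hence r: "1 + x + x ^ 2 = 0" using x by simp
  show x0: "x \<noteq> 0" using x by auto
  hence y: "1 / x ^ 2 = x" using x(1) by (simp add: field_simps eval_nat_numeral)
  show g0: "geo (x ^ 2) 0 = 1" by (simp add: geo_def)
  have g: "geo (x ^ 2) (Suc j) = geo (x ^ 2) j * x + (x ^ 2) ^ Suc j" for j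
    using geo_Suc[of "x ^ 2" j] x0 y by (simp add: divide_inverse)
  show g1: "geo (x ^ 2) (Suc 0) = -1" using g[of 0] g0 r by simp algebra
  show g2: "geo (x ^ 2) 2 = 0" using g[of 1] g1 r x(1) by (simp add: numeral_2_eq_2 [symmetric]) algebra
qed

lemma theta3:
  assumes w: "0 < norm w" "norm w < 1 / 3" and x: "x ^ 3 = (1::complex)" "x \<noteq> 1"
  shows "theta w x = (1 - x) * th 3 (w ^ 3) 1"
proof -
  have i: "{0..<3::int} = {0, 1, 2}" by auto
  note Q = norm_power_lt[OF w, of 3, OF zero_less_numeral]
  have t: "th 3 (w ^ 3) 2 = th 3 (w ^ 3) 1" "th 3 (w ^ 3) 3 = 0"
    using th_reflect[OF Q, of 3 1] th_reflect[OF Q, of 3 0] th_0[OF Q, of 3] by simp_all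
  have "theta w x = (\<Sum>r\<in>{0..<3}. (-1) powi r * w powi tri r * x powi r * th 3 (w powi 3) (r + 1))"
    by (rule theta_dissection) (use w x third_root_constants[OF x] in simp_all)
  also have "\<dots> = (1 - x) * th 3 (w ^ 3) 1"
    by (simp add: i t algebra_simps)
  finally show ?thesis .
qed

text \<open>
  Here only the class \<open>r = 1\<close> contributes and the theta function is a single product, so that no relation
  between Appell sums is needed.
\<close>

lemma lambert_3:
  assumes w: "0 < norm w" "norm w < 1 / 3" and x: "x ^ 3 = (1::complex)" "x \<noteq> 1"
  defines "Q \<equiv> w ^ 3"
  shows "lambert 0 x w = numer x 1 / (1 - x) * theta w x * (w * (- ap 3 Q 1 0 / th 3 Q 1) + w ^ 2 * (ap 3 Q 1 1 / th 3 Q 1))"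
    and "lambert 1 x w = numer x 1 / (1 - x) * theta w x * (Q * ap 3 Q 1 2 / th 3 Q 1 + w ^ 2 * (- ap 3 Q 1 1 / th 3 Q 1))"
proof -
  have j: "{..<2::nat} = {0, 1}" by auto
  note c = third_root_constants[OF x]
  have q0: "w \<noteq> 0" using w by auto
  have q1: "norm w < 1" using w by simp
  have nz: "th 3 Q 1 \<noteq> 0"
    unfolding Q_def using th_nonzero[OF norm_power_lt[OF w, of 3, OF zero_less_numeral], of 3 1] by simp
  have L: "lambert s x w = (\<Sum>r\<in>{1..3-2}. \<Sum>j<nat (3 - 1). (-1) powi r * numer x r * geo (x ^ 2) j * w powi (tri (r + 1) + (int j + s) * r) *
         ap 3 (w powi 3) r (r + int j + s - 1))" for s
    by (rule lambert_expand) (use w q1 x c in simp_all)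
  show "lambert 0 x w = numer x 1 / (1 - x) * theta w x * (w * (- ap 3 Q 1 0 / th 3 Q 1) + w ^ 2 * (ap 3 Q 1 1 / th 3 Q 1))"
    unfolding L theta3[OF w x] using nz x by (simp add: j c field_simps flip: Q_def)
  show "lambert 1 x w = numer x 1 / (1 - x) * theta w x * (Q * ap 3 Q 1 2 / th 3 Q 1 + w ^ 2 * (- ap 3 Q 1 1 / th 3 Q 1))"
    unfolding L theta3[OF w x] using nz x by (simp add: j c field_simps flip: Q_def)
qed

section \<open>The Lambert series at seventh roots of unity\<close>

lemma theta_quotient_minus:
  fixes L :: complex
  shows "L = n * (T * g) \<Longrightarrow> \<theta> = (1 - x) * (- T) \<Longrightarrow> x \<noteq> 1 \<Longrightarrow> L = - (n / (1 - x)) * \<theta> * g"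
  by simp

lemma seventh_root_relations:
  assumes x: "x ^ 7 = (1::complex)" "x \<noteq> 1"
  shows "x ^ 6 = - 1 - x - x ^ 2 - x ^ 3 - x ^ 4 - x ^ 5" "x \<noteq> 0"
proof -
  have "(1 - x) * (1 + x + x ^ 2 + x ^ 3 + x ^ 4 + x ^ 5 + x ^ 6) = 1 - x ^ 7"
    by (simp add: algebra_simps eval_nat_numeral)
  hence "1 + x + x ^ 2 + x ^ 3 + x ^ 4 + x ^ 5 + x ^ 6 = 0" using x by simp
  thus "x ^ 6 = - 1 - x - x ^ 2 - x ^ 3 - x ^ 4 - x ^ 5" by (simp add: add_eq_0_iff algebra_simps)
  show "x \<noteq> 0" using x by auto
qed

text \<open>
  As for fifth roots of unity, but with the cubic ring generated by the sums \<open>a\<close> and \<open>c\<close> of complex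
  conjugate powers of \<open>x\<close>.
\<close>

lemma seventh_root_constants:
  assumes x: "x ^ 7 = (1::complex)" "x \<noteq> 1"
  defines "a \<equiv> x ^ 3 + x ^ 4" and "c \<equiv> x + x ^ 6"
  shows "a ^ 2 = c + 2" "a * c = - 1 - c" "c ^ 2 = 1 - a - c"
    "geo (x ^ 2) 0 = 1" "geo (x ^ 2) (Suc 0) = - 1 - a - c" "geo (x ^ 2) 2 = 1 + a" "geo (x ^ 2) 3 = - 1 - a"
    "geo (x ^ 2) 4 = 1 + a + c" "geo (x ^ 2) 5 = - 1" "geo (x ^ 2) 6 = 0"
    "numer x 2 = (1 + c) * numer x 1" "numer x 3 = (1 - a) * numer x 1" "numer x 4 = (1 + c) * numer x 1" "numer x 5 = numer x 1"
proof -
  note r = seventh_root_relations[OF x]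
  have y: "1 / x ^ k = x ^ (7 - k)" if "k \<le> 7" for k
  proof -
    have "x ^ k * x ^ (7 - k) = 1" using that x(1) by (simp flip: power_add)
    thus ?thesis using r(2) by (simp add: field_simps)
  qed
  show "a ^ 2 = c + 2" "a * c = - 1 - c" "c ^ 2 = 1 - a - c"
    using r(1) x(1) unfolding a_def c_def by algebra+
  show g0: "geo (x ^ 2) 0 = 1" by (simp add: geo_def)
  have g: "geo (x ^ 2) (Suc j) = geo (x ^ 2) j * x ^ 5 + (x ^ 2) ^ Suc j" for j
    using geo_Suc[of "x ^ 2" j] r(2) y[of 2] by (simp add: divide_inverse)
  show g1: "geo (x ^ 2) (Suc 0) = - 1 - a - c" using g[of 0] g0 r(1) by (simp add: a_def c_def)
  show g2: "geo (x ^ 2) 2 = 1 + a" using g[of 1] g1 r(1) x(1) by (simp add: numeral_2_eq_2 [symmetric] a_def c_def) algebra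
  show g3: "geo (x ^ 2) 3 = - 1 - a" using g[of 2] g2 r(1) x(1) by (simp add: a_def c_def) algebra
  show g4: "geo (x ^ 2) 4 = 1 + a + c" using g[of 3] g3 r(1) x(1) by (simp add: a_def c_def) algebra
  show g5: "geo (x ^ 2) 5 = - 1" using g[of 4] g4 r(1) x(1) by (simp add: a_def c_def) algebra
  show g6: "geo (x ^ 2) 6 = 0" using g[of 5] g5 r(1) x(1) by (simp add: a_def c_def) algebra
  have n: "numer x 1 = x ^ 6 + x ^ 2 - 1 - x" "numer x 2 = x ^ 5 + x ^ 3 - 1 - x" "numer x 3 = x ^ 4 + x ^ 4 - 1 - x"
    "numer x 4 = x ^ 3 + x ^ 5 - 1 - x" "numer x 5 = x ^ 2 + x ^ 6 - 1 - x"
    using y[of 1] y[of 2] y[of 3] y[of 4] y[of 5] by (simp_all add: numer_def power_int_minus inverse_eq_divide)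
  show "numer x 2 = (1 + c) * numer x 1" "numer x 3 = (1 - a) * numer x 1" "numer x 4 = (1 + c) * numer x 1" 
    unfolding n a_def c_def using r(1) x(1) by algebra+
  show "numer x 5 = numer x 1" unfolding n by simp
qed

lemma theta7:
  assumes w: "0 < norm w" "norm w < 1 / 3" and x: "x ^ 7 = (1::complex)" "x \<noteq> 1"
  shows "theta w x = (1 - x) * (th 7 (w ^ 7) 3 - (1 + x + x ^ 6) * w * th 7 (w ^ 7) 2 - (x ^ 3 + x ^ 4) * w ^ 3 * th 7 (w ^ 7) 1)"
proof -
  have i: "{0..<7::int} = {0, 1, 2, 3, 4, 5, 6}" by auto
  note r = seventh_root_relations[OF x]
  note Q = norm_power_lt[OF w, of 7, OF zero_less_numeral]
  have q0: "w \<noteq> 0" using w by auto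
  have "theta w x = (\<Sum>r\<in>{0..<7}. (-1) powi r * w powi tri r * x powi r * th 7 (w powi 7) (r + 3))"
    by (rule theta_dissection) (use w x r in simp_all)
  also have "\<dots> = (1 - x) * th 7 (w ^ 7) 3 + (x ^ 2 - x ^ 6) * w * th 7 (w ^ 7) 2 + (x ^ 5 - x ^ 3) * w ^ 3 * th 7 (w ^ 7) 1"
    using q0 by (simp add: i t7_simps[OF Q]) (simp add: field_simps eval_nat_numeral)
  also have "\<dots> = (1 - x) * (th 7 (w ^ 7) 3 - (1 + x + x ^ 6) * w * th 7 (w ^ 7) 2 - (x ^ 3 + x ^ 4) * w ^ 3 * th 7 (w ^ 7) 1)"
    using x(1) by algebra
  finally show ?thesis .
qed

text \<open>
  The quotient is \<open>F1 + F2 + F3 + F4 + F6\<close>, where \<open>Fk\<close> has exponents in the class of \<open>k\<close> modulo 7. Its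
  product with the three terms of the theta function is compared with the dissected Lambert series
  class by class; the equation \<open>Ek\<close> is the one for the class of \<open>k\<close>, and each needs only a few of the
  relations between Appell sums.
\<close>

lemma lambert_U7:
  assumes w: "0 < norm w" "norm w < 1 / 3" and x: "x ^ 7 = (1::complex)" "x \<noteq> 1"
  defines "Q \<equiv> w ^ 7"
  defines "K \<equiv> ap 7 Q 1 0 * th 7 Q 1" and "a \<equiv> x ^ 3 + x ^ 4" and "c \<equiv> x + x ^ 6"
  shows "lambert 0 x w = - (numer x 1 / (1 - x)) * theta w x *
     (w * (K * th 7 Q 3 / (th 7 Q 1 * th 7 Q 2 ^ 2) + (1 + a + c) * Q ^ 2 * ap 7 Q 3 3 / th 7 Q 3)
      - w ^ 2 * (a * K / (th 7 Q 1 * th 7 Q 2)) + w ^ 3 * (K / (th 7 Q 1 * th 7 Q 3))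
      + w ^ 4 * (c * ap 7 Q 1 2 / th 7 Q 2) - w ^ 6 * ((1 + a) * Q * ap 7 Q 2 4 / th 7 Q 3))"
proof -
  have i: "{1..5::int} = {1, 2, 3, 4, 5}" by auto
  have j: "{..<6::nat} = {0, 1, 2, 3, 4, 5}" by auto
  note c = seventh_root_constants[OF x, folded a_def c_def]
  note Q = norm_power_lt[OF w, of 7, folded Q_def, OF zero_less_numeral]
  note nz = t7_nz[OF Q]
  have q0: "w \<noteq> 0" using w by auto
  have q1: "norm w < 1" using w by simp
  have "lambert 0 x w = (\<Sum>r\<in>{1..7-2}. \<Sum>j<nat (7 - 1). (-1) powi r * numer x r * geo (x ^ 2) j * w powi (tri (r + 1) + (int j + 0) * r) *
         ap 7 (w powi 7) r (r + int j + 0 - 3))"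
    by (rule lambert_expand) (use w q1 x c in simp_all)
  also have "\<dots> = numer x 1 * (
      - (w * ap 7 Q 1 (-2) - (1 + a + c) * w ^ 2 * ap 7 Q 1 (-1) + (1 + a) * w ^ 3 * ap 7 Q 1 0
         - (1 + a) * w ^ 4 * ap 7 Q 1 1 + (1 + a + c) * w ^ 5 * ap 7 Q 1 2 - w ^ 6 * ap 7 Q 1 3)
      + (1 + c) * (w ^ 3 * ap 7 Q 2 (-1) - (1 + a + c) * w ^ 5 * ap 7 Q 2 0 + (1 + a) * w ^ 7 * ap 7 Q 2 1
         - (1 + a) * w ^ 9 * ap 7 Q 2 2 + (1 + a + c) * w ^ 11 * ap 7 Q 2 3 - w ^ 13 * ap 7 Q 2 4)
      - (1 - a) * (w ^ 6 * ap 7 Q 3 0 - (1 + a + c) * w ^ 9 * ap 7 Q 3 1 + (1 + a) * w ^ 12 * ap 7 Q 3 2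
         - (1 + a) * w ^ 15 * ap 7 Q 3 3 + (1 + a + c) * w ^ 18 * ap 7 Q 3 4 - w ^ 21 * ap 7 Q 3 5)
      + (1 + c) * (w ^ 10 * ap 7 Q 4 1 - (1 + a + c) * (w ^ 14 * ap 7 Q 4 2) + (1 + a) * (w ^ 18 * ap 7 Q 4 3)
         - (1 + a) * (w ^ 22 * ap 7 Q 4 4) + (1 + a + c) * (w ^ 26 * ap 7 Q 4 5) - w ^ 30 * ap 7 Q 4 6)
      - (w ^ 15 * ap 7 Q 5 2 - (1 + a + c) * (w ^ 20 * ap 7 Q 5 3) + (1 + a) * (w ^ 25 * ap 7 Q 5 4)
         - (1 + a) * (w ^ 30 * ap 7 Q 5 5) + (1 + a + c) * (w ^ 35 * ap 7 Q 5 6) - w ^ 40 * ap 7 Q 5 7))" (is "_ = _ * ?B0")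
    by (simp add: i j c Q_def) algebra
  finally have L: "lambert 0 x w = numer x 1 * ?B0" .
  have Qk: "Q ^ k = w ^ (7 * k)" for k by (simp add: Q_def power_mult)
  have up: "w ^ m * (w ^ n * X) = w ^ (m + n) * X" and down: "w ^ (m + n) * (X / w ^ n) = w ^ m * X" for m n X
    using q0 by (simp_all add: power_add)
  have Q1: "Q * X = w ^ 7 * X" "X / Q = X / w ^ 7" for X by (simp_all add: Q_def)
  have num: "(7::nat) * 2 = 14" "(7::nat) * 3 = 21" "(7::nat) * 4 = 28" "(7::nat) * 5 = 35" "(10::nat) + 14 = 24" "(14::nat) + 7 = 21" by simp_all
  note A = A7_simps[OF Q, unfolded Qk Q1 num]
  note d = down[of 15 7, simplified] down[of 12 14, simplified] down[of 9 21, simplified] down[of 13 7, simplified]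
    down[of 11 14, simplified] down[of 7 28, simplified] down[of 5 35, simplified]
  have refl: "w ^ 10 * ap 7 Q 4 1 = w ^ 24 * ap 7 Q 3 6"
    "w ^ 14 * ap 7 Q 4 2 = w ^ 21 * ap 7 Q 3 5"
    "w ^ 18 * ap 7 Q 4 3 = w ^ 18 * ap 7 Q 3 4"
    "w ^ 22 * ap 7 Q 4 4 = w ^ 15 * ap 7 Q 3 3"
    "w ^ 26 * ap 7 Q 4 5 = w ^ 12 * ap 7 Q 3 2"
    "w ^ 30 * ap 7 Q 4 6 = w ^ 9 * ap 7 Q 3 1"
    "w ^ 15 * ap 7 Q 5 2 = w ^ 15 * ap 7 Q 2 5"
    "w ^ 20 * ap 7 Q 5 3 = w ^ 13 * ap 7 Q 2 4"
    "w ^ 25 * ap 7 Q 5 4 = w ^ 11 * ap 7 Q 2 3"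
    "w ^ 30 * ap 7 Q 5 5 = w ^ 9 * ap 7 Q 2 2"
    "w ^ 35 * ap 7 Q 5 6 = w ^ 7 * ap 7 Q 2 1"
    "w ^ 40 * ap 7 Q 5 7 = w ^ 5 * ap 7 Q 2 0"
    by (simp_all only: A up num times_divide_eq_right d)
  have L: "lambert 0 x w = numer x 1 * (
      - (w * ap 7 Q 1 (-2) - (1 + a + c) * w ^ 2 * ap 7 Q 1 (-1) + (1 + a) * w ^ 3 * ap 7 Q 1 0
         - (1 + a) * w ^ 4 * ap 7 Q 1 1 + (1 + a + c) * w ^ 5 * ap 7 Q 1 2 - w ^ 6 * ap 7 Q 1 3)
      + (1 + c) * (w ^ 3 * ap 7 Q 2 (-1) - (1 + a + c) * w ^ 5 * ap 7 Q 2 0 + (1 + a) * w ^ 7 * ap 7 Q 2 1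
         - (1 + a) * w ^ 9 * ap 7 Q 2 2 + (1 + a + c) * w ^ 11 * ap 7 Q 2 3 - w ^ 13 * ap 7 Q 2 4)
      - (1 - a) * (w ^ 6 * ap 7 Q 3 0 - (1 + a + c) * w ^ 9 * ap 7 Q 3 1 + (1 + a) * w ^ 12 * ap 7 Q 3 2
         - (1 + a) * w ^ 15 * ap 7 Q 3 3 + (1 + a + c) * w ^ 18 * ap 7 Q 3 4 - w ^ 21 * ap 7 Q 3 5)
      + (1 + c) * (w ^ 24 * ap 7 Q 3 6 - (1 + a + c) * (w ^ 21 * ap 7 Q 3 5) + (1 + a) * (w ^ 18 * ap 7 Q 3 4)
         - (1 + a) * (w ^ 15 * ap 7 Q 3 3) + (1 + a + c) * (w ^ 12 * ap 7 Q 3 2) - w ^ 9 * ap 7 Q 3 1)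
      - (w ^ 15 * ap 7 Q 2 5 - (1 + a + c) * (w ^ 13 * ap 7 Q 2 4) + (1 + a) * (w ^ 11 * ap 7 Q 2 3)
         - (1 + a) * (w ^ 9 * ap 7 Q 2 2) + (1 + a + c) * (w ^ 7 * ap 7 Q 2 1) - w ^ 5 * ap 7 Q 2 0))" (is "_ = _ * ?B")
    using L unfolding refl .
  define t1 t2 t3 where "t1 = th 7 Q 1" and "t2 = th 7 Q 2" and "t3 = th 7 Q 3"
  note t = t1_def [symmetric] t2_def [symmetric] t3_def [symmetric]
  note nz = nz[unfolded t]
  define F1 F2 F3 F4 F6 where
    "F1 = w * (K * t3 / (t1 * t2 ^ 2) + (1 + a + c) * w ^ 14 * ap 7 Q 3 3 / t3)" and
    "F2 = - (w ^ 2 * (a * K / (t1 * t2)))" and "F3 = w ^ 3 * (K / (t1 * t3))" and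
    "F4 = w ^ 4 * (c * ap 7 Q 1 2 / t2)" and "F6 = - (w ^ 6 * ((1 + a) * w ^ 7 * ap 7 Q 2 4 / t3))"
  note F = F1_def F2_def F3_def F4_def F6_def
  have Qp: "w ^ 7 = Q" "w ^ 14 = Q ^ 2" "w ^ 21 = Q ^ 3" by (simp_all add: Q_def flip: power_mult)
  have A0: "ap 7 Q 2 1 = ap 7 Q 1 2 * t1 / t2"
    unfolding Qp using A7_21[OF Q, folded K_def, unfolded t] nz by (simp add: field_simps power2_eq_square)
  have A1: "w ^ 7 * ap 7 Q 3 5 = ap 7 Q 2 4 * t2 / t3"
    unfolding Qp using A7_35[OF Q, folded K_def, unfolded t] nz by (simp add: field_simps power2_eq_square)
  have A2: "ap 7 Q 1 0 = K / t1" using nz by (simp add: K_def t)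
  have A3: "ap 7 Q 3 0 = K / t3"
    unfolding Qp using A7_30[OF Q, folded K_def, unfolded t] nz by (simp add: field_simps power2_eq_square)
  have A4: "ap 7 Q 2 (-1) + w ^ 21 * ap 7 Q 3 6 = K / t1"
    unfolding Qp using A7_2m1[OF Q, folded K_def, unfolded t] nz by (simp add: field_simps power2_eq_square)
  have A5: "ap 7 Q 1 (-2) + w ^ 14 * ap 7 Q 2 5 = K * t3 ^ 2 / (t1 * t2 ^ 2)"
    unfolding Qp using A7_1m2[OF Q, folded K_def, unfolded t] nz by (simp add: field_simps power2_eq_square)
  have A6: "w ^ 7 * ap 7 Q 3 2 = ap 7 Q 1 2 - K / t2"
    unfolding Qp using A7_32[OF Q, folded K_def, unfolded t] nz by (simp add: field_simps power2_eq_square)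
  have A7: "ap 7 Q 1 3 = w ^ 7 * ap 7 Q 2 4 + K / t3"
    unfolding Qp using A7_24[OF Q, folded K_def, unfolded t] nz by (simp add: field_simps power2_eq_square)
  have A8: "ap 7 Q 1 (-1) = K * t3 / (t1 * t2) - w ^ 14 * t1 * ap 7 Q 2 4 / t3"
    unfolding Qp using A7_1m1[OF Q, folded K_def, unfolded t] nz by (simp add: field_simps power2_eq_square)
  have A9: "ap 7 Q 2 2 = w ^ 7 * t2 * ap 7 Q 3 3 / t3 + K * t1 / t3 ^ 2"
    unfolding Qp using A7_22[OF Q, folded K_def, unfolded t] nz by (simp add: field_simps power2_eq_square)
  have A10: "ap 7 Q 3 1 = w ^ 7 * t1 * ap 7 Q 2 4 / t3 + K * t1 / t3 ^ 2"
    unfolding Qp using A7_31[OF Q, folded K_def, unfolded t] nz by (simp add: field_simps power2_eq_square)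
  have A11: "w ^ 14 * ap 7 Q 3 4 = ap 7 Q 1 2 * t3 / t2 - K * t2 / (t1 * t3)"
    unfolding Qp using A7_34[OF Q, folded K_def, unfolded t] nz by (simp add: field_simps power2_eq_square)
  have A12: "ap 7 Q 1 1 = w ^ 14 * t1 * ap 7 Q 3 3 / t3 + K * t2 / (t1 * t3)"
    unfolding Qp using A7_11[OF Q, folded K_def, unfolded t] nz by (simp add: field_simps power2_eq_square)
  have A13: "w ^ 7 * ap 7 Q 2 3 = (ap 7 Q 1 2 - K / t2) * t3 / t2"
    unfolding A6[symmetric] using A7_23[OF Q, unfolded t] nz by (simp add: field_simps)
  have E0: "- (1 + c) * w ^ 7 * ap 7 Q 2 1 - a * w ^ 21 * ap 7 Q 3 5 = (1 + c) * w * t2 * F6 + a * w ^ 3 * t1 * F4"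
  proof -
    have "- (1 + c) * w ^ 7 * ap 7 Q 2 1 - a * w ^ 21 * ap 7 Q 3 5 = - (1 + c) * w ^ 7 * (ap 7 Q 2 1) - a * w ^ 14 * (w ^ 7 * ap 7 Q 3 5)"
      by (simp add: algebra_simps flip: power_add power_Suc power_Suc2)
    also have "\<dots> = (1 + c) * w * t2 * F6 + a * w ^ 3 * t1 * F4"
      unfolding A0 A1 F using nz c(1-3) by (simp add: field_simps, algebra?)
    finally show ?thesis .
  qed
  have E1: "- (w ^ 15 * ap 7 Q 2 5 + w * ap 7 Q 1 (-2)) - (1 + a + c) * w ^ 15 * ap 7 Q 3 3 = - t3 * F1"
  proof -
    have "- (w ^ 15 * ap 7 Q 2 5 + w * ap 7 Q 1 (-2)) - (1 + a + c) * w ^ 15 * ap 7 Q 3 3 = - w * (ap 7 Q 1 (-2) + w ^ 14 * ap 7 Q 2 5) - (1 + a + c) * w ^ 15 * ap 7 Q 3 3"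
      by (simp add: algebra_simps flip: power_add power_Suc power_Suc2)
    also have "\<dots> = - t3 * F1"
      unfolding A5 F using nz c(1-3) by (simp add: field_simps eval_nat_numeral)
    finally show ?thesis .
  qed
  have E2: "w ^ 9 * ap 7 Q 2 2 + (1 + a + c) * w ^ 2 * ap 7 Q 1 (-1) - w ^ 9 * ap 7 Q 3 1 = - t3 * F2 + (1 + c) * w * t2 * F1 + a * w ^ 3 * t1 * F6"
    unfolding A8 A9 A10 F using nz c(1-3) by (simp add: field_simps, algebra?)
  have E3: "(1 + c) * (w ^ 24 * ap 7 Q 3 6 + w ^ 3 * ap 7 Q 2 (-1)) - (1 + a) * w ^ 3 * ap 7 Q 1 0 = - t3 * F3 + (1 + c) * w * t2 * F2"
  proof -
    have "(1 + c) * (w ^ 24 * ap 7 Q 3 6 + w ^ 3 * ap 7 Q 2 (-1)) - (1 + a) * w ^ 3 * ap 7 Q 1 0 = (1 + c) * w ^ 3 * (ap 7 Q 2 (-1) + w ^ 21 * ap 7 Q 3 6) - (1 + a) * w ^ 3 * ap 7 Q 1 0"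
      by (simp add: algebra_simps flip: power_add power_Suc power_Suc2)
    also have "\<dots> = - t3 * F3 + (1 + c) * w * t2 * F2"
      unfolding A4 A2 F using nz c(1-3) by (simp add: field_simps, algebra?)
    finally show ?thesis .
  qed
  have E4: "- a * w ^ 11 * ap 7 Q 2 3 + (a - c) * w ^ 18 * ap 7 Q 3 4 + (1 + a) * w ^ 4 * ap 7 Q 1 1 = - t3 * F4 + (1 + c) * w * t2 * F3 + a * w ^ 3 * t1 * F1"
  proof -
    have "- a * w ^ 11 * ap 7 Q 2 3 + (a - c) * w ^ 18 * ap 7 Q 3 4 + (1 + a) * w ^ 4 * ap 7 Q 1 1 = - a * w ^ 4 * (w ^ 7 * ap 7 Q 2 3) + (a - c) * w ^ 4 * (w ^ 14 * ap 7 Q 3 4) + (1 + a) * w ^ 4 * ap 7 Q 1 1"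
      by (simp add: algebra_simps flip: power_add power_Suc power_Suc2)
    also have "\<dots> = - t3 * F4 + (1 + c) * w * t2 * F3 + a * w ^ 3 * t1 * F1"
      unfolding A13 A11 A12 F using nz c(1-3) by (simp add: field_simps, algebra?)
    finally show ?thesis .
  qed
  have E5: "- (1 + a + c) * w ^ 5 * ap 7 Q 1 2 + (2 + c) * w ^ 12 * ap 7 Q 3 2 = (1 + c) * w * t2 * F4 + a * w ^ 3 * t1 * F2"
  proof -
    have "- (1 + a + c) * w ^ 5 * ap 7 Q 1 2 + (2 + c) * w ^ 12 * ap 7 Q 3 2 = - (1 + a + c) * w ^ 5 * ap 7 Q 1 2 + (2 + c) * w ^ 5 * (w ^ 7 * ap 7 Q 3 2)"
      by (simp add: algebra_simps flip: power_add power_Suc power_Suc2)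
    also have "\<dots> = (1 + c) * w * t2 * F4 + a * w ^ 3 * t1 * F2"
      unfolding A6 F using nz c(1-3) by (simp add: field_simps, algebra?)
    finally show ?thesis .
  qed
  have E6: "w ^ 6 * ap 7 Q 1 3 + a * w ^ 13 * ap 7 Q 2 4 + (a - 1) * w ^ 6 * ap 7 Q 3 0 = - t3 * F6 + a * w ^ 3 * t1 * F3"
    unfolding A7 A3 F using nz c(1-3) by (simp add: field_simps, algebra?)
  have B: "?B = (- (1 + c) * w ^ 7 * ap 7 Q 2 1 - a * w ^ 21 * ap 7 Q 3 5)
     + (- (w ^ 15 * ap 7 Q 2 5 + w * ap 7 Q 1 (-2)) - (1 + a + c) * w ^ 15 * ap 7 Q 3 3)
     + (w ^ 9 * ap 7 Q 2 2 + (1 + a + c) * w ^ 2 * ap 7 Q 1 (-1) - w ^ 9 * ap 7 Q 3 1)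
     + ((1 + c) * (w ^ 24 * ap 7 Q 3 6 + w ^ 3 * ap 7 Q 2 (-1)) - (1 + a) * w ^ 3 * ap 7 Q 1 0)
     + (- a * w ^ 11 * ap 7 Q 2 3 + (a - c) * w ^ 18 * ap 7 Q 3 4 + (1 + a) * w ^ 4 * ap 7 Q 1 1)
     + (- (1 + a + c) * w ^ 5 * ap 7 Q 1 2 + (2 + c) * w ^ 12 * ap 7 Q 3 2)
     + (w ^ 6 * ap 7 Q 1 3 + a * w ^ 13 * ap 7 Q 2 4 + (a - 1) * w ^ 6 * ap 7 Q 3 0)"
    using c(1-3) by algebra
  hence B: "?B = (- t3 + (1 + c) * w * t2 + a * w ^ 3 * t1) * (F1 + F2 + F3 + F4 + F6)"
    unfolding E0 E1 E2 E3 E4 E5 E6 by algebra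
  have th: "theta w x = (1 - x) * (- (- t3 + (1 + c) * w * t2 + a * w ^ 3 * t1))"
    using theta7[OF w x] by (simp add: Q_def t1_def t2_def t3_def a_def c_def algebra_simps)
  have "lambert 0 x w = - (numer x 1 / (1 - x)) * theta w x * (F1 + F2 + F3 + F4 + F6)"
    by (rule theta_quotient_minus[OF L[unfolded B] th x(2)])
  also have "F1 + F2 + F3 + F4 + F6 = w * (K * th 7 Q 3 / (th 7 Q 1 * th 7 Q 2 ^ 2) + (1 + a + c) * Q ^ 2 * ap 7 Q 3 3 / th 7 Q 3)
      - w ^ 2 * (a * K / (th 7 Q 1 * th 7 Q 2)) + w ^ 3 * (K / (th 7 Q 1 * th 7 Q 3))
      + w ^ 4 * (c * ap 7 Q 1 2 / th 7 Q 2) - w ^ 6 * ((1 + a) * Q * ap 7 Q 2 4 / th 7 Q 3)"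
    by (simp add: F Qp t1_def t2_def t3_def)
  finally show ?thesis .
qed

section \<open>The finite Jacobi triple product\<close>

text \<open>
  The reciprocal of \<open>(q; q)\<^sub>m\<close>. Its value 0 for negative \<open>m\<close> is the usual convention and makes the recursion
  \<open>inv_fpoch_step\<close> hold for all integers.
\<close>

definition inv_fpoch :: "int \<Rightarrow> 'a::field fps" where
  "inv_fpoch m = (if m < 0 then 0 else inverse (fpoch fps_X (nat m)))"

lemma fpoch_X_inv_fpoch: "fpoch fps_X k * inv_fpoch (int k) = (1 :: 'a::field fps)"
  unfolding inv_fpoch_def using inverse_mult_eq_1'[of "fpoch fps_X k :: 'a fps"] fpoch_X_nth_0[of k, where 'a='a] by simp

lemma inv_fpoch_step: "(1 - fps_X ^ nat m) * inv_fpoch m = (inv_fpoch (m - 1) :: 'a::field fps)"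
proof (cases "m \<le> 0")
  case True
  thus ?thesis by (simp add: inv_fpoch_def)
next
  case False
  then obtain k where k: "m = int (Suc k)" by (metis not_le zero_less_imp_eq_int Suc_pred)
  have "fpoch fps_X (Suc k) * ((1 - fps_X ^ Suc k) * inv_fpoch (int (Suc k))) = (1 - fps_X ^ Suc k) * (fpoch fps_X (Suc k) * inv_fpoch (int (Suc k)) :: 'a fps)"
    by (simp only: mult_ac)
  also have "\<dots> = (1 - fps_X ^ Suc k) * (fpoch fps_X k * inv_fpoch (int k))" unfolding fpoch_X_inv_fpoch ..
  also have "\<dots> = fpoch fps_X (Suc k) * inv_fpoch (int k)" by (simp add: fpoch_Suc mult_ac)
  finally have "(1 - fps_X ^ Suc k) * inv_fpoch (int (Suc k)) = (inv_fpoch (int k) :: 'a fps)"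
    by (rule fps_unit_cancel) (rule fpoch_X_nth_0)
  thus ?thesis by (simp only: k nat_int) (simp add: algebra_simps)
qed

text \<open>
  The general term of the bilateral series in Jacobi's triple product identity.
\<close>

definition jterm :: "'a::field \<Rightarrow> int \<Rightarrow> 'a fps" where
  "jterm x r = fps_const ((-1) powi r * x powi r) * fps_X ^ nat (tri (r + 1))"

lemma jterm_Suc:
  assumes "x \<noteq> 0" "r \<le> int b"
  shows "jterm x (r + 1) * fps_X ^ nat (int b - r) = - (fps_const x * fps_X ^ Suc b) * jterm x r"
proof -
  have t: "tri (r + 1 + 1) = tri (r + 1) + r + 1" using tri_Suc[of "r+1"] by simp
  have "nat (tri (r + 1 + 1)) + nat (int b - r) = Suc b + nat (tri (r + 1))"
    using tri_nonneg[of "r + 1"] tri_nonneg[of "r+1+1"] assms(2) t by linarith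
  hence e: "fps_X ^ nat (tri (r + 1 + 1)) * fps_X ^ nat (int b - r) = (fps_X ^ Suc b * fps_X ^ nat (tri (r + 1)) :: 'a fps)"
    by (simp only: power_add[symmetric])
  have c: "(-1) powi (r + 1) * x powi (r + 1) = - (x * ((-1) powi r * x powi r))"
    using assms(1) by (simp add: power_int_add)
  show ?thesis unfolding jterm_def c mult.assoc e
    by (simp only: fps_const_mult[symmetric] fps_const_neg[symmetric] mult_ac mult_minus_left mult_minus_right)
qed

text \<open>
  Multiplied by \<open>(q; q)\<^sub>a\<^sub>+\<^sub>b\<close>, this is the alternating sum of Gaussian binomials in the finite form of the
  triple product identity, \<open>fpoch_X_jsum\<close>.
\<close>

definition jsum :: "'a::field \<Rightarrow> nat \<Rightarrow> nat \<Rightarrow> 'a fps" where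
  "jsum x a b = (\<Sum>r\<in>{- int a..int b}. jterm x r * (inv_fpoch (int b - r) * inv_fpoch (int a + r)))"

text \<open>
  Pascal's rule in the form
  \<open>1 - q\<^sup>a\<^sup>+\<^sup>b = (1 - q\<^sup>b\<^sup>-\<^sup>r) + q\<^sup>b\<^sup>-\<^sup>r (1 - q\<^sup>a\<^sup>+\<^sup>r)\<close> splits the sum; the second half is a shift of the first.
\<close>

lemma jsum_step_right:
  assumes x: "x \<noteq> 0"
  shows "(1 - fps_X ^ (a + Suc b)) * jsum x a (Suc b) = (1 - fps_const x * fps_X ^ Suc b) * jsum x a b"
proof -
  let ?B = "int (Suc b)"
  have split: "(1 - fps_X ^ (a + Suc b)) * (inv_fpoch (?B - r) * inv_fpoch (int a + r))
      = inv_fpoch (int b - r) * inv_fpoch (int a + r) + fps_X ^ nat (?B - r) * (inv_fpoch (?B - r) * (inv_fpoch (int a + r - 1) :: 'a fps))"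
    if r: "r \<in> {- int a..?B}" for r
  proof -
    have "a + Suc b = nat (?B - r) + nat (int a + r)" using r by auto
    hence e: "fps_X ^ (a + Suc b) = fps_X ^ nat (?B - r) * (fps_X ^ nat (int a + r) :: 'a fps)" by (simp only: power_add)
    have i: "int b - r = ?B - r - 1" by simp
    show ?thesis unfolding e i inv_fpoch_step[symmetric] by (simp add: algebra_simps)
  qed
  have 1: "(\<Sum>r\<in>{- int a..?B}. jterm x r * (inv_fpoch (int b - r) * inv_fpoch (int a + r))) = jsum x a b"
    unfolding jsum_def by (rule sum.mono_neutral_right) (auto simp: inv_fpoch_def)
  have "(\<Sum>r\<in>{- int a..?B}. jterm x r * (fps_X ^ nat (?B - r) * (inv_fpoch (?B - r) * inv_fpoch (int a + r - 1))))
      = (\<Sum>r\<in>{- int a + 1..?B}. jterm x r * (fps_X ^ nat (?B - r) * (inv_fpoch (?B - r) * inv_fpoch (int a + r - 1))))"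
    by (rule sum.mono_neutral_right) (auto simp: inv_fpoch_def)
  also have "\<dots> = (\<Sum>r\<in>{- int a..int b}. jterm x (r + 1) * fps_X ^ nat (int b - r) * (inv_fpoch (int b - r) * inv_fpoch (int a + r)))"
    by (rule sum.reindex_bij_witness[of _ "\<lambda>r. r + 1" "\<lambda>r. r - 1"]) (auto simp: mult.assoc algebra_simps)
  also have "\<dots> = (\<Sum>r\<in>{- int a..int b}. - (fps_const x * fps_X ^ Suc b) * (jterm x r * (inv_fpoch (int b - r) * inv_fpoch (int a + r))))"
  proof (rule sum.cong[OF refl])
    fix r assume "r \<in> {- int a..int b}"
    hence "r \<le> int b" by simp
    from jterm_Suc[OF x this] show "jterm x (r + 1) * fps_X ^ nat (int b - r) * (inv_fpoch (int b - r) * inv_fpoch (int a + r)) =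
       - (fps_const x * fps_X ^ Suc b) * (jterm x r * (inv_fpoch (int b - r) * inv_fpoch (int a + r)))" by (simp only: mult.assoc)
  qed
  also have "\<dots> = - (fps_const x * fps_X ^ Suc b) * jsum x a b" unfolding jsum_def sum_distrib_left ..
  finally have 2: "(\<Sum>r\<in>{- int a..?B}. jterm x r * (fps_X ^ nat (?B - r) * (inv_fpoch (?B - r) * inv_fpoch (int a + r - 1)))) = - (fps_const x * fps_X ^ Suc b) * jsum x a b" .
  have "(1 - fps_X ^ (a + Suc b)) * jsum x a (Suc b)
     = (\<Sum>r\<in>{- int a..?B}. jterm x r * ((1 - fps_X ^ (a + Suc b)) * (inv_fpoch (?B - r) * inv_fpoch (int a + r))))"
    unfolding jsum_def sum_distrib_left by (simp only: mult_ac)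
  also have "\<dots> = (\<Sum>r\<in>{- int a..?B}. jterm x r * (inv_fpoch (int b - r) * inv_fpoch (int a + r)) + jterm x r * (fps_X ^ nat (?B - r) * (inv_fpoch (?B - r) * inv_fpoch (int a + r - 1))))"
    by (intro sum.cong refl) (simp only: split distrib_left)
  also have "\<dots> = (1 - fps_const x * fps_X ^ Suc b) * jsum x a b"
    unfolding sum.distrib 1 2 by (simp add: algebra_simps)
  finally show ?thesis .
qed

lemma jterm_pred:
  assumes "x \<noteq> 0" "- int a \<le> r"
  shows "jterm x (r - 1) * fps_X ^ nat (int (Suc a) + (r - 1)) = - (fps_const (1 / x) * fps_X ^ a) * jterm x r"
proof -
  have t: "tri (r + 1) = tri r + r" using tri_Suc[of r] by simp
  have "nat (tri r) + nat (int (Suc a) + (r - 1)) = a + nat (tri (r + 1))"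
    using tri_nonneg[of "r + 1"] tri_nonneg[of "r"] assms(2) t by linarith
  hence e: "fps_X ^ nat (tri r) * fps_X ^ nat (int (Suc a) + (r - 1)) = (fps_X ^ a * fps_X ^ nat (tri (r + 1)) :: 'a fps)"
    by (simp only: power_add[symmetric])
  have c: "(-1) powi (r - 1) * x powi (r - 1) = - (1 / x * ((-1) powi r * x powi r))"
    using assms(1) by (simp add: power_int_diff)
  have r: "r - 1 + 1 = r" by simp
  show ?thesis unfolding jterm_def c r mult.assoc e
    by (simp only: fps_const_mult[symmetric] fps_const_neg[symmetric] mult_ac mult_minus_left mult_minus_right)
qed

text \<open>As before, with the other form of Pascal's rule.\<close>

lemma jsum_step_left:
  assumes x: "x \<noteq> 0"
  shows "(1 - fps_X ^ (Suc a + b)) * jsum x (Suc a) b = (1 - fps_const (1 / x) * fps_X ^ a) * jsum x a b"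
proof -
  let ?A = "int (Suc a)"
  have split: "(1 - fps_X ^ (Suc a + b)) * (inv_fpoch (int b - r) * inv_fpoch (?A + r))
      = inv_fpoch (int b - r) * inv_fpoch (int a + r) + fps_X ^ nat (?A + r) * (inv_fpoch (int b - r - 1) * (inv_fpoch (?A + r) :: 'a fps))"
    if r: "r \<in> {- ?A..int b}" for r
  proof -
    have "Suc a + b = nat (int b - r) + nat (?A + r)" using r by auto
    hence e: "fps_X ^ (Suc a + b) = fps_X ^ nat (int b - r) * (fps_X ^ nat (?A + r) :: 'a fps)" by (simp only: power_add)
    have i: "int a + r = ?A + r - 1" by simp
    show ?thesis unfolding e i inv_fpoch_step[symmetric] by (simp add: algebra_simps)
  qed
  have 1: "(\<Sum>r\<in>{- ?A..int b}. jterm x r * (inv_fpoch (int b - r) * inv_fpoch (int a + r))) = jsum x a b"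
    unfolding jsum_def by (rule sum.mono_neutral_right) (auto simp: inv_fpoch_def)
  have "(\<Sum>r\<in>{- ?A..int b}. jterm x r * (fps_X ^ nat (?A + r) * (inv_fpoch (int b - r - 1) * inv_fpoch (?A + r))))
      = (\<Sum>r\<in>{- ?A..int b - 1}. jterm x r * (fps_X ^ nat (?A + r) * (inv_fpoch (int b - r - 1) * inv_fpoch (?A + r))))"
    by (rule sum.mono_neutral_right) (auto simp: inv_fpoch_def)
  also have "\<dots> = (\<Sum>r\<in>{- int a..int b}. jterm x (r - 1) * fps_X ^ nat (?A + (r - 1)) * (inv_fpoch (int b - r) * inv_fpoch (int a + r)))"
    by (rule sum.reindex_bij_witness[of _ "\<lambda>r. r - 1" "\<lambda>r. r + 1"]) (auto simp: mult.assoc algebra_simps)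
  also have "\<dots> = (\<Sum>r\<in>{- int a..int b}. - (fps_const (1 / x) * fps_X ^ a) * (jterm x r * (inv_fpoch (int b - r) * inv_fpoch (int a + r))))"
  proof (rule sum.cong[OF refl])
    fix r assume "r \<in> {- int a..int b}"
    hence "- int a \<le> r" by simp
    from jterm_pred[OF x this] show "jterm x (r - 1) * fps_X ^ nat (?A + (r - 1)) * (inv_fpoch (int b - r) * inv_fpoch (int a + r)) =
       - (fps_const (1 / x) * fps_X ^ a) * (jterm x r * (inv_fpoch (int b - r) * inv_fpoch (int a + r)))" by (simp only: mult.assoc)
  qed
  also have "\<dots> = - (fps_const (1 / x) * fps_X ^ a) * jsum x a b" unfolding jsum_def sum_distrib_left ..
  finally have 2: "(\<Sum>r\<in>{- ?A..int b}. jterm x r * (fps_X ^ nat (?A + r) * (inv_fpoch (int b - r - 1) * inv_fpoch (?A + r)))) = - (fps_const (1 / x) * fps_X ^ a) * jsum x a b" .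
  have "(1 - fps_X ^ (Suc a + b)) * jsum x (Suc a) b
     = (\<Sum>r\<in>{- ?A..int b}. jterm x r * ((1 - fps_X ^ (Suc a + b)) * (inv_fpoch (int b - r) * inv_fpoch (?A + r))))"
    unfolding jsum_def sum_distrib_left by (simp only: mult_ac)
  also have "\<dots> = (\<Sum>r\<in>{- ?A..int b}. jterm x r * (inv_fpoch (int b - r) * inv_fpoch (int a + r)) + jterm x r * (fps_X ^ nat (?A + r) * (inv_fpoch (int b - r - 1) * inv_fpoch (?A + r))))"
    by (intro sum.cong refl) (simp only: split distrib_left)
  also have "\<dots> = (1 - fps_const (1 / x) * fps_X ^ a) * jsum x a b"
    unfolding sum.distrib 1 2 by (simp add: algebra_simps)
  finally show ?thesis .
qed

lemma fpoch_X_jsum: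
  assumes x: "x \<noteq> 0"
  shows "fpoch fps_X (a + b) * jsum x a b = fpoch (fps_const x * fps_X) b * fpoch (fps_const (1 / x)) a"
proof (induction a)
  case 0
  show ?case
  proof (induction b)
    case 0
    show ?case by (simp add: jsum_def jterm_def inv_fpoch_def tri_def)
  next
    case (Suc b)
    have "fpoch fps_X (0 + Suc b) * jsum x 0 (Suc b) = fpoch fps_X b * ((1 - fps_X ^ (0 + Suc b)) * jsum x 0 (Suc b))"
      by (simp add: fpoch_Suc mult_ac)
    also have "\<dots> = (1 - fps_const x * fps_X ^ Suc b) * (fpoch fps_X (0 + b) * jsum x 0 b)"
      unfolding jsum_step_right[OF x] by (simp add: mult_ac)
    also have "\<dots> = fpoch (fps_const x * fps_X) (Suc b) * fpoch (fps_const (1 / x)) 0"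
      unfolding Suc by (simp add: fpoch_Suc mult_ac)
    finally show ?case .
  qed
next
  case (Suc a)
  have "fpoch fps_X (Suc a + b) * jsum x (Suc a) b = fpoch fps_X (a + b) * ((1 - fps_X ^ (Suc a + b)) * jsum x (Suc a) b)"
    by (simp add: fpoch_Suc mult_ac)
  also have "\<dots> = (1 - fps_const (1 / x) * fps_X ^ a) * (fpoch fps_X (a + b) * jsum x a b)"
    unfolding jsum_step_left[OF x] by (simp add: mult_ac)
  also have "\<dots> = fpoch (fps_const x * fps_X) b * fpoch (fps_const (1 / x)) (Suc a)"
    unfolding Suc by (simp add: fpoch_Suc mult_ac)
  finally show ?case .
qed

section \<open>A Bailey pair and its limit\<close>

text \<open>
  The weight of \<open>r\<close> in the Bailey pair: the triple product sum with \<open>a = b = n\<close>, without the power of \<open>x\<close>.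
\<close>

definition kern :: "nat \<Rightarrow> int \<Rightarrow> complex fps" where
  "kern n r = jterm 1 r * (inv_fpoch (int n - r) * inv_fpoch (int n + r))"

lemma jsum_kern: "jsum x n n = (\<Sum>r\<in>{- int n..int n}. fps_const (x powi r) * kern n r)"
  unfolding jsum_def kern_def jterm_def
  by (rule sum.cong[OF refl]) (simp add: mult_ac flip: fps_const_mult)

lemma jsum_eq:
  fixes x :: complex
  assumes "x \<noteq> 0"
  shows "jsum x n n = fpoch (fps_const x * fps_X) n * fpoch (fps_const (1 / x)) n * inv_fpoch (int (2 * n))"
proof -
  have "jsum x n n = (fpoch fps_X (n + n) * jsum x n n) * inv_fpoch (int (n + n))"
    using fpoch_X_inv_fpoch[of "n + n", where 'a=complex] by (simp add: mult_ac)
  thus ?thesis unfolding fpoch_X_jsum[OF assms] by (simp only: mult_2)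
qed

text \<open>
  The left-hand sides are linear combinations of the finite triple products at \<open>x\<close>, \<open>1 / x\<close> and 1. The one
  at 1 vanishes for \<open>n > 0\<close>; it is included so that the coefficients vanish at \<open>r = 0\<close>. This removes the
  term \<open>n = 0\<close> from the Bailey sum and, at roots of unity, the poles from the dissected Lambert series.
\<close>

lemma numer_kern:
  assumes x: "x \<noteq> 0" and n: "n > 0"
  shows "(\<Sum>r\<in>{- int n..int n}. fps_const (numer x (- r)) * kern n r)
       = (1 + fps_const x) * fpoch (fps_const x) n * fpoch (fps_const (1 / x)) n * inv_fpoch (int (2 * n))" (is "?U")
    and "(\<Sum>r\<in>{- int n..int n}. fps_const (numer x r) * kern n r)
       = fps_X ^ n * ((1 + fps_const x) * fpoch (fps_const x) n * fpoch (fps_const (1 / x)) n * inv_fpoch (int (2 * n)))" (is "?V")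
proof -
  obtain m where m: "n = Suc m" using n by (cases n) auto
  define a where "a = fps_const x"
  define b where "b = fps_const (1 / x)"
  have ab: "a * b = 1" using x by (simp add: a_def b_def)
  define A where "A = fpoch (a * fps_X) m"
  define B where "B = fpoch (b * fps_X) m"
  define I where "I = (inv_fpoch (int (2 * n)) :: complex fps)"
  define Y where "Y = (fps_X :: complex fps) ^ n"
  have fr: "fpoch (c * fps_X) n = fpoch (c * fps_X) m * (1 - c * Y)" for c
    by (simp only: m Y_def fpoch_Suc power_Suc mult_ac)
  have fl: "fpoch c n = (1 - c) * fpoch (c * fps_X) m" for c :: "complex fps"
    by (simp only: m fpoch_Suc_left)
  note f = fr[of a] fr[of b] fl[of a] fl[of b]
  have j1: "jsum x n n = A * (1 - a * Y) * ((1 - b) * B) * I"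
    unfolding jsum_eq[OF x] a_def[symmetric] b_def[symmetric] f A_def B_def I_def ..
  have j2: "jsum (1 / x) n n = B * (1 - b * Y) * ((1 - a) * A) * I"
  proof -
    have "1 / (1 / x) = x" by simp
    hence "jsum (1 / x) n n = fpoch (b * fps_X) n * fpoch a n * I"
      using jsum_eq[of "1 / x" n] x by (simp add: a_def b_def I_def)
    thus ?thesis unfolding f A_def B_def .
  qed
  have j3: "jsum 1 n n = (0 :: complex fps)"
    using jsum_eq[of 1 n] by (simp add: m fpoch_Suc_left)
  have s: "(\<Sum>r\<in>{- int n..int n}. fps_const (numer x r) * kern n r) = jsum (1 / x) n n + a * jsum x n n"
    (is "?l = _")
  proof -
    have "?l = jsum (1 / x) n n + a * jsum x n n - (1 + a) * jsum 1 n n"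
      unfolding jsum_kern sum_distrib_left sum.distrib[symmetric] sum_subtractf[symmetric]
    proof (rule sum.cong[OF refl])
      fix r
      have "fps_const (numer x r) = fps_const ((1 / x) powi r) + a * fps_const (x powi r) - (1 + a) * fps_const (1 powi r)"
        using x by (simp add: numer_def a_def power_int_add power_int_minus power_int_divide_distrib field_simps flip: fps_const_add fps_const_sub fps_const_1_eq_1)
      thus "fps_const (numer x r) * kern n r = fps_const ((1 / x) powi r) * kern n r + a * (fps_const (x powi r) * kern n r) - (1 + a) * (fps_const (1 powi r) * kern n r)"
        by (simp only:) (simp only: left_diff_distrib distrib_right mult.assoc)
    qed
    thus ?thesis by (simp add: j3)
  qed
  have s': "(\<Sum>r\<in>{- int n..int n}. fps_const (numer x (- r)) * kern n r) = jsum x n n + a * jsum (1 / x) n n"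
    (is "?l = _")
  proof -
    have "?l = jsum x n n + a * jsum (1 / x) n n - (1 + a) * jsum 1 n n"
      unfolding jsum_kern sum_distrib_left sum.distrib[symmetric] sum_subtractf[symmetric]
    proof (rule sum.cong[OF refl])
      fix r
      have "fps_const (numer x (-r)) = fps_const (x powi r) + a * fps_const ((1/x) powi r) - (1 + a) * fps_const (1 powi r)"
        using x by (simp add: numer_def a_def power_int_add power_int_diff power_int_minus power_int_divide_distrib field_simps flip: fps_const_add fps_const_sub fps_const_1_eq_1)
      thus "fps_const (numer x (-r)) * kern n r = fps_const (x powi r) * kern n r + a * (fps_const ((1/x) powi r) * kern n r) - (1 + a) * (fps_const (1 powi r) * kern n r)"
        by (simp only:) (simp only: left_diff_distrib distrib_right mult.assoc)
    qed
    thus ?thesis by (simp add: j3)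
  qed
  show ?U unfolding s' j1 j2 unfolding a_def[symmetric] b_def[symmetric] f A_def[symmetric] B_def[symmetric] I_def[symmetric]
    using ab by algebra
  show ?V unfolding s j1 j2 unfolding a_def[symmetric] b_def[symmetric] f A_def[symmetric] B_def[symmetric] I_def[symmetric] Y_def[symmetric]
    using ab by algebra
qed

text \<open>
  The sum over \<open>n\<close> in the Bailey transform, with its dependence on \<open>r\<close>.
\<close>

definition bsum :: "complex \<Rightarrow> nat \<Rightarrow> int \<Rightarrow> complex fps" where
  "bsum y N r = (\<Sum>n\<le>N. fps_X ^ n * fpoch (fps_const y) n * fpoch (fps_const (1 / y)) n * (inv_fpoch (int n - r) * inv_fpoch (int n + r)))"

definition wfac :: "complex \<Rightarrow> nat \<Rightarrow> complex fps" where
  "wfac y k = (1 - fps_const y * fps_X ^ k) * (1 - fps_const (1 / y) * fps_X ^ k)"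

lemma bsum_uminus: "bsum y N (- r) = bsum y N r"
  unfolding bsum_def by (simp add: mult.commute)

text \<open>
  The sum over \<open>n\<close> telescopes. With \<open>S = q\<^sup>k\<close> and \<open>T = q\<^sup>n\<^sup>-\<^sup>k\<close>, the induction step is the identity
  \<open>S (1 - T) (1 - S\<^sup>2 T) + S T (1 - y S) (1 - S / y) = S (1 - y S T) (1 - S T / y)\<close>.
\<close>

lemma bsum_telescope:
  assumes y: "y \<noteq> 0"
  shows "wfac y k * bsum y N (int k) = fps_X ^ k * fpoch (fps_const y) (Suc N) * fpoch (fps_const (1 / y)) (Suc N) * (inv_fpoch (int N - int k) * inv_fpoch (int N + int k))"
proof (induction N)
  case 0
  show ?case by (cases "k = 0") (simp_all add: bsum_def wfac_def fpoch_Suc inv_fpoch_def)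
next
  case (Suc N)
  define n where "n = Suc N"
  define A where "A = fpoch (fps_const y) n"
  define B where "B = fpoch (fps_const (1 / y)) n"
  have A': "fpoch (fps_const y) (Suc n) = A * (1 - fps_const y * fps_X ^ n)"
    and B': "fpoch (fps_const (1 / y)) (Suc n) = B * (1 - fps_const (1 / y) * fps_X ^ n)" by (simp_all add: A_def B_def fpoch_Suc)
  have e: "wfac y k * bsum y n (int k) = fps_X ^ k * A * B * (inv_fpoch (int N - int k) * inv_fpoch (int N + int k))
      + wfac y k * (fps_X ^ n * A * B * (inv_fpoch (int n - int k) * inv_fpoch (int n + int k)))"
    using Suc unfolding bsum_def n_def A_def B_def by (simp add: distrib_left)
  have "wfac y k * bsum y n (int k) = fps_X ^ k * (A * (1 - fps_const y * fps_X ^ n)) * (B * (1 - fps_const (1 / y) * fps_X ^ n)) * (inv_fpoch (int n - int k) * inv_fpoch (int n + int k))"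
  proof (cases "n < k")
    case True
    thus ?thesis unfolding e by (simp add: inv_fpoch_def n_def)
  next
    case False
    define i where "i = (inv_fpoch (int n - int k) :: complex fps)"
    define j where "j = (inv_fpoch (int n + int k) :: complex fps)"
    define S where "S = (fps_X ^ k :: complex fps)"
    define T where "T = (fps_X ^ (n - k) :: complex fps)"
    define u where "u = fps_const y"
    define v where "v = fps_const (1 / y)"
    have uv: "u * v = 1" using y by (simp add: u_def v_def)
    have nk: "fps_X ^ n = S * T" using False by (simp add: S_def T_def flip: power_add)
    have 1: "int N - int k = int n - int k - 1" "nat (int n - int k) = n - k" by (auto simp: n_def)
    have i': "inv_fpoch (int N - int k) = (1 - T) * i" unfolding 1(1) inv_fpoch_step[symmetric] 1(2) T_def i_def ..
    have 2: "int N + int k = int n + int k - 1" "nat (int n + int k) = n + k" by (auto simp: n_def)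
    have j': "inv_fpoch (int N + int k) = (1 - S * T * S) * j" unfolding 2(1) inv_fpoch_step[symmetric] 2(2) power_add nk j_def S_def ..
    show ?thesis unfolding e unfolding i' j' wfac_def nk unfolding i_def[symmetric] j_def[symmetric] u_def[symmetric] v_def[symmetric] S_def[symmetric]
      using uv by algebra
  qed
  thus ?case unfolding n_def[symmetric] A' B' .
qed

lemma bailey_interchange:
  "(\<Sum>n\<le>N. fps_X ^ n * fpoch (fps_const y) n * fpoch (fps_const (1 / y)) n * (\<Sum>r\<in>{- int n..int n}. fps_const (c r) * kern n r))
   = (\<Sum>r\<in>{- int N..int N}. fps_const (c r) * jterm 1 r * bsum y N r)"
proof -
  have "(\<Sum>r\<in>{- int n..int n}. fps_const (c r) * kern n r) = (\<Sum>r\<in>{- int N..int N}. fps_const (c r) * kern n r)" if "n \<le> N" for n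
    by (rule sum.mono_neutral_left) (use that in \<open>auto simp: kern_def inv_fpoch_def\<close>)
  hence "(\<Sum>n\<le>N. fps_X ^ n * fpoch (fps_const y) n * fpoch (fps_const (1 / y)) n * (\<Sum>r\<in>{- int n..int n}. fps_const (c r) * kern n r))
    = (\<Sum>n\<le>N. \<Sum>r\<in>{- int N..int N}. fps_X ^ n * fpoch (fps_const y) n * fpoch (fps_const (1 / y)) n * (fps_const (c r) * kern n r))"
    by (simp add: sum_distrib_left)
  also have "\<dots> = (\<Sum>r\<in>{- int N..int N}. \<Sum>n\<le>N. fps_X ^ n * fpoch (fps_const y) n * fpoch (fps_const (1 / y)) n * (fps_const (c r) * kern n r))"
    by (rule sum.swap)
  also have "\<dots> = (\<Sum>r\<in>{- int N..int N}. fps_const (c r) * jterm 1 r * bsum y N r)"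
    unfolding bsum_def kern_def sum_distrib_left by (simp only: mult_ac)
  finally show ?thesis .
qed

lemma fpinf_X_inv_fpoch: "M \<le> N \<Longrightarrow> fps_eq M (fpinf fps_X * inv_fpoch (int N)) (1 :: complex fps)"
proof -
  assume "M \<le> N"
  hence "fps_eq M (fpinf fps_X) (fpoch fps_X N :: complex fps)" using fps_eq_fpinf fps_eq_mono by blast
  from fps_eq_mult[OF this fps_eq_refl, of "inv_fpoch (int N)"] show ?thesis by (simp only: fpoch_X_inv_fpoch)
qed

lemma fps_nth_wfac: "fps_nth (wfac y k) 0 = (if k = 0 then (1 - y) * (1 - 1 / y) else 1)"
  by (simp add: wfac_def)

lemma wfac_unit: "y \<noteq> 0 \<Longrightarrow> y \<noteq> 1 \<Longrightarrow> inverse (wfac y k) * wfac y k = 1"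
  by (rule inverse_mult_eq_1) (auto simp: fps_nth_wfac)

lemma bsum_limit:
  assumes y: "y \<noteq> 0" "y \<noteq> 1" and N: "M + nat \<bar>r\<bar> \<le> N"
  shows "fps_eq M (fpinf fps_X ^ 2 * bsum y N r)
           (fpinf (fps_const y) * fpinf (fps_const (1 / y)) * (fps_X ^ nat \<bar>r\<bar> * inverse (wfac y (nat \<bar>r\<bar>))))"
proof -
  define k where "k = nat \<bar>r\<bar>"
  have r: "bsum y N r = bsum y N (int k)" by (cases "r \<ge> 0") (auto simp: k_def bsum_uminus)
  have kN: "int N - int k = int (N - k)" "int N + int k = int (N + k)" using N by (auto simp: k_def)
  have "fpinf fps_X ^ 2 * bsum y N r = inverse (wfac y k) * fpinf fps_X ^ 2 * (wfac y k * bsum y N (int k))"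
    using wfac_unit[OF y, of k] unfolding r by (simp only: mult_ac) (metis mult.commute mult.left_commute mult_1_right)
  also have "\<dots> = inverse (wfac y k) * (fps_X ^ k * fpoch (fps_const y) (Suc N) * fpoch (fps_const (1 / y)) (Suc N) * ((fpinf fps_X * inv_fpoch (int (N - k))) * (fpinf fps_X * inv_fpoch (int (N + k)))))"
    unfolding bsum_telescope[OF y(1)] kN by (simp only: mult_ac power2_eq_square)
  also have "fps_eq M \<dots> (inverse (wfac y k) * (fps_X ^ k * fpinf (fps_const y) * fpinf (fps_const (1 / y)) * (1 * 1)))"
    by (intro fps_eq_mult fps_eq_refl fpinf_X_inv_fpoch fps_eq_sym[OF fps_eq_mono[OF fps_eq_fpinf]]) (use N in \<open>auto simp: k_def\<close>)
  finally show ?thesis by (simp add: k_def mult_ac)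
qed

text \<open>
  The sum of a family of power series over all integers, for families in which the \<open>r\<close>-th member has
  order at least \<open>\<bar>r\<bar> - 1\<close>; then the members with \<open>\<bar>r\<bar> > m + 1\<close> do not contribute to order \<open>m\<close>.
\<close>

definition zsum :: "(int \<Rightarrow> complex fps) \<Rightarrow> complex fps" where
  "zsum g = Abs_fps (\<lambda>m. \<Sum>r\<in>{- (int m + 1)..int m + 1}. fps_nth (g r) m)"

lemma fps_eq_zsum:
  assumes "\<And>r. fps_eq (nat \<bar>r\<bar> - 1) (g r) 0" "M \<le> R"
  shows "fps_eq M (zsum g) (\<Sum>r\<in>{- int R..int R}. g r)"
  unfolding fps_eq_def
proof safe
  fix m assume m: "m < M"
  have "(\<Sum>r\<in>{- int R..int R}. fps_nth (g r) m) = (\<Sum>r\<in>{- (int m + 1)..int m + 1}. fps_nth (g r) m)"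
  proof (rule sum.mono_neutral_right)
    show "\<forall>r\<in>{- int R..int R} - {- (int m + 1)..int m + 1}. fps_nth (g r) m = 0"
    proof
      fix r assume "r \<in> {- int R..int R} - {- (int m + 1)..int m + 1}"
      hence "m < nat \<bar>r\<bar> - 1" by auto
      thus "fps_nth (g r) m = 0" using assms(1)[of r] by (simp add: fps_eq_def)
    qed
  qed (use m assms(2) in auto)
  thus "fps_nth (zsum g) m = fps_nth (\<Sum>r\<in>{- int R..int R}. g r) m"
    by (simp add: zsum_def fps_sum_nth)
qed

definition lterm :: "complex \<Rightarrow> (int \<Rightarrow> complex) \<Rightarrow> int \<Rightarrow> complex fps" where
  "lterm y c r = fps_const (c r) * jterm 1 r * (fps_X ^ nat \<bar>r\<bar> * inverse (wfac y (nat \<bar>r\<bar>)))"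

lemma lterm_order: "N \<le> nat \<bar>r\<bar> \<Longrightarrow> fps_eq N (lterm y c r) 0"
proof -
  assume N: "N \<le> nat \<bar>r\<bar>"
  have "lterm y c r = fps_X ^ nat \<bar>r\<bar> * (fps_const (c r) * jterm 1 r * inverse (wfac y (nat \<bar>r\<bar>)))"
    by (simp add: lterm_def mult_ac)
  thus ?thesis using fps_eq_X_power_mult[OF N] by metis
qed

lemma jterm_mult_order: "N + 2 \<le> nat \<bar>r\<bar> \<Longrightarrow> fps_eq N (jterm x r * f) 0"
proof -
  assume N: "N + 2 \<le> nat \<bar>r\<bar>"
  hence le: "N \<le> nat (tri (r + 1))" using tri_ge[of "r + 1"] by linarith
  have "jterm x r * f = fps_X ^ nat (tri (r + 1)) * (fps_const ((-1) powi r * x powi r) * f)"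
    by (simp add: jterm_def mult_ac)
  thus ?thesis using fps_eq_X_power_mult[OF le] by metis
qed

text \<open>
  After the order of summation is exchanged, the inner sums converge for each \<open>r\<close>. The cut-off
  \<open>2 * M + 2\<close> leaves room for both ranges of \<open>r\<close>: for \<open>\<bar>r\<bar> \<le> M + 2\<close> the inner sum is accurate to order
  \<open>M\<close>, and for larger \<open>\<bar>r\<bar>\<close> the factor \<open>jterm 1 r\<close> has order at least \<open>M\<close>.
\<close>

theorem bailey_limit:
  assumes y: "y \<noteq> 0" "y \<noteq> 1"
  shows "fps_eq M (fpinf fps_X ^ 2 * (\<Sum>n\<le>2*M+2. fps_X ^ n * fpoch (fps_const y) n * fpoch (fps_const (1 / y)) n * (\<Sum>r\<in>{- int n..int n}. fps_const (c r) * kern n r)))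
     (fpinf (fps_const y) * fpinf (fps_const (1 / y)) * zsum (lterm y c))"
proof -
  define N where "N = 2 * M + 2"
  have t: "fps_eq M (fps_const (c r) * jterm 1 r * (fpinf fps_X ^ 2 * bsum y N r)) (fpinf (fps_const y) * fpinf (fps_const (1 / y)) * lterm y c r)" for r
  proof (cases "nat \<bar>r\<bar> \<le> M + 2")
    case True
    hence "M + nat \<bar>r\<bar> \<le> N" by (simp add: N_def)
    from fps_eq_mult[OF fps_eq_refl bsum_limit[OF y this], of "fps_const (c r) * jterm 1 r"]
    show ?thesis by (simp add: lterm_def mult_ac)
  next
    case False
    hence "fps_eq M (jterm 1 r * (fps_const (c r) * (fpinf fps_X ^ 2 * bsum y N r))) 0" by (intro jterm_mult_order) simp
    moreover have "fps_eq M (fpinf (fps_const y) * fpinf (fps_const (1 / y)) * lterm y c r) (fpinf (fps_const y) * fpinf (fps_const (1 / y)) * 0)"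
      by (intro fps_eq_mult fps_eq_refl lterm_order) (use False in simp)
    ultimately show ?thesis by (simp add: fps_eq_def mult_ac)
  qed
  have "fpinf fps_X ^ 2 * (\<Sum>r\<in>{- int N..int N}. fps_const (c r) * jterm 1 r * bsum y N r)
      = (\<Sum>r\<in>{- int N..int N}. fps_const (c r) * jterm 1 r * (fpinf fps_X ^ 2 * bsum y N r))"
    unfolding sum_distrib_left by (simp only: mult_ac)
  also have "fps_eq M \<dots> (\<Sum>r\<in>{- int N..int N}. fpinf (fps_const y) * fpinf (fps_const (1 / y)) * lterm y c r)"
    by (rule fps_eq_sum) (rule t)
  also have "\<dots> = fpinf (fps_const y) * fpinf (fps_const (1 / y)) * (\<Sum>r\<in>{- int N..int N}. lterm y c r)"
    by (simp only: sum_distrib_left)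
  also have "fps_eq M \<dots> (fpinf (fps_const y) * fpinf (fps_const (1 / y)) * zsum (lterm y c))"
    by (intro fps_eq_mult fps_eq_refl fps_eq_sym[OF fps_eq_zsum] lterm_order) (auto simp: N_def)
  finally show ?thesis unfolding bailey_interchange N_def .
qed

section \<open>The rank generating functions as Lambert series\<close>

lemma tri_Suc_ge: "\<bar>r\<bar> \<le> tri (r + 1) + 1"
  using tri_ge[of "- r"] by (simp add: tri_minus tri_Suc)

lemma jterm_order: "fps_eq (nat \<bar>r\<bar> - 1) (jterm x r) 0"
proof -
  have le: "nat \<bar>r\<bar> - 1 \<le> nat (tri (r + 1))" using tri_Suc_ge[of r] by linarith
  have "jterm x r = fps_X ^ nat (tri (r + 1)) * (fps_const ((-1) powi r * x powi r))"
    by (simp add: jterm_def mult_ac)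
  thus ?thesis using fps_eq_X_power_mult[OF le] by metis
qed

theorem triple_product:
  fixes x :: complex
  assumes x: "x \<noteq> 0"
  shows "fpinf fps_X * fpinf (fps_const x) * fpinf (fps_const (1 / x)) = fps_const (1 - x) * zsum (jterm x)"
proof (rule fps_eqI)
  fix M :: nat
  define N where "N = 2 * M + 2"
  have t: "fps_eq M (fpinf fps_X ^ 2 * (jterm x r * (inv_fpoch (int N - r) * inv_fpoch (int N + r)))) (jterm x r)" for r
  proof (cases "nat \<bar>r\<bar> \<le> M + 1")
    case True
    have e: "int N - r = int (nat (int N - r))" "int N + r = int (nat (int N + r))" using True by (auto simp: N_def)
    have "fpinf fps_X ^ 2 * (jterm x r * (inv_fpoch (int N - r) * inv_fpoch (int N + r)))
       = jterm x r * ((fpinf fps_X * inv_fpoch (int (nat (int N - r)))) * (fpinf fps_X * inv_fpoch (int (nat (int N + r)))))"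
      using e by (simp only: power2_eq_square mult_ac)
    also have "fps_eq M \<dots> (jterm x r * (1 * 1))"
      by (intro fps_eq_mult fps_eq_refl fpinf_X_inv_fpoch) (use True in \<open>auto simp: N_def\<close>)
    finally show ?thesis by simp
  next
    case False
    have a: "fps_eq M (jterm x r) 0" by (rule fps_eq_mono[OF jterm_order[of r]]) (use False in simp)
    have "fps_eq M (fpinf fps_X ^ 2 * (jterm x r * (inv_fpoch (int N - r) * inv_fpoch (int N + r)))) (fpinf fps_X ^ 2 * (0 * (inv_fpoch (int N - r) * inv_fpoch (int N + r))))"
      by (intro fps_eq_mult fps_eq_refl a)
    thus ?thesis using a by (simp add: fps_eq_def)
  qed
  have "fps_eq M (fpinf fps_X * 1 * (fpinf (fps_const x * fps_X) * fpinf (fps_const (1 / x))))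
      (fpinf fps_X * (fpinf fps_X * inv_fpoch (int (2 * N))) * (fpoch (fps_const x * fps_X) N * fpoch (fps_const (1 / x)) N))"
    by (intro fps_eq_mult fps_eq_refl fps_eq_sym[OF fpinf_X_inv_fpoch] fps_eq_mono[OF fps_eq_fpinf]) (auto simp: N_def)
  also have "fpinf fps_X * (fpinf fps_X * inv_fpoch (int (2 * N))) * (fpoch (fps_const x * fps_X) N * fpoch (fps_const (1 / x)) N) = fpinf fps_X ^ 2 * jsum x N N"
    unfolding jsum_eq[OF x] by (simp only: power2_eq_square mult_ac)
  also have "\<dots> = (\<Sum>r\<in>{- int N..int N}. fpinf fps_X ^ 2 * (jterm x r * (inv_fpoch (int N - r) * inv_fpoch (int N + r))))"
    unfolding jsum_def sum_distrib_left ..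
  also have "fps_eq M \<dots> (\<Sum>r\<in>{- int N..int N}. jterm x r)" by (rule fps_eq_sum) (rule t)
  also have "fps_eq M \<dots> (zsum (jterm x))"
    by (rule fps_eq_sym[OF fps_eq_zsum[OF jterm_order]]) (simp add: N_def)
  finally have "fps_eq M (fps_const (1 - x) * (fpinf fps_X * 1 * (fpinf (fps_const x * fps_X) * fpinf (fps_const (1 / x))))) (fps_const (1 - x) * zsum (jterm x))"
    by (intro fps_eq_mult fps_eq_refl)
  moreover have "fpinf (fps_const x) = fps_const (1 - x) * fpinf (fps_const x * fps_X)"
    using fpinf_split[of "fps_const x" 1] by (simp add: fpoch_Suc flip: fps_const_sub)
  ultimately show "fps_eq M (fpinf fps_X * fpinf (fps_const x) * fpinf (fps_const (1 / x))) (fps_const (1 - x) * zsum (jterm x))"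
    by (simp add: mult_ac)
qed

lemma rank_weight_powi: "x \<noteq> (0::complex) \<Longrightarrow> rank_weight (\<lambda>k. x powi k)"
  by unfold_locales (simp_all add: power_int_add)

text \<open>
  Completing the products in \<open>gf_fill\<close> by their first \<open>n\<close> factors turns the rank generating function,
  times infinite products, into the sum over \<open>n\<close> to which \<open>bailey_limit\<close> applies. The products in \<open>y\<close>
  cancel, and those in \<open>x\<close> form a theta function.
\<close>

theorem gf_times_theta:
  fixes x :: complex and s :: nat
  assumes x: "x \<noteq> 0" "x ^ 2 \<noteq> 1" and S: "S \<subseteq> U_set"
    and gf: "\<And>n. n > 0 \<Longrightarrow> rank_weight.gf (\<lambda>k. x powi k) (smallest_is n S) quad_size rk
                = fps_X ^ (n + s * n) * rank_weight.gf (\<lambda>k. x powi k) (fill n) quad_size (core_rank n)"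
    and c: "\<And>n. n > 0 \<Longrightarrow> (\<Sum>r\<in>{- int n..int n}. fps_const (c r) * kern n r)
                = fps_X ^ (s * n) * ((1 + fps_const x) * fpoch (fps_const x) n * fpoch (fps_const (1 / x)) n * inv_fpoch (int (2 * n)))"
    and c0: "c 0 = 0"
  shows "fps_const (1 - x ^ 2) * zsum (jterm x) * rank_weight.gf (\<lambda>k. x powi k) S quad_size rk = zsum (lterm (x ^ 2) c)"
proof -
  interpret rank_weight "\<lambda>k. x powi k" by (rule rank_weight_powi) (rule x)
  define y where "y = x ^ 2"
  have y: "y \<noteq> 0" "y \<noteq> 1" using x by (auto simp: y_def)
  have ZZ: "Z 1 = fps_const x" "Z (-1) = fps_const (1 / x)" "Z 2 = fps_const y" "Z (-2) = fps_const (1 / y)"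
    by (simp_all add: Z_def y_def power_int_minus inverse_eq_divide)
  define T where "T = fpinf (fps_const x) * fpinf (fps_const (1 / x)) * fpinf (fps_const y) * fpinf (fps_const (1 / y))"
  define G where "G n = gf (fill n) quad_size (core_rank n)" for n
  define p where "p n = fpoch (fps_const x) n * fpoch (fps_const (1 / x)) n * fpoch (fps_const y) n * fpoch (fps_const (1 / y)) n" for n
  have TG: "T * G n = p n * (fpinf fps_X * inv_fpoch (int (2 * n)))" if n: "n > 0" for n
  proof -
    have 1: "fpinf (fps_const c) = fpoch (fps_const c) n * fpinf (fps_const c * fps_X ^ n)" for c :: complex by (rule fpinf_split)
    have "T * G n = p n * (fpinf (Z 1 * fps_X ^ n) * fpinf (Z (-1) * fps_X ^ n) * fpinf (Z 2 * fps_X ^ n) * fpinf (Z (-2) * fps_X ^ n) * G n)"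
      unfolding T_def p_def ZZ 1[of x] 1[of "1 / x"] 1[of y] 1[of "1 / y"] by (simp only: mult_ac)
    also have "\<dots> = p n * fpinf (fps_X ^ (2 * n + 1))" unfolding G_def gf_fill[OF n] ..
    also have "fpinf (fps_X ^ (2 * n + 1)) = fpinf fps_X * (inv_fpoch (int (2 * n)) :: complex fps)"
    proof -
      have "fpinf fps_X = fpoch fps_X (2 * n) * (fpinf (fps_X ^ (2 * n + 1)) :: complex fps)"
        using fpinf_split[of fps_X "2 * n"] by (simp add: power_add mult.commute)
      hence "fpinf fps_X * inv_fpoch (int (2 * n)) = (fpoch fps_X (2 * n) * inv_fpoch (int (2 * n))) * (fpinf (fps_X ^ (2 * n + 1)) :: complex fps)"
        by (simp only: mult_ac)
      thus ?thesis by (simp only: fpoch_X_inv_fpoch mult_1_left)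
    qed
    finally show ?thesis .
  qed
  define F where "F = gf S quad_size rk"
  define E where "E = (1 + fps_const x) * fpinf fps_X"
  have "(fpinf (fps_const y) * fpinf (fps_const (1 / y))) * ((1 + fps_const x) * (fpinf fps_X * fpinf (fps_const x) * fpinf (fps_const (1 / x))) * F)
     = (fpinf (fps_const y) * fpinf (fps_const (1 / y))) * zsum (lterm y c)"
  proof (rule fps_eqI)
    fix M :: nat
    define N where "N = 2 * M + 2"
    have F: "fps_eq M F (\<Sum>i<N. gf (smallest_is (Suc i) S) quad_size rk)"
      unfolding fps_eq_def F_def
    proof (intro allI impI gf_by_smallest S)
      fix m assume "m < M" thus "m \<le> N" by (simp add: N_def)
    qed
    have t: "E * T * gf (smallest_is (Suc i) S) quad_size rk =
       fpinf fps_X ^ 2 * (fps_X ^ Suc i * fpoch (fps_const y) (Suc i) * fpoch (fps_const (1 / y)) (Suc i) * (\<Sum>r\<in>{- int (Suc i)..int (Suc i)}. fps_const (c r) * kern (Suc i) r))" for i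
    proof -
      have "E * T * gf (smallest_is (Suc i) S) quad_size rk = E * fps_X ^ (Suc i + s * Suc i) * (T * G (Suc i))"
        unfolding gf[OF zero_less_Suc] G_def by (simp only: mult_ac)
      also have "\<dots> = fpinf fps_X ^ 2 * (fps_X ^ Suc i * fpoch (fps_const y) (Suc i) * fpoch (fps_const (1 / y)) (Suc i) * (\<Sum>r\<in>{- int (Suc i)..int (Suc i)}. fps_const (c r) * kern (Suc i) r))"
        unfolding TG[OF zero_less_Suc] c[OF zero_less_Suc] p_def E_def power_add by (simp only: mult_ac power2_eq_square)
      finally show ?thesis .
    qed
    have "(fpinf (fps_const y) * fpinf (fps_const (1 / y))) * ((1 + fps_const x) * (fpinf fps_X * fpinf (fps_const x) * fpinf (fps_const (1 / x))) * F) = E * T * F"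
      unfolding E_def T_def by (simp only: mult_ac)
    also have "fps_eq M \<dots> (E * T * (\<Sum>i<N. gf (smallest_is (Suc i) S) quad_size rk))" by (intro fps_eq_mult fps_eq_refl F)
    also have "E * T * (\<Sum>i<N. gf (smallest_is (Suc i) S) quad_size rk)
       = (\<Sum>i<N. fpinf fps_X ^ 2 * (fps_X ^ Suc i * fpoch (fps_const y) (Suc i) * fpoch (fps_const (1 / y)) (Suc i) * (\<Sum>r\<in>{- int (Suc i)..int (Suc i)}. fps_const (c r) * kern (Suc i) r)))"
      by (simp only: sum_distrib_left[of "E * T"] t)
    also have "\<dots> = fpinf fps_X ^ 2 * (\<Sum>n\<le>N. fps_X ^ n * fpoch (fps_const y) n * fpoch (fps_const (1 / y)) n * (\<Sum>r\<in>{- int n..int n}. fps_const (c r) * kern n r))"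
      by (simp only: sum_distrib_left[of "fpinf fps_X ^ 2"] sum.atMost_shift) (simp add: c0 sum_distrib_left mult.assoc)
    also have "fps_eq M \<dots> (fpinf (fps_const y) * fpinf (fps_const (1 / y)) * zsum (lterm y c))"
      unfolding N_def by (rule bailey_limit[OF y])
    finally show "fps_eq M (fpinf (fps_const y) * fpinf (fps_const (1 / y)) * ((1 + fps_const x) * (fpinf fps_X * fpinf (fps_const x) * fpinf (fps_const (1 / x))) * F))
       (fpinf (fps_const y) * fpinf (fps_const (1 / y)) * zsum (lterm y c))" .
  qed
  note eq = this
  have "fps_nth (fpinf (fps_const y) * fpinf (fps_const (1 / y))) 0 \<noteq> 0"
    using y by (simp add: fpinf_nth_0)
  hence nz: "fpinf (fps_const y) * fpinf (fps_const (1 / y)) \<noteq> 0" by (metis fps_zero_nth)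
  have "(1 + fps_const x) * (fpinf fps_X * fpinf (fps_const x) * fpinf (fps_const (1 / x))) * F = zsum (lterm y c)"
    by (rule iffD1[OF mult_left_cancel[OF nz] eq])
  moreover have "(1 + fps_const x) * fps_const (1 - x) = fps_const (1 - x ^ 2)"
  proof -
    have "(1 + fps_const x) * fps_const (1 - x) = fps_const ((1 + x) * (1 - x))"
      by (simp only: fps_const_mult[symmetric] fps_const_add[symmetric] fps_const_1_eq_1)
    thus ?thesis by (simp add: power2_eq_square algebra_simps)
  qed
  ultimately show ?thesis unfolding triple_product[OF x(1)] F_def y_def by (simp only: mult.assoc[symmetric])
qed

section \<open>From power series to analytic functions\<close>

lemma summable_quadratic_geometric:
  fixes t :: real
  assumes "0 \<le> t" "t < 1"
  shows "summable (\<lambda>m. C * (real (2 * m + 3) * real (m + 1)) * t ^ m)"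
proof (rule summable_comparison_test')
  have 1: "summable (\<lambda>n. diffs (\<lambda>_. 1) n * u ^ n)" if "norm u < 1" for u :: real
    by (rule termdiff_converges[OF that]) (simp add: summable_geometric)
  have "summable (\<lambda>n. diffs (diffs (\<lambda>_. 1)) n * t ^ n)"
    by (rule termdiff_converges[of _ 1]) (use assms 1 in auto)
  thus "summable (\<lambda>n. 2 * \<bar>C\<bar> * (diffs (diffs (\<lambda>_. 1)) n * t ^ n))" by (rule summable_mult)
  fix n :: nat
  have "real (2 * n + 3) * real (n + 1) \<le> 2 * (real (n + 1) * real (n + 2))" by (simp add: algebra_simps)
  hence "\<bar>C\<bar> * (real (2 * n + 3) * real (n + 1)) * t ^ n \<le> \<bar>C\<bar> * (2 * (real (n + 1) * real (n + 2))) * t ^ n"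
    using assms by (intro mult_right_mono mult_left_mono) auto
  also have "\<bar>C\<bar> * (2 * (real (n + 1) * real (n + 2))) * t ^ n = 2 * \<bar>C\<bar> * (diffs (diffs (\<lambda>_. 1)) n * t ^ n)"
    by (simp add: diffs_def algebra_simps)
  finally show "norm (C * (real (2 * n + 3) * real (n + 1)) * t ^ n) \<le> 2 * \<bar>C\<bar> * (diffs (diffs (\<lambda>_. 1)) n * t ^ n)"
    using assms by (simp only: real_norm_def abs_mult power_abs abs_of_nonneg of_nat_0_le_iff)
qed

lemma fps_eval_infsum:
  fixes f :: "complex fps"
  assumes "summable (\<lambda>n. norm (fps_nth f n * w ^ n))"
  shows "eval_fps f w = (\<Sum>\<^sub>\<infinity>n. fps_nth f n * w ^ n)"
  using norm_summable_imp_has_sum[OF assms summable_sums[OF summable_norm_cancel[OF assms]]]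
  by (simp add: eval_fps_def infsumI)

text \<open>
  The order condition and the linear bound on the coefficients make the double series over \<open>r\<close> and \<open>m\<close>
  converge absolutely, so the summations can be interchanged.
\<close>

lemma eval_zsum:
  assumes C: "\<And>r m. norm (fps_nth (g r) m) \<le> C * real (m + 1)" and g: "\<And>r. fps_eq (nat \<bar>r\<bar> - 1) (g r) 0"
  shows "fps_conv_radius (zsum g) \<ge> 1"
    and "norm w < 1 \<Longrightarrow> eval_fps (zsum g) w = (\<Sum>\<^sub>\<infinity>r. eval_fps (g r) w)"
proof -
  define f where "f w = (\<lambda>(m, r). fps_nth (g r) m * w ^ m)" for w :: complex
  define D where "D m = {- (int m + 1)..int m + 1}" for m
  have C0: "C \<ge> 0" using C[of 0 0] order_trans[OF norm_ge_zero, of "fps_nth (g 0) 0"] by simp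
  have out: "fps_nth (g r) m = 0" if "r \<notin> D m" for r m
  proof -
    have "m < nat \<bar>r\<bar> - 1" using that by (auto simp: D_def)
    thus ?thesis using g[of r] by (simp add: fps_eq_def)
  qed
  have fin: "finite (D m)" for m by (simp add: D_def)
  have cardD: "real (card (D m)) = real (2 * m + 3)" for m by (simp add: D_def nat_add_distrib)
  have fb: "norm (f w (m, r)) \<le> C * real (m + 1) * norm w ^ m" for w m r
    unfolding f_def by (simp add: norm_mult norm_power) (rule mult_right_mono, use C[of r m] in auto)
  have zs: "fps_nth (zsum g) m * w ^ m = (\<Sum>r\<in>D m. f w (m, r))" for m w
    by (simp add: zsum_def f_def sum_distrib_right D_def)
  have sb: "(\<Sum>r\<in>D m. norm (f w (m, r))) \<le> C * (real (2 * m + 3) * real (m + 1)) * norm w ^ m" for m w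
  proof -
    have "(\<Sum>r\<in>D m. norm (f w (m, r))) \<le> real (card (D m)) * (C * real (m + 1) * norm w ^ m)"
      by (rule sum_bounded_above) (rule fb)
    thus ?thesis unfolding cardD by (simp only: mult_ac)
  qed
  have zn: "summable (\<lambda>m. norm (fps_nth (zsum g) m * w ^ m))" if "norm w < 1" for w
  proof (rule summable_comparison_test'[OF summable_quadratic_geometric[OF norm_ge_zero that, of C]])
    fix m :: nat
    have "norm (fps_nth (zsum g) m * w ^ m) \<le> (\<Sum>r\<in>D m. norm (f w (m, r)))" unfolding zs by (rule norm_sum)
    also have "\<dots> \<le> C * (real (2 * m + 3) * real (m + 1)) * norm w ^ m" by (rule sb)
    finally show "norm (norm (fps_nth (zsum g) m * w ^ m)) \<le> C * (real (2 * m + 3) * real (m + 1)) * norm w ^ m" by simp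
  qed
  show "fps_conv_radius (zsum g) \<ge> 1" unfolding fps_conv_radius_def
  proof (rule conv_radius_geI_ex)
    fix t :: real assume t: "0 < t" "ereal t < 1"
    have "norm (of_real t :: complex) = t" using t by simp
    moreover have "summable (\<lambda>n. fps_nth (zsum g) n * of_real t ^ n)"
      by (rule summable_norm_cancel[OF zn]) (use t in simp)
    ultimately show "\<exists>z. norm z = t \<and> summable (\<lambda>n. fps_nth (zsum g) n * z ^ n)" by blast
  qed
  assume w: "norm w < 1"
  have gn: "summable (\<lambda>m. norm (fps_nth (g r) m * w ^ m))" for r
  proof (rule summable_comparison_test'[OF summable_quadratic_geometric[OF norm_ge_zero w, of C]])
    fix m :: nat
    have "norm (fps_nth (g r) m * w ^ m) \<le> C * real (m + 1) * norm w ^ m" using fb[of w m r] by (simp add: f_def)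
    also have "C * real (m + 1) * norm w ^ m \<le> C * (real (2 * m + 3) * real (m + 1)) * norm w ^ m"
      using C0 by (intro mult_right_mono mult_left_mono) (auto simp: algebra_simps)
    finally show "norm (norm (fps_nth (g r) m * w ^ m)) \<le> C * (real (2 * m + 3) * real (m + 1)) * norm w ^ m" by simp
  qed
  have sumr: "((\<lambda>r. h (f w (m, r))) has_sum (\<Sum>r\<in>D m. h (f w (m, r)))) UNIV" if "h 0 = 0" for h :: "complex \<Rightarrow> 'b::{comm_monoid_add,topological_space}" and m
    by (rule has_sum_finite_neutralI[OF fin]) (use out that in \<open>auto simp: f_def\<close>)
  have "(\<lambda>p. norm (f w p)) summable_on (UNIV \<times> UNIV)"
  proof (subst Infinite_Sum.abs_summable_on_Sigma_iff, intro conjI ballI)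
    fix m
    show "(\<lambda>r. norm (f w (m, r))) summable_on UNIV" using sumr[of norm m] by (auto simp: summable_on_def)
  next
    have i: "(\<Sum>\<^sub>\<infinity>r. norm (f w (m, r))) = (\<Sum>r\<in>D m. norm (f w (m, r)))" for m using sumr[of norm m] by (simp add: infsumI)
    have "summable (\<lambda>m. norm (\<Sum>r\<in>D m. norm (f w (m, r))))"
      by (rule summable_comparison_test'[OF summable_quadratic_geometric[OF norm_ge_zero w, of C]])
         (use sb in \<open>auto simp: sum_nonneg\<close>)
    hence "(\<lambda>m. norm (\<Sum>r\<in>D m. norm (f w (m, r)))) summable_on UNIV"
      by (intro norm_summable_imp_summable_on) simp
    thus "(\<lambda>m. norm (\<Sum>\<^sub>\<infinity>r. norm (f w (m, r)))) summable_on UNIV" unfolding i .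
  qed
  hence "f w summable_on (UNIV \<times> UNIV)" by (rule abs_summable_summable)
  hence sm: "(\<lambda>(m, r). f w (m, r)) summable_on (UNIV \<times> UNIV)" by simp
  have "eval_fps (zsum g) w = (\<Sum>\<^sub>\<infinity>m. fps_nth (zsum g) m * w ^ m)" by (rule fps_eval_infsum[OF zn[OF w]])
  also have "\<dots> = (\<Sum>\<^sub>\<infinity>m. \<Sum>\<^sub>\<infinity>r. f w (m, r))"
    unfolding zs by (intro infsum_cong infsumI[symmetric] sumr) simp
  also have "\<dots> = (\<Sum>\<^sub>\<infinity>r. \<Sum>\<^sub>\<infinity>m. f w (m, r))" by (rule infsum_swap_banach[OF sm])
  also have "\<dots> = (\<Sum>\<^sub>\<infinity>r. eval_fps (g r) w)"
    by (intro infsum_cong) (simp add: fps_eval_infsum[OF gn] f_def)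
  finally show "eval_fps (zsum g) w = (\<Sum>\<^sub>\<infinity>r. eval_fps (g r) w)" .
qed

lemma norm_powi_1: "norm (x::complex) = 1 \<Longrightarrow> norm (x powi n) = 1"
  by (simp add: norm_power_int)

lemma norm_numer: "norm x = 1 \<Longrightarrow> norm (numer x n) \<le> 4"
proof -
  assume x: "norm x = 1"
  have "norm (numer x n) \<le> norm (x powi (-n)) + norm (x powi (n + 1)) + norm (1::complex) + norm x"
    using norm_triangle_ineq4[of "x powi (-n) + x powi (n + 1) - 1" x] norm_triangle_ineq4[of "x powi (-n) + x powi (n + 1)" 1]
      norm_triangle_ineq[of "x powi (-n)" "x powi (n + 1)"] unfolding numer_def by linarith
  thus ?thesis using x by (simp only: norm_powi_1 norm_one)
qed

lemma fps_nth_inverse_one_minus: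
  fixes c :: complex
  assumes c: "norm c = 1" and k: "k > 0"
  shows "norm (fps_nth (inverse (1 - fps_const c * fps_X ^ k)) m) \<le> 1"
proof (induction m rule: less_induct)
  case (less m)
  define f where "f = inverse (1 - fps_const c * fps_X ^ k)"
  have "(1 - fps_const c * fps_X ^ k) * f = 1"
    unfolding f_def by (rule inverse_mult_eq_1') (use k in simp)
  hence f: "f = 1 + fps_const c * (fps_X ^ k * f)" by (simp add: algebra_simps)
  have "fps_nth f m = fps_nth (1 + fps_const c * (fps_X ^ k * f)) m" using f by simp
  hence e: "fps_nth f m = (if m = 0 then 1 else 0) + c * (if m < k then 0 else fps_nth f (m - k))"
    by (simp add: fps_X_power_mult_nth)
  show ?case
  proof (cases "m < k")
    case True
    thus ?thesis using e by (simp add: f_def)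
  next
    case False
    hence "norm (fps_nth f (m - k)) \<le> 1" unfolding f_def by (intro less) (use k in simp)
    thus ?thesis using e False k c by (simp add: f_def norm_mult)
  qed
qed

text \<open>
  A convolution of two geometric series with coefficients of modulus at most 1.
\<close>

lemma fps_nth_inverse_wfac:
  assumes y: "norm y = 1" and k: "k > 0"
  shows "norm (fps_nth (inverse (wfac y k)) m) \<le> real (m + 1)"
proof -
  define a where "a = inverse (1 - fps_const y * fps_X ^ k)"
  define b where "b = inverse (1 - fps_const (1 / y) * fps_X ^ k)"
  have "inverse (wfac y k) = a * b" by (simp add: wfac_def a_def b_def fps_inverse_mult)
  hence "norm (fps_nth (inverse (wfac y k)) m) = norm (\<Sum>i=0..m. fps_nth a i * fps_nth b (m - i))" by (simp add: fps_mult_nth)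
  also have "\<dots> \<le> (\<Sum>i=0..m. norm (fps_nth a i * fps_nth b (m - i)))" by (rule norm_sum)
  also have "\<dots> \<le> (\<Sum>i=0..m. 1)"
  proof (rule sum_mono)
    fix i
    have "norm (fps_nth a i) \<le> 1" unfolding a_def by (rule fps_nth_inverse_one_minus) (use y k in auto)
    moreover have "norm (fps_nth b (m - i)) \<le> 1" unfolding b_def by (rule fps_nth_inverse_one_minus) (use y k in \<open>auto simp: norm_divide\<close>)
    ultimately show "norm (fps_nth a i * fps_nth b (m - i)) \<le> 1" unfolding norm_mult by (intro mult_le_one) auto
  qed
  finally show ?thesis by simp
qed

lemma conv_radius_inverse_wfac:
  assumes y: "norm y = 1" and k: "k > 0"
  shows "fps_conv_radius (inverse (wfac y k)) \<ge> 1"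
  unfolding fps_conv_radius_def
proof (rule conv_radius_geI_ex)
  fix t :: real assume t: "0 < t" "ereal t < 1"
  have "summable (\<lambda>m. fps_nth (inverse (wfac y k)) m * of_real t ^ m)"
  proof (rule summable_comparison_test'[OF summable_quadratic_geometric[of t 1]])
    fix m
    have "norm (fps_nth (inverse (wfac y k)) m * of_real t ^ m) = norm (fps_nth (inverse (wfac y k)) m) * t ^ m"
      using t by (simp add: norm_mult norm_power)
    also have "\<dots> \<le> real (m + 1) * t ^ m"
      using t by (intro mult_right_mono fps_nth_inverse_wfac assms) auto
    also have "\<dots> \<le> 1 * (real (2 * m + 3) * real (m + 1)) * t ^ m"
      using t by (intro mult_right_mono) (auto simp: algebra_simps)
    finally show "norm (fps_nth (inverse (wfac y k)) m * of_real t ^ m) \<le> 1 * (real (2 * m + 3) * real (m + 1)) * t ^ m" .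
  qed (use t in auto)
  moreover have "norm (of_real t :: complex) = t" using t by simp
  ultimately show "\<exists>z. norm z = t \<and> summable (\<lambda>n. fps_nth (inverse (wfac y k)) n * z ^ n)" by blast
qed

lemma norm_lt_radius: "norm w < 1 \<Longrightarrow> 1 \<le> R \<Longrightarrow> ereal (norm (w::complex)) < R"
  by (metis ereal_less(3) less_le_trans less_ereal.simps(1) one_ereal_def)

lemma eval_inverse_wfac:
  assumes y: "norm y = 1" and k: "k > 0" and w: "norm w < 1"
  shows "eval_fps (inverse (wfac y k)) w = 1 / denom y (w ^ k)"
proof -
  have y0: "y \<noteq> 0" using y by auto
  have rW: "fps_conv_radius (wfac y k) = \<infinity>"
  proof -
    have "fps_conv_radius (wfac y k) \<ge> \<infinity>"
      unfolding wfac_def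
      by (rule order_trans[OF _ fps_conv_radius_mult], rule min.boundedI; rule order_trans[OF _ fps_conv_radius_diff], rule min.boundedI;
          (simp; fail)?; rule order_trans[OF _ fps_conv_radius_mult]; simp)
    thus ?thesis by simp
  qed
  have e: "eval_fps (1 - fps_const c * fps_X ^ k) w = 1 - c * w ^ k" for c
  proof -
    have "fps_conv_radius (fps_const c * fps_X ^ k) \<ge> \<infinity>"
      by (rule order_trans[OF _ fps_conv_radius_mult]) simp
    thus ?thesis by (subst eval_fps_diff) (auto simp: eval_fps_mult)
  qed
  have r: "fps_conv_radius (1 - fps_const c * fps_X ^ k) = \<infinity>" for c :: complex
  proof -
    have "fps_conv_radius (fps_const c * fps_X ^ k) \<ge> \<infinity>"
      by (rule order_trans[OF _ fps_conv_radius_mult]) simp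
    hence "fps_conv_radius (1 - fps_const c * fps_X ^ k) \<ge> \<infinity>"
      by (intro order_trans[OF _ fps_conv_radius_diff]) simp
    thus ?thesis by simp
  qed
  have "inverse (wfac y k) * wfac y k = 1" by (rule inverse_mult_eq_1) (use k in \<open>simp add: fps_nth_wfac\<close>)
  hence "1 = eval_fps (inverse (wfac y k) * wfac y k) w" by simp
  also have "\<dots> = eval_fps (inverse (wfac y k)) w * eval_fps (wfac y k) w"
    using norm_lt_radius[OF w conv_radius_inverse_wfac[OF y k]] rW by (intro eval_fps_mult) auto
  also have "eval_fps (wfac y k) w = denom y (w ^ k)"
    unfolding wfac_def denom_def by (subst eval_fps_mult) (simp_all add: e r)
  finally show ?thesis by (metis mult_zero_right nonzero_eq_divide_eq zero_neq_one)
qed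

lemma jterm_nth: "fps_nth (jterm x r) m = (if m = nat (tri (r + 1)) then (-1) powi r * x powi r else 0)"
  by (simp add: jterm_def)

lemma eval_monom: "eval_fps (fps_const c * fps_X ^ k) w = c * (w::complex) ^ k"
  by (subst eval_fps_mult) simp_all

lemma monom_conv_radius: "fps_conv_radius (fps_const (c::complex) * fps_X ^ k) = \<infinity>"
proof -
  have "fps_conv_radius (fps_const c * fps_X ^ k) \<ge> \<infinity>"
    by (rule order_trans[OF _ fps_conv_radius_mult]) simp
  thus ?thesis by simp
qed

lemma power_nat_tri: "w ^ nat (tri n) = (w::complex) powi tri n"
  using tri_nonneg[of n] by (simp add: power_int_def)

lemma eval_zsum_jterm:
  assumes x: "norm x = 1" and w: "norm w < 1" "w \<noteq> 0"
  shows "fps_conv_radius (zsum (jterm x)) \<ge> 1"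
    and "eval_fps (zsum (jterm x)) w = - (1 / x) * theta w x"
proof -
  have x0: "x \<noteq> 0" using x by auto
  have b: "norm (fps_nth (jterm x r) m) \<le> 1 * real (m + 1)" for r m
    using norm_powi_1[OF x] by (auto simp: jterm_nth norm_mult norm_power_int)
  note E = eval_zsum[of "jterm x", OF b jterm_order]
  show "fps_conv_radius (zsum (jterm x)) \<ge> 1" by (rule E)
  have "eval_fps (zsum (jterm x)) w = (\<Sum>\<^sub>\<infinity>r. eval_fps (jterm x r) w)" by (rule E(2)[OF w(1)])
  also have "\<dots> = (\<Sum>\<^sub>\<infinity>r. - (1 / x) * ((-1) powi (r + 1) * w powi tri (r + 1) * x powi (r + 1)))"
  proof (intro infsum_cong)
    fix r
    have "eval_fps (jterm x r) w = (-1) powi r * x powi r * w powi tri (r + 1)"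
      unfolding jterm_def eval_monom power_nat_tri ..
    thus "eval_fps (jterm x r) w = - (1 / x) * ((-1) powi (r + 1) * w powi tri (r + 1) * x powi (r + 1))"
      using x0 by (simp add: power_int_add)
  qed
  also have "\<dots> = - (1 / x) * (\<Sum>\<^sub>\<infinity>r. (-1) powi (r + 1) * w powi tri (r + 1) * x powi (r + 1))"
    by (rule infsum_cmult_right') 
  also have "(\<Sum>\<^sub>\<infinity>r. (-1) powi (r + 1) * w powi tri (r + 1) * x powi (r + 1)) = theta w x"
    unfolding theta_def
    by (rule infsum_reindex_bij_betw[of "\<lambda>r::int. r + 1" UNIV UNIV "\<lambda>n. (-1) powi n * w powi tri n * x powi n"])
       (rule bij_betwI[of _ _ _ "\<lambda>r. r - 1"]; simp)
  finally show "eval_fps (zsum (jterm x)) w = - (1 / x) * theta w x" .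
qed

text \<open>
  Up to a monomial, \<^const>\<open>denom\<close> is invariant under inversion of its second argument; this rewrites the
  terms with \<open>n < 0\<close> in non-negative powers of \<open>w\<close>.
\<close>

lemma denom_abs:
  assumes "w \<noteq> 0" "y \<noteq> 0"
  shows "1 / denom y (w powi n) = w powi (\<bar>n\<bar> - n) / denom y (w ^ nat \<bar>n\<bar>)"
proof (cases "n \<ge> 0")
  case True
  thus ?thesis by (simp add: power_int_def)
next
  case False
  define t where "t = w ^ nat \<bar>n\<bar>"
  have t0: "t \<noteq> 0" using assms by (simp add: t_def)
  have wn: "w powi n = 1 / t" using False by (simp add: t_def power_int_def inverse_eq_divide power_one_over)
  have w2: "w powi (\<bar>n\<bar> - n) = t ^ 2"
  proof -
    have "nat (\<bar>n\<bar> - n) = nat \<bar>n\<bar> * 2" using False by simp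
    thus ?thesis using False by (simp add: power_int_def t_def power_mult)
  qed
  have "denom y (1 / t) = denom y t / t ^ 2"
    using assms t0 by (simp add: denom_def field_simps power2_eq_square)
  thus ?thesis unfolding wn w2 t_def[symmetric] by simp
qed

lemma eval_zsum_lterm:
  assumes y: "norm y = 1" and w: "norm w < 1" and c: "\<And>r. norm (c r) \<le> 4" "c 0 = 0"
  shows "fps_conv_radius (zsum (lterm y c)) \<ge> 1"
    and "eval_fps (zsum (lterm y c)) w = (\<Sum>\<^sub>\<infinity>r. c r * (-1) powi r * w ^ nat (tri (r + 1) + \<bar>r\<bar>) / denom y (w ^ nat \<bar>r\<bar>))"
proof -
  have l: "lterm y c r = fps_const (c r * (-1) powi r) * fps_X ^ (nat (tri (r + 1) + \<bar>r\<bar>)) * inverse (wfac y (nat \<bar>r\<bar>))" for r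
    using tri_nonneg[of "r + 1"]
    by (simp add: lterm_def jterm_def nat_add_distrib power_add mult_ac flip: fps_const_mult)
  have b: "norm (fps_nth (lterm y c r) m) \<le> 4 * real (m + 1)" for r m
  proof (cases "r = 0")
    case True
    thus ?thesis by (simp add: l c)
  next
    case False
    define e where "e = nat (tri (r + 1) + \<bar>r\<bar>)"
    have "fps_nth (lterm y c r) m = (if m < e then 0 else (c r * (-1) powi r) * fps_nth (inverse (wfac y (nat \<bar>r\<bar>))) (m - e))"
      by (simp add: l e_def[symmetric] mult.assoc fps_X_power_mult_nth)
    moreover have "norm (c r * (-1) powi r * fps_nth (inverse (wfac y (nat \<bar>r\<bar>))) (m - e)) \<le> 4 * real (m - e + 1)"
    proof -
      have "norm (c r) * norm (fps_nth (inverse (wfac y (nat \<bar>r\<bar>))) (m - e)) \<le> 4 * real (m - e + 1)"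
        by (intro mult_mono c fps_nth_inverse_wfac y) (use False in auto)
      thus ?thesis by (simp add: norm_mult norm_power_int)
    qed
    moreover have "4 * real (m - e + 1) \<le> 4 * real (m + 1)" by simp
    ultimately show ?thesis by (auto intro: order_trans)
  qed
  have o: "fps_eq (nat \<bar>r\<bar> - 1) (lterm y c r) 0" for r by (rule lterm_order) simp
  note E = eval_zsum[of "lterm y c", OF b o]
  show "fps_conv_radius (zsum (lterm y c)) \<ge> 1" by (rule E)
  have "eval_fps (zsum (lterm y c)) w = (\<Sum>\<^sub>\<infinity>r. eval_fps (lterm y c r) w)" by (rule E(2)[OF w(1)])
  also have "\<dots> = (\<Sum>\<^sub>\<infinity>r. c r * (-1) powi r * w ^ nat (tri (r + 1) + \<bar>r\<bar>) / denom y (w ^ nat \<bar>r\<bar>))"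
  proof (intro infsum_cong)
    fix r
    show "eval_fps (lterm y c r) w = c r * (-1) powi r * w ^ nat (tri (r + 1) + \<bar>r\<bar>) / denom y (w ^ nat \<bar>r\<bar>)"
    proof (cases "r = 0")
      case True
      thus ?thesis by (simp add: l c)
    next
      case False
      hence k: "nat \<bar>r\<bar> > 0" by simp
      show ?thesis unfolding l
        using norm_lt_radius[OF w conv_radius_inverse_wfac[OF y k]]
        by (subst eval_fps_mult) (simp_all add: monom_conv_radius eval_monom eval_inverse_wfac[OF y k w])
    qed
  qed
  finally show "eval_fps (zsum (lterm y c)) w = (\<Sum>\<^sub>\<infinity>r. c r * (-1) powi r * w ^ nat (tri (r + 1) + \<bar>r\<bar>) / denom y (w ^ nat \<bar>r\<bar>))" .
qed

text \<open>
  For \<open>s = 0\<close> the terms match after the reflection \<open>r \<mapsto> - r\<close>.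
\<close>

lemma lambert_eq:
  assumes "w \<noteq> 0" "x \<noteq> 0"
  shows "lambert 1 x w = (\<Sum>\<^sub>\<infinity>r. numer x r * (-1) powi r * w ^ nat (tri (r + 1) + \<bar>r\<bar>) / denom (x ^ 2) (w ^ nat \<bar>r\<bar>))"
    and "lambert 0 x w = (\<Sum>\<^sub>\<infinity>r. numer x (- r) * (-1) powi r * w ^ nat (tri (r + 1) + \<bar>r\<bar>) / denom (x ^ 2) (w ^ nat \<bar>r\<bar>))"
proof -
  have y0: "x ^ 2 \<noteq> 0" using assms by simp
  have p: "w ^ nat (tri (r + 1) + \<bar>r\<bar>) = w powi (tri (r + 1) + \<bar>r\<bar>)" for r
    using tri_nonneg[of "r + 1"] by (simp add: power_int_def)
  have d: "a / denom (x ^ 2) (w powi n) = a * w powi (\<bar>n\<bar> - n) / denom (x ^ 2) (w ^ nat \<bar>n\<bar>)" for a n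
    using arg_cong[OF denom_abs[OF assms(1) y0, of n], of "\<lambda>t. a * t"] by simp
  show "lambert 1 x w = (\<Sum>\<^sub>\<infinity>r. numer x r * (-1) powi r * w ^ nat (tri (r + 1) + \<bar>r\<bar>) / denom (x ^ 2) (w ^ nat \<bar>r\<bar>))"
    unfolding lambert_def
  proof (intro infsum_cong)
    fix n
    have "w powi (tri (n + 1) + 1 * n) * w powi (\<bar>n\<bar> - n) = w powi (tri (n + 1) + \<bar>n\<bar>)"
      using assms(1) by (simp flip: power_int_add)
    thus "(-1) powi n * w powi (tri (n + 1) + 1 * n) * numer x n / denom (x ^ 2) (w powi n) =
       numer x n * (-1) powi n * w ^ nat (tri (n + 1) + \<bar>n\<bar>) / denom (x ^ 2) (w ^ nat \<bar>n\<bar>)"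
      unfolding d p by (simp add: mult_ac)
  qed
  have "lambert 0 x w = (\<Sum>\<^sub>\<infinity>n. numer x n * (-1) powi n * w ^ nat (tri (- n + 1) + \<bar>n\<bar>) / denom (x ^ 2) (w ^ nat \<bar>n\<bar>))"
    unfolding lambert_def
  proof (intro infsum_cong)
    fix n
    have "tri (- n + 1) + \<bar>n\<bar> = tri (n + 1) + 0 * n + (\<bar>n\<bar> - n)" using tri_Suc[of "- n"] tri_Suc[of n] tri_minus[of n] by linarith
    hence "w powi (tri (n + 1) + 0 * n) * w powi (\<bar>n\<bar> - n) = w powi (tri (- n + 1) + \<bar>n\<bar>)"
      using assms(1) by (simp only: power_int_add[symmetric] simp_thms)
    thus "(-1) powi n * w powi (tri (n + 1) + 0 * n) * numer x n / denom (x ^ 2) (w powi n) =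
       numer x n * (-1) powi n * w ^ nat (tri (- n + 1) + \<bar>n\<bar>) / denom (x ^ 2) (w ^ nat \<bar>n\<bar>)"
      unfolding d using p[of "-n"] by (simp add: mult_ac)
  qed
  also have "\<dots> = (\<Sum>\<^sub>\<infinity>r. numer x (- r) * (-1) powi r * w ^ nat (tri (r + 1) + \<bar>r\<bar>) / denom (x ^ 2) (w ^ nat \<bar>r\<bar>))"
    by (rule infsum_reindex_bij_witness[of _ uminus uminus]) (simp_all add: power_int_minus_one_minus)
  finally show "lambert 0 x w = (\<Sum>\<^sub>\<infinity>r. numer x (- r) * (-1) powi r * w ^ nat (tri (r + 1) + \<bar>r\<bar>) / denom (x ^ 2) (w ^ nat \<bar>r\<bar>))" .
qed

section \<open>Vanishing coefficients and equidistribution\<close>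

lemma root_of_unity_power_int_eq_1:
  fixes d :: int and l :: nat
  assumes "l > 0"
  defines "\<omega> \<equiv> exp (2 * of_real pi * \<i> / of_nat l)"
  shows "\<omega> powi d = 1 \<longleftrightarrow> int l dvd d"
proof -
  have n: "\<omega> ^ j = 1 \<longleftrightarrow> l dvd j" for j
  proof -
    have "\<omega> ^ j = exp (2 * of_real pi * \<i> * of_nat j / of_nat l)"
      by (simp add: \<omega>_def exp_of_nat_mult[symmetric] mult_ac)
    thus ?thesis using complex_root_unity_eq_1[of l j] assms by simp
  qed
  show ?thesis
    by (cases d rule: int_cases2) (simp_all add: n power_int_minus inverse_eq_1_iff)
qed

lemma sum_powers_root_of_unity:
  fixes u :: complex
  assumes "u ^ l = 1"
  shows "(\<Sum>j<l. u ^ j) = (if u = 1 then of_nat l else 0)"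
  using assms geometric_sum[of u l] by auto

text \<open>
  A root of unity filter. The functions \<open>g k\<close> are arbitrary, so the vanishing cannot be read off from
  them; instead a weighted average of \<open>f\<close> over the rotations \<open>w \<mapsto> \<omega>\<^sup>j w\<close> extracts the coefficients in the class
  of \<open>n\<close> on one side and gives 0 on the other.
\<close>

theorem coeffs_vanish_of_dissection:
  fixes f :: "complex fps" and \<rho> :: real
  assumes l: "l > 0" and \<rho>: "\<rho> > 0" "ereal \<rho> \<le> fps_conv_radius f"
    and eq: "\<And>w. 0 < norm w \<Longrightarrow> norm w < \<rho> \<Longrightarrow> eval_fps f w = (\<Sum>k\<in>K. w ^ k * g k (w ^ l))"
    and K: "K \<subseteq> {..<l}" and n: "n mod l \<notin> K"
  shows "fps_nth f n = 0"
proof -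
  define \<omega> where "\<omega> = exp (2 * of_real pi * \<i> / of_nat l)"
  \<comment> \<open>\<open>e\<close> represents \<open>- n\<close> modulo \<open>l\<close> without negative exponents.\<close>
  define e where "e = l - n mod l"
  have e: "n mod l + e = l" using l by (simp add: e_def less_imp_le)
  have w1: "\<omega> ^ j = 1 \<longleftrightarrow> l dvd j" for j
    using root_of_unity_power_int_eq_1[OF l, of "int j"] by (simp add: \<omega>_def)
  have wl: "\<omega> ^ l = 1" by (simp add: w1)
  have nw: "norm \<omega> = 1" by (simp add: \<omega>_def norm_exp_eq_Re)
  define h where "h = Abs_fps (\<lambda>m. (\<Sum>j<l. (\<omega> ^ (e + m)) ^ j) * fps_nth f m)"
  have sums: "(\<lambda>m. fps_nth h m * w ^ m) sums (\<Sum>j<l. \<omega> ^ (e * j) * eval_fps f (\<omega> ^ j * w))" if "norm w < \<rho>" for w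
  proof -
    have "(\<lambda>m. fps_nth f m * (\<omega> ^ j * w) ^ m) sums eval_fps f (\<omega> ^ j * w)" for j
    proof (rule sums_eval_fps)
      have "ereal (norm (\<omega> ^ j * w)) < ereal \<rho>" using that nw by (simp add: norm_mult norm_power)
      thus "ereal (norm (\<omega> ^ j * w)) < fps_conv_radius f" using \<rho>(2) by (rule less_le_trans)
    qed
    hence "(\<lambda>m. \<Sum>j<l. \<omega> ^ (e * j) * (fps_nth f m * (\<omega> ^ j * w) ^ m)) sums (\<Sum>j<l. \<omega> ^ (e * j) * eval_fps f (\<omega> ^ j * w))"
      by (intro sums_sum sums_mult)
    also have "(\<lambda>m. \<Sum>j<l. \<omega> ^ (e * j) * (fps_nth f m * (\<omega> ^ j * w) ^ m)) = (\<lambda>m. fps_nth h m * w ^ m)"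
      by (simp add: h_def sum_distrib_right sum_distrib_left power_mult_distrib power_add mult_ac flip: power_mult)
    finally show ?thesis .
  qed
  have zero: "(\<Sum>j<l. \<omega> ^ (e * j) * eval_fps f (\<omega> ^ j * w)) = 0" if w: "0 < norm w" "norm w < \<rho>" for w
  proof -
    have "eval_fps f (\<omega> ^ j * w) = (\<Sum>k\<in>K. (\<omega> ^ j * w) ^ k * g k (w ^ l))" for j
    proof -
      have "(\<omega> ^ j) ^ l = 1" using w1[of "j * l"] by (simp add: power_mult)
      thus ?thesis using eq[of "\<omega> ^ j * w"] w nw by (simp add: norm_mult norm_power power_mult_distrib)
    qed
    hence "(\<Sum>j<l. \<omega> ^ (e * j) * eval_fps f (\<omega> ^ j * w)) = (\<Sum>j<l. \<Sum>k\<in>K. w ^ k * g k (w ^ l) * (\<omega> ^ (e + k)) ^ j)"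
      by (simp add: sum_distrib_left power_mult_distrib power_add mult_ac flip: power_mult)
    also have "\<dots> = (\<Sum>k\<in>K. \<Sum>j<l. w ^ k * g k (w ^ l) * (\<omega> ^ (e + k)) ^ j)" by (rule sum.swap)
    also have "\<dots> = (\<Sum>k\<in>K. w ^ k * g k (w ^ l) * (\<Sum>j<l. (\<omega> ^ (e + k)) ^ j))" by (simp add: sum_distrib_left)
    also have "\<dots> = 0"
    proof (rule sum.neutral, rule ballI)
      fix k assume k: "k \<in> K"
      hence kl: "k < l" "k \<noteq> n mod l" using K n by auto
      have "\<not> l dvd e + k"
      proof
        assume "l dvd e + k"
        hence "(n mod l + (e + k)) mod l = n mod l" using mod_add_right_eq[of "n mod l" "e + k" l] by simp
        moreover have "n mod l + (e + k) = l + k" using e by simp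
        ultimately show False using kl by simp
      qed
      moreover have "(\<omega> ^ (e + k)) ^ l = 1" using w1[of "(e + k) * l"] by (simp add: power_mult)
      ultimately have "(\<Sum>j<l. (\<omega> ^ (e + k)) ^ j) = 0" using sum_powers_root_of_unity[of "\<omega> ^ (e + k)" l] w1[of "e + k"] by simp
      thus "w ^ k * g k (w ^ l) * (\<Sum>j<l. (\<omega> ^ (e + k)) ^ j) = 0" by simp
    qed
    finally show ?thesis .
  qed
  have rh: "fps_conv_radius h \<ge> ereal \<rho>" unfolding fps_conv_radius_def
  proof (rule conv_radius_geI_ex)
    fix t :: real assume t: "0 < t" "ereal t < ereal \<rho>"
    thus "\<exists>z. norm z = t \<and> summable (\<lambda>n. fps_nth h n * z ^ n)"
      using sums[of "of_real t"] by (intro exI[of _ "of_real t"]) (auto simp: sums_iff)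
  qed
  \<comment> \<open>The hypothesis leaves out \<open>w = 0\<close>; the factor \<^const>\<open>fps_X\<close> makes that point harmless.\<close>
  have "fps_X * h = 0"
  proof (rule eval_fps_eqD)
    have "fps_conv_radius h > 0" using rh \<rho>(1) less_le_trans[of 0 "ereal \<rho>" "fps_conv_radius h"] by simp
    moreover have "min (fps_conv_radius fps_X) (fps_conv_radius h) \<le> fps_conv_radius (fps_X * h)" using fps_conv_radius_mult[of fps_X h] by simp
    ultimately show "fps_conv_radius (fps_X * h) > 0" by auto
    show "fps_conv_radius (0 :: complex fps) > 0" by simp
    have "eventually (\<lambda>w::complex. w \<in> ball 0 \<rho>) (nhds 0)"
      by (rule eventually_nhds_in_open) (use \<rho> in auto)
    thus "eventually (\<lambda>w. eval_fps (fps_X * h) w = eval_fps 0 w) (nhds 0)"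
    proof eventually_elim
      case (elim w)
      hence w: "norm w < \<rho>" by simp
      have "ereal (norm w) < fps_conv_radius h" using w rh less_le_trans[of "ereal (norm w)" "ereal \<rho>"] by simp
      hence "eval_fps (fps_X * h) w = w * eval_fps h w" by (subst eval_fps_mult) auto
      also have "\<dots> = 0"
      proof (cases "w = 0")
        case False
        thus ?thesis using sums[OF w] zero[of w] w by (simp add: eval_fps_def sums_iff)
      qed simp
      finally show ?case by simp
    qed
  qed
  hence "fps_nth h n = 0" by simp
  moreover have "l dvd e + n"
  proof -
    have "e + n = l + l * (n div l)" using e mult_div_mod_eq[of l n] by linarith
    thus ?thesis by simp
  qed
  hence "\<omega> ^ (e + n) = 1" by (simp add: w1)
  ultimately show ?thesis using l by (simp add: h_def)
qed

text \<open>
  Since the constant term of the theta series is not 0, its reciprocal has positive radius of convergence,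
  and so does \<open>F\<close>. Near 0 the equation for \<open>F\<close> can then be evaluated and the common factor \<open>theta w x\<close>
  cancelled.
\<close>

theorem coeffs_vanish_of_quotient:
  fixes F :: "complex fps"
  assumes l: "l > 0" and x: "norm x = 1" "x ^ 2 \<noteq> 1"
    and c: "\<And>r. norm (c r) \<le> 4" "c 0 = 0"
    and F: "fps_const (1 - x ^ 2) * zsum (jterm x) * F = zsum (lterm (x ^ 2) c)"
    and ev: "\<And>w. 0 < norm w \<Longrightarrow> norm w < 1 / 3 \<Longrightarrow> eval_fps (zsum (lterm (x ^ 2) c)) w = C * theta w x * (\<Sum>k\<in>K. w ^ k * g k (w ^ l))"
    and K: "K \<subseteq> {..<l}" and n: "n mod l \<notin> K"
  shows "fps_nth F n = 0"
proof -
  have x0: "x \<noteq> 0" using x by auto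
  have x1: "x \<noteq> 1" using x by auto
  define J where "J = zsum (jterm x)"
  define L where "L = zsum (lterm (x ^ 2) c)"
  have rJ: "fps_conv_radius J \<ge> 1" unfolding J_def by (rule eval_zsum_jterm(1)[OF x(1), of "1/2"]) (simp_all add: norm_divide)
  have y1: "norm (x ^ 2) = 1" using x by (simp add: norm_power)
  have rL: "fps_conv_radius L \<ge> 1" unfolding L_def by (rule eval_zsum_lterm(1)[OF y1, of "1/2"]) (simp_all add: norm_divide c)
  have J0: "fps_nth J 0 \<noteq> 0"
  proof -
    have "{- (int 0 + 1)..int 0 + 1} = {-1, 0, 1}" by auto
    hence "fps_nth J 0 = 1 - 1 / x" by (simp add: J_def zsum_def jterm_nth power_int_minus inverse_eq_divide)
    thus ?thesis using x0 x1 by simp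
  qed
  define D where "D = fps_const (1 - x ^ 2) * J"
  have rD: "fps_conv_radius D \<ge> 1" unfolding D_def by (rule order_trans[OF _ fps_conv_radius_mult]) (simp add: rJ)
  have D0: "fps_nth D 0 \<noteq> 0" using J0 x(2) by (simp add: D_def)
  have rDi: "fps_conv_radius (inverse D) > 0"
    by (rule fps_conv_radius_inverse_pos[OF D0]) (use rD in \<open>auto intro: less_le_trans[of 0 1]\<close>)
  have "inverse D * D = 1" by (rule inverse_mult_eq_1[OF D0])
  moreover have "L = D * F" using F unfolding D_def J_def L_def by simp
  ultimately have "F = inverse D * L" by (simp add: mult.assoc[symmetric])
  have "min (fps_conv_radius (inverse D)) (fps_conv_radius L) > 0" using rDi rL less_le_trans[of 0 1 "fps_conv_radius L"] by simp
  hence rF: "fps_conv_radius F > 0" unfolding \<open>F = inverse D * L\<close> using fps_conv_radius_mult[of "inverse D" L] by (rule less_le_trans)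
  then obtain r where r: "0 < r" "ereal r < fps_conv_radius F" using ereal_dense2[of 0 "fps_conv_radius F"] by auto
  have "isCont (eval_fps J) 0"
    by (rule continuous_eval_fps) (use rJ less_le_trans[of 0 1 "fps_conv_radius J"] in \<open>simp add: zero_ereal_def\<close>)
  moreover have "eval_fps J 0 \<noteq> 0" using J0 by (simp add: eval_fps_at_0)
  ultimately have "eventually (\<lambda>w. eval_fps J w \<noteq> 0) (at 0)"
    unfolding isCont_def by (rule tendsto_imp_eventually_ne)
  then obtain d where d: "d > 0" "\<And>w. w \<noteq> 0 \<Longrightarrow> norm w < d \<Longrightarrow> eval_fps J w \<noteq> 0"
    by (auto simp: eventually_at)
  define \<rho> where "\<rho> = min (min r d) (1 / 3)"
  have \<rho>: "\<rho> > 0" "\<rho> \<le> r" "\<rho> \<le> d" "\<rho> \<le> 1 / 3" using r d by (auto simp: \<rho>_def)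
  show ?thesis
  proof (rule coeffs_vanish_of_dissection[OF l \<rho>(1) _ _ K n])
    have "ereal \<rho> \<le> ereal r" using \<rho> by simp
    thus "ereal \<rho> \<le> fps_conv_radius F" using r(2) by (meson le_less_trans less_imp_le)
    fix w :: complex assume w: "0 < norm w" "norm w < \<rho>"
    have w1: "norm w < 1" "w \<noteq> 0" using w \<rho> by auto
    have Jw: "eval_fps J w = - (1 / x) * theta w x" unfolding J_def by (rule eval_zsum_jterm(2)[OF x(1) w1])
    have nz: "theta w x \<noteq> 0" using d(2)[of w] w \<rho> w1 Jw by auto
    have rFw: "ereal (norm w) < fps_conv_radius F" using w \<rho> r(2) less_trans[of "ereal (norm w)" "ereal r"] by simp
    have "eval_fps L w = eval_fps (fps_const (1 - x ^ 2) * J * F) w" using F unfolding J_def L_def by simp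
    also have "\<dots> = (1 - x ^ 2) * eval_fps J w * eval_fps F w"
      using norm_lt_radius[OF w1(1) rJ] norm_lt_radius[OF w1(1) rD[unfolded D_def]] rFw by (simp add: eval_fps_mult)
    finally have "(1 - x ^ 2) * (- (1 / x) * theta w x) * eval_fps F w = C * theta w x * (\<Sum>k\<in>K. w ^ k * g k (w ^ l))"
      using ev[of w] w \<rho> unfolding Jw L_def by simp
    hence "theta w x * ((1 - x ^ 2) * eval_fps F w) = theta w x * (- x * C * (\<Sum>k\<in>K. w ^ k * g k (w ^ l)))"
      using x0 by (simp add: field_simps)
    hence "(1 - x ^ 2) * eval_fps F w = - x * C * (\<Sum>k\<in>K. w ^ k * g k (w ^ l))"
      by (rule iffD1[OF mult_left_cancel[OF nz]])
    hence "eval_fps F w = - x * C / (1 - x ^ 2) * (\<Sum>k\<in>K. w ^ k * g k (w ^ l))"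
      using x(2) by (simp add: field_simps)
    thus "eval_fps F w = (\<Sum>k\<in>K. w ^ k * (- x * C / (1 - x ^ 2) * g k (w ^ l)))"
      by (simp add: sum_distrib_left mult_ac)
  qed
qed

text \<open>
  Orthogonality of the additive characters modulo \<open>l\<close>: only the trivial one contributes to the size of
  a class.
\<close>

lemma equal_classes_if_exponential_sums_vanish:
  assumes fin: "finite S" and l: "l > 0"
    and zero: "\<And>x::complex. x ^ l = 1 \<Longrightarrow> x \<noteq> 1 \<Longrightarrow> (\<Sum>Q\<in>S. x powi rk Q) = 0"
  shows "divides_into_equal_classes rk l S"
proof -
  define \<omega> where "\<omega> = exp (2 * of_real pi * \<i> / of_nat l)"
  have w1: "\<omega> powi d = 1 \<longleftrightarrow> int l dvd d" for d
    unfolding \<omega>_def by (rule root_of_unity_power_int_eq_1[OF l])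
  have w0: "\<omega> \<noteq> 0" by (simp add: \<omega>_def)
  have main: "of_nat l * of_nat (card {Q \<in> S. [rk Q = k] (mod int l)}) = (of_nat (card S) :: complex)" for k
  proof -
    have s: "(\<Sum>j<l. (\<omega> powi (rk Q - k)) ^ j) = (if [rk Q = k] (mod int l) then of_nat l else 0)" for Q
    proof -
      have "(\<omega> powi (rk Q - k)) ^ l = \<omega> powi ((rk Q - k) * int l)" by (simp add: power_int_mult)
      hence "(\<omega> powi (rk Q - k)) ^ l = 1" by (simp add: w1)
      thus ?thesis by (simp add: sum_powers_root_of_unity w1 cong_iff_dvd_diff)
    qed
    have "of_nat l * of_nat (card {Q \<in> S. [rk Q = k] (mod int l)}) = (\<Sum>Q\<in>S. if [rk Q = k] (mod int l) then of_nat l else (0::complex))"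
      using fin by (simp add: sum.If_cases Int_def)
    also have "\<dots> = (\<Sum>j<l. \<Sum>Q\<in>S. (\<omega> powi (rk Q - k)) ^ j)"
      unfolding s[symmetric] by (rule sum.swap)
    also have "\<dots> = (\<Sum>j<l. if j = 0 then of_nat (card S) else 0)"
    proof (rule sum.cong[OF refl])
      fix j assume j: "j \<in> {..<l}"
      show "(\<Sum>Q\<in>S. (\<omega> powi (rk Q - k)) ^ j) = (if j = 0 then of_nat (card S) else 0)"
      proof (cases "j = 0")
        case False
        have p: "\<omega> ^ j = \<omega> powi int j" by simp
        have "(\<omega> ^ j) ^ l = \<omega> powi (int j * int l)" by (simp add: power_int_mult)
        hence 1: "(\<omega> ^ j) ^ l = 1" by (simp add: w1)
        have "\<not> int l dvd int j" using j False by (auto dest: dvd_imp_le)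
        hence 2: "\<omega> ^ j \<noteq> 1" using w1[of "int j"] by simp
        have "(\<omega> powi (rk Q - k)) ^ j = (\<omega> ^ j) powi rk Q / (\<omega> ^ j) powi k" for Q
          using w0 by (simp add: power_int_diff power_divide power_int_power power_int_power' mult.commute)
        hence "(\<Sum>Q\<in>S. (\<omega> powi (rk Q - k)) ^ j) = (\<Sum>Q\<in>S. (\<omega> ^ j) powi rk Q) / (\<omega> ^ j) powi k"
          by (simp add: sum_divide_distrib)
        thus ?thesis using zero[OF 1 2] False by simp
      qed simp
    qed
    also have "\<dots> = of_nat (card S)" using l by simp
    finally show ?thesis .
  qed
  show ?thesis unfolding divides_into_equal_classes_def
  proof (intro allI)
    fix k k'
    have "of_nat l * of_nat (card {Q \<in> S. [rk Q = k] (mod int l)}) = (of_nat l * of_nat (card {Q \<in> S. [rk Q = k'] (mod int l)}) :: complex)"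
      unfolding main ..
    thus "card {Q \<in> S. [rk Q = k] (mod int l)} = card {Q \<in> S. [rk Q = k'] (mod int l)}" using l by simp
  qed
qed

lemma odd_root_square_neq_1:
  fixes x :: complex
  assumes "odd l" "x ^ l = 1" "x \<noteq> 1"
  shows "x ^ 2 \<noteq> 1"
proof
  assume "x ^ 2 = 1"
  moreover obtain m where "l = 2 * m + 1" using assms(1) by (rule oddE)
  ultimately have "x ^ l = x" by (simp add: power_mult)
  thus False using assms by simp
qed

lemma norm_root_of_unity:
  fixes x :: complex
  assumes "l > 0" "x ^ l = 1"
  shows "norm x = 1"
proof -
  show ?thesis using power_eq_1_iff[OF assms(2)] assms(1) by simp
qed

text \<open>
  The common shape of the rank series of the two sets: the unspecified \<open>c\<close> are the numerators of the
  Lambert series, which matter only through their size and through \<open>c 0 = 0\<close>.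
\<close>

definition rank_series_lambert :: "quadruple set \<Rightarrow> (quadruple \<Rightarrow> int) \<Rightarrow> int \<Rightarrow> bool" where
  "rank_series_lambert S rk s \<longleftrightarrow> (\<forall>x. norm x = 1 \<longrightarrow> x ^ 2 \<noteq> 1 \<longrightarrow> (\<exists>c. (\<forall>r. norm (c r) \<le> 4) \<and> c 0 = 0 \<and>
     fps_const (1 - x ^ 2) * zsum (jterm x) * rank_weight.gf (\<lambda>k. x powi k) S quad_size rk = zsum (lterm (x ^ 2) c) \<and>
     (\<forall>w. 0 < norm w \<longrightarrow> norm w < 1 \<longrightarrow> eval_fps (zsum (lterm (x ^ 2) c)) w = lambert s x w)))"

lemma rank_series_U: "rank_series_lambert U_set u_rank 0"
  unfolding rank_series_lambert_def
proof (intro allI impI)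
  fix x :: complex assume nx: "norm x = 1" and x2: "x ^ 2 \<noteq> 1"
  hence x0: "x \<noteq> 0" by auto
  interpret rank_weight "\<lambda>k. x powi k" by (rule rank_weight_powi[OF x0])
  have c: "norm (numer x (- r)) \<le> 4" "numer x (- 0) = 0" for r
    using norm_numer[OF nx, of "- r"] by (simp_all, simp add: numer_def)
  moreover have "fps_const (1 - x ^ 2) * zsum (jterm x) * gf U_set quad_size u_rank = zsum (lterm (x ^ 2) (\<lambda>r. numer x (- r)))"
  proof (rule gf_times_theta[OF x0 x2 subset_refl, where s = 0])
    fix n :: nat assume n: "n > 0"
    show "gf (smallest_is n U_set) quad_size u_rank = fps_X ^ (n + 0 * n) * gf (fill n) quad_size (core_rank n)"
      unfolding gf_smallest_is_U[OF n] by simp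
    show "(\<Sum>r\<in>{- int n..int n}. fps_const (numer x (- r)) * kern n r)
      = fps_X ^ (0 * n) * ((1 + fps_const x) * fpoch (fps_const x) n * fpoch (fps_const (1 / x)) n * inv_fpoch (int (2 * n)))"
      unfolding numer_kern(1)[OF x0 n] by (simp only: mult_0 power_0 mult_1_left)
  qed (rule c)
  moreover have "eval_fps (zsum (lterm (x ^ 2) (\<lambda>r. numer x (- r)))) w = lambert 0 x w" if w: "0 < norm w" "norm w < 1" for w
  proof -
    have w0: "w \<noteq> 0" using w by auto
    show ?thesis
      unfolding lambert_eq(2)[OF w0 x0]
      by (rule eval_zsum_lterm(2)[where c = "\<lambda>r. numer x (- r)", OF _ w(2) c]) (simp add: norm_power nx)
  qed
  ultimately show "\<exists>c. (\<forall>r. norm (c r) \<le> 4) \<and> c 0 = 0 \<and>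
     fps_const (1 - x ^ 2) * zsum (jterm x) * gf U_set quad_size u_rank = zsum (lterm (x ^ 2) c) \<and>
     (\<forall>w. 0 < norm w \<longrightarrow> norm w < 1 \<longrightarrow> eval_fps (zsum (lterm (x ^ 2) c)) w = lambert 0 x w)"
    by (intro exI[of _ "\<lambda>r. numer x (- r)"]) auto
qed

lemma rank_series_V: "rank_series_lambert V_set v_rank 1"
  unfolding rank_series_lambert_def
proof (intro allI impI)
  fix x :: complex assume nx: "norm x = 1" and x2: "x ^ 2 \<noteq> 1"
  hence x0: "x \<noteq> 0" by auto
  interpret rank_weight "\<lambda>k. x powi k" by (rule rank_weight_powi[OF x0])
  have c: "norm (numer x r) \<le> 4" "numer x 0 = 0" for r
    using norm_numer[OF nx, of r] by (simp_all add: numer_def)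
  moreover have "fps_const (1 - x ^ 2) * zsum (jterm x) * gf V_set quad_size v_rank = zsum (lterm (x ^ 2) (numer x))"
  proof (rule gf_times_theta[OF x0 x2 V_set_subset, where s = 1])
    fix n :: nat assume n: "n > 0"
    show "gf (smallest_is n V_set) quad_size v_rank = fps_X ^ (n + 1 * n) * gf (fill n) quad_size (core_rank n)"
      unfolding gf_smallest_is_V[OF n] by (simp add: mult_2)
    show "(\<Sum>r\<in>{- int n..int n}. fps_const (numer x r) * kern n r)
      = fps_X ^ (1 * n) * ((1 + fps_const x) * fpoch (fps_const x) n * fpoch (fps_const (1 / x)) n * inv_fpoch (int (2 * n)))"
      unfolding numer_kern(2)[OF x0 n] by (simp only: mult_1_left)
  qed (rule c)
  moreover have "eval_fps (zsum (lterm (x ^ 2) (numer x))) w = lambert 1 x w" if w: "0 < norm w" "norm w < 1" for w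
  proof -
    have w0: "w \<noteq> 0" using w by auto
    show ?thesis
      unfolding lambert_eq(1)[OF w0 x0]
      by (rule eval_zsum_lterm(2)[where c = "numer x", OF _ w(2) c]) (simp add: norm_power nx)
  qed
  ultimately show "\<exists>c. (\<forall>r. norm (c r) \<le> 4) \<and> c 0 = 0 \<and>
     fps_const (1 - x ^ 2) * zsum (jterm x) * gf V_set quad_size v_rank = zsum (lterm (x ^ 2) c) \<and>
     (\<forall>w. 0 < norm w \<longrightarrow> norm w < 1 \<longrightarrow> eval_fps (zsum (lterm (x ^ 2) c)) w = lambert 1 x w)"
    by (intro exI[of _ "numer x"]) auto
qed

text \<open>
  A dissection of the Lambert series in which the classes outside \<open>K\<close> are missing gives equal classes for
  these residues.
\<close>

lemma equal_classes_of_dissection: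
  assumes S: "rank_series_lambert S rk s" "S \<subseteq> U_set" and l: "odd l" and n: "n mod l \<notin> K" and K: "K \<subseteq> {..<l}"
    and lam: "\<And>x. x ^ l = 1 \<Longrightarrow> x \<noteq> 1 \<Longrightarrow> \<exists>C g. \<forall>w. 0 < norm w \<longrightarrow> norm w < 1 / 3 \<longrightarrow>
        lambert s x w = C * theta w x * (\<Sum>k\<in>K. w ^ k * g k (w ^ l))"
  shows "divides_into_equal_classes rk l (quadruples_in S n)"
proof (rule equal_classes_if_exponential_sums_vanish)
  show l0: "l > 0" using l by (rule odd_pos)
  fix x :: complex assume x: "x ^ l = 1" "x \<noteq> 1"
  have x2: "x ^ 2 \<noteq> 1" by (rule odd_root_square_neq_1[OF l x])
  have nx: "norm x = 1" by (rule norm_root_of_unity[OF l0 x(1)])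
  hence x0: "x \<noteq> 0" by auto
  interpret rank_weight "\<lambda>k. x powi k" by (rule rank_weight_powi[OF x0])
  from S(1) nx x2 obtain c where c: "\<And>r. norm (c r) \<le> 4" "c 0 = 0"
      "fps_const (1 - x ^ 2) * zsum (jterm x) * gf S quad_size rk = zsum (lterm (x ^ 2) c)"
      "\<And>w. 0 < norm w \<Longrightarrow> norm w < 1 \<Longrightarrow> eval_fps (zsum (lterm (x ^ 2) c)) w = lambert s x w"
    unfolding rank_series_lambert_def by blast
  from lam[OF x] obtain C g where g: "\<And>w. 0 < norm w \<Longrightarrow> norm w < 1 / 3 \<Longrightarrow>
        lambert s x w = C * theta w x * (\<Sum>k\<in>K. w ^ k * g k (w ^ l))" by blast
  have "fps_nth (gf S quad_size rk) n = 0"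
  proof (rule coeffs_vanish_of_quotient[where g = g and C = C, OF l0 nx x2 c(1,2,3) _ K n])
    fix w :: complex assume "0 < norm w" "norm w < 1 / 3"
    thus "eval_fps (zsum (lterm (x ^ 2) c)) w = C * theta w x * (\<Sum>k\<in>K. w ^ k * g k (w ^ l))"
      using c(4)[of w] g[of w] by simp
  qed
  thus "(\<Sum>Q\<in>quadruples_in S n. x powi rk Q) = 0"
    by (simp add: gf_def fibers_eq_quadruples_in[OF S(2)])
qed (rule finite_quadruples_in)

lemma equal_classes_U3: "n mod 3 = 0 \<Longrightarrow> divides_into_equal_classes u_rank 3 (quadruples_in U_set n)"
proof (rule equal_classes_of_dissection[OF rank_series_U subset_refl, where K = "{1, 2}"])
  fix x :: complex assume x: "x ^ 3 = 1" "x \<noteq> 1"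
  show "\<exists>C g. \<forall>w. 0 < norm w \<longrightarrow> norm w < 1 / 3 \<longrightarrow> lambert 0 x w = C * theta w x * (\<Sum>k\<in>{1, 2}. w ^ k * g k (w ^ 3))"
    by (rule exI[of _ "numer x 1 / (1 - x)"],
        rule exI[of _ "\<lambda>k Q. if k = 1 then - ap 3 Q 1 0 / th 3 Q 1 else ap 3 Q 1 1 / th 3 Q 1"])
       (simp add: lambert_3(1)[OF _ _ x])
qed auto

lemma equal_classes_V3: "n mod 3 = 1 \<Longrightarrow> divides_into_equal_classes v_rank 3 (quadruples_in V_set n)"
proof (rule equal_classes_of_dissection[OF rank_series_V laurent.V_set_subset, where K = "{0, 2}"])
  fix x :: complex assume x: "x ^ 3 = 1" "x \<noteq> 1"
  show "\<exists>C g. \<forall>w. 0 < norm w \<longrightarrow> norm w < 1 / 3 \<longrightarrow> lambert 1 x w = C * theta w x * (\<Sum>k\<in>{0, 2}. w ^ k * g k (w ^ 3))"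
    by (rule exI[of _ "numer x 1 / (1 - x)"],
        rule exI[of _ "\<lambda>k Q. if k = 0 then Q * ap 3 Q 1 2 / th 3 Q 1 else - ap 3 Q 1 1 / th 3 Q 1"])
       (simp add: lambert_3(2)[OF _ _ x])
qed auto

lemma equal_classes_U5: "n mod 5 \<in> {0, 3} \<Longrightarrow> divides_into_equal_classes u_rank 5 (quadruples_in U_set n)"
proof (rule equal_classes_of_dissection[OF rank_series_U subset_refl, where K = "{1, 2, 4}"])
  fix x :: complex assume x: "x ^ 5 = 1" "x \<noteq> 1"
  show "\<exists>C g. \<forall>w. 0 < norm w \<longrightarrow> norm w < 1 / 3 \<longrightarrow> lambert 0 x w = C * theta w x * (\<Sum>k\<in>{1, 2, 4}. w ^ k * g k (w ^ 5))"
    by (rule exI[of _ "numer x 1 / (1 - x)"],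
        rule exI[of _ "\<lambda>k Q. if k = 1 then - (ap 5 Q 1 (-1) + Q ^ 2 * ap 5 Q 2 4) / th 5 Q 2
          else if k = 2 then (ap 5 Q 1 1 - ap 5 Q 2 0) / th 5 Q 1 else ap 5 Q 1 2 / th 5 Q 2"])
       (simp add: lambert_U5[OF _ _ x] add.assoc)
qed auto

lemma equal_classes_V5: "n mod 5 \<in> {1, 4} \<Longrightarrow> divides_into_equal_classes v_rank 5 (quadruples_in V_set n)"
proof (rule equal_classes_of_dissection[OF rank_series_V laurent.V_set_subset, where K = "{0, 2, 3}"])
  fix x :: complex assume x: "x ^ 5 = 1" "x \<noteq> 1"
  show "\<exists>C g. \<forall>w. 0 < norm w \<longrightarrow> norm w < 1 / 3 \<longrightarrow> lambert 1 x w = C * theta w x * (\<Sum>k\<in>{0, 2, 3}. w ^ k * g k (w ^ 5))"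
    by (rule exI[of _ "numer x 1 / (1 - x)"],
        rule exI[of _ "\<lambda>k Q. if k = 0 then Q * ap 5 Q 1 3 / th 5 Q 2
          else if k = 2 then - ((Q * ap 5 Q 2 2 + ap 5 Q 1 0) / th 5 Q 2) else (ap 5 Q 1 2 - Q * ap 5 Q 2 3) / th 5 Q 1"])
       (simp add: lambert_V5[OF _ _ x] add.assoc)
qed auto

lemma equal_classes_U7: "n mod 7 \<in> {0, 5} \<Longrightarrow> divides_into_equal_classes u_rank 7 (quadruples_in U_set n)"
proof (rule equal_classes_of_dissection[OF rank_series_U subset_refl, where K = "{1, 2, 3, 4, 6}"])
  fix x :: complex assume x: "x ^ 7 = 1" "x \<noteq> 1"
  show "\<exists>C g. \<forall>w. 0 < norm w \<longrightarrow> norm w < 1 / 3 \<longrightarrow> lambert 0 x w = C * theta w x * (\<Sum>k\<in>{1, 2, 3, 4, 6}. w ^ k * g k (w ^ 7))"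
    by (rule exI[of _ "- (numer x 1 / (1 - x))"],
        rule exI[of _ "\<lambda>k Q. let K = ap 7 Q 1 0 * th 7 Q 1; a = x ^ 3 + x ^ 4; c = x + x ^ 6 in
          if k = 1 then K * th 7 Q 3 / (th 7 Q 1 * th 7 Q 2 ^ 2) + (1 + a + c) * Q ^ 2 * ap 7 Q 3 3 / th 7 Q 3
          else if k = 2 then - (a * K / (th 7 Q 1 * th 7 Q 2)) else if k = 3 then K / (th 7 Q 1 * th 7 Q 3)
          else if k = 4 then c * ap 7 Q 1 2 / th 7 Q 2 else - ((1 + a) * Q * ap 7 Q 2 4 / th 7 Q 3)"], unfold Let_def)
       (simp add: lambert_U7[OF _ _ x] algebra_simps)
qed auto

theorem theorem1p3:
  shows "(\<forall>m::int. \<forall>n::nat. n \<ge> 1 \<longrightarrow>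
            ru m n = int (card {Q \<in> quadruples_in U_set n. u_rank Q = m}) \<and>
            rv m n = int (card {Q \<in> quadruples_in V_set n. v_rank Q = m})) \<and>
         (\<forall>n::nat.
            divides_into_equal_classes u_rank 3 (quadruples_in U_set (3 * n)) \<and>
            divides_into_equal_classes v_rank 3 (quadruples_in V_set (3 * n + 1)) \<and>
            divides_into_equal_classes u_rank 5 (quadruples_in U_set (5 * n)) \<and>
            divides_into_equal_classes u_rank 5 (quadruples_in U_set (5 * n + 3)) \<and>
            divides_into_equal_classes v_rank 5 (quadruples_in V_set (5 * n + 1)) \<and>
            divides_into_equal_classes v_rank 5 (quadruples_in V_set (5 * n + 4)) \<and>
            divides_into_equal_classes u_rank 7 (quadruples_in U_set (7 * n)) \<and>
            divides_into_equal_classes u_rank 7 (quadruples_in U_set (7 * n + 5)))"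
proof (intro conjI allI impI)
  fix n :: nat
  have m: "(l * n + i) mod l = i" if "i < l" for i l :: nat
    using that by simp
  show "divides_into_equal_classes u_rank 3 (quadruples_in U_set (3 * n))"
    by (rule equal_classes_U3) simp
  show "divides_into_equal_classes v_rank 3 (quadruples_in V_set (3 * n + 1))"
    by (rule equal_classes_V3) (simp only: m)
  show "divides_into_equal_classes u_rank 5 (quadruples_in U_set (5 * n))"
    "divides_into_equal_classes u_rank 5 (quadruples_in U_set (5 * n + 3))"
    by (rule equal_classes_U5, simp add: m)+
  show "divides_into_equal_classes v_rank 5 (quadruples_in V_set (5 * n + 1))"
    "divides_into_equal_classes v_rank 5 (quadruples_in V_set (5 * n + 4))"
    using m[of 1 5] m[of 4 5] by (intro equal_classes_V5; simp)+
  show "divides_into_equal_classes u_rank 7 (quadruples_in U_set (7 * n))"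
    "divides_into_equal_classes u_rank 7 (quadruples_in U_set (7 * n + 5))"
    by (rule equal_classes_U7, simp add: m)+
qed (rule ru_eq rv_eq)+

end
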